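(* (Integral 3, generating function.) Let $n\ge1$, $p,q\ge0$ be integers, let $x=(x_1<\dots<x_n)$ and $y=(y_1<\dots<y_n)$ be strictly increasing tuples of nonnegative integers, and let $\lambda,\mu$ be the partitions with at most $n$ rows given by $\lambda_{n-j+1}=x_j-j+1$, $\mu_{n-j+1}=y_j-j+1$ for $j=1,\dots,n$. Let $b^{(k)}_{xy}$ be $k!$ times the number of ways that $n$ non-intersecting walkers in $\mathbb Z$ move during $p+q$ instants from $x_1<\dots<x_n$ to $y_1<\dots<y_n$, where at each of the instants $1,\dots,p$ walkers may move one step to the right or stay put, and at each of the instants $p+1,\dots,p+q$ walkers may move one step to the left or stay put, with total number of effective moves equal to $k$. Then $$\sum_{k\ge0}\frac{z^k}{k!}b^{(k)}_{xy}=\int_{U(n)}\mathbf s_\lambda(M)\mathbf s_\mu(\bar M)\det(I+zM)^p\det(I+z\bar M)^q\,dM=:a_{\lambda\mu}(z).$$ Furthermore, a generating function for the $a_{\lambda\mu}$'s is $$\sum_{\lambda,\mu:\ \lambda_1^\top,\mu_1^\top\le n}a_{\lambda\mu}(z)\,\mathbf s_\lambda(t)\,\mathbf s_\mu(-s)=\int_{U(n)}\det(I+zM)^p\det(I+z\bar M)^qe^{\sum_{i\ge1}\operatorname{Tr}(t_iM^i-s_i\bar M^i)}\,dM.$$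
   Context: $dM$ is normalized Haar measure on the unitary group $U(n)$, $\bar M$ the complex conjugate of $M$. The elementary Schur polynomials are defined by $e^{\sum_{i\ge1}t_iz^i}=\sum_{k\ge0}\mathbf s_k(t)z^k$, $\mathbf s_k=0$ for $k<0$; $\mathbf s_\lambda(t)=\det(\mathbf s_{\lambda_i-i+j}(t))$. For a matrix $M$, $\mathbf s_\lambda(M):=\mathbf s_\lambda(\operatorname{Tr}M,\frac12\operatorname{Tr}M^2,\dots)$, i.e. the Schur function of the eigenvalues of $M$. $\lambda_1^\top$ is the number of rows of $\lambda$. The last identity is one of formal power series in $t=(t_1,t_2,\dots)$, $s=(s_1,s_2,\dots)$. Walks: at an instant where walkers "may move one step to the right (left) or stay put", any subset of the walkers (possibly empty) moves simultaneously one unit to the right (left). Non-intersecting means that after each instant the positions are strictly increasing. The number of effective moves counts all individual unit moves made by all walkers (two walkers moving simultaneously count for two, a walker staying put contributes nothing). *)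

theory Defs
  imports
    "Jordan_Normal_Form.Determinant"
    "HOL-Library.Poly_Mapping"
    "HOL-Probability.Probability_Measure"
begin

section \<open>Formal power series in arbitrarily many variables\<close>

text \<open>A series is its family of coefficients, indexed by the finitely supported exponent
  vectors; no finiteness is required of the family itself.\<close>

typedef 'v mfps = "UNIV :: (('v \<Rightarrow>\<^sub>0 nat) \<Rightarrow> complex) set"
  morphisms mcoeff Abs_mfps by simp

lemma mcoeff_Abs [simp]: "mcoeff (Abs_mfps f) = f"
  by (simp add: Abs_mfps_inverse)

lemma mfps_eqI: "(\<And>a. mcoeff f a = mcoeff g a) \<Longrightarrow> f = g"
  by (simp add: mcoeff_inject[symmetric] fun_eq_iff)

lemma finite_exponent_le:
  fixes a :: "'v \<Rightarrow>\<^sub>0 nat"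
  shows "finite {b. \<exists>c. b + c = a}"
proof (rule finite_imageD)
  let ?f = "\<lambda>b :: 'v \<Rightarrow>\<^sub>0 nat. restrict (Poly_Mapping.lookup b) (Poly_Mapping.keys a)"
  show "finite (?f ` {b. \<exists>c. b + c = a})"
  proof (rule finite_subset)
    show "?f ` {b. \<exists>c. b + c = a} \<subseteq> (\<Pi>\<^sub>E v\<in>Poly_Mapping.keys a. {..Poly_Mapping.lookup a v})"
      by (auto simp: lookup_add)
    show "finite (\<Pi>\<^sub>E v\<in>Poly_Mapping.keys a. {..Poly_Mapping.lookup a v})"
      by (intro finite_PiE) (auto simp: finite_keys)
  qed
  show "inj_on ?f {b. \<exists>c. b + c = a}"
  proof (rule inj_onI)
    fix b b' :: "'v \<Rightarrow>\<^sub>0 nat"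
    assume "b \<in> {b. \<exists>c. b + c = a}" "b' \<in> {b. \<exists>c. b + c = a}" and eq: "?f b = ?f b'"
    then obtain c c' where a: "b + c = a" "b' + c' = a" by blast
    show "b = b'"
    proof (rule poly_mapping_eqI)
      fix v
      show "Poly_Mapping.lookup b v = Poly_Mapping.lookup b' v"
      proof (cases "v \<in> Poly_Mapping.keys a")
        case True
        then show ?thesis using fun_cong[OF eq, of v] by simp
      next
        case False
        then have "Poly_Mapping.lookup a v = 0" by (simp add: in_keys_iff)
        then have "Poly_Mapping.lookup (b + c) v = 0" "Poly_Mapping.lookup (b' + c') v = 0"
          using a by simp_all
        then show ?thesis by (simp add: lookup_add)
      qed
    qed
  qed
qed

lemma finite_exponent_pairs:
  fixes a :: "'v \<Rightarrow>\<^sub>0 nat"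
  shows "finite {(b, c). b + c = a}"
proof (rule finite_subset)
  show "{(b, c). b + c = a} \<subseteq> {b. \<exists>c. b + c = a} \<times> {b. \<exists>c. b + c = a}"
    by (auto intro: add.commute)
  show "finite ({b. \<exists>c. b + c = a} \<times> {b. \<exists>c. b + c = a})"
    by (simp add: finite_exponent_le)
qed

instantiation mfps :: (type) comm_ring_1
begin

definition "0 = Abs_mfps (\<lambda>_. 0)"
definition "1 = Abs_mfps (\<lambda>a. if a = 0 then 1 else 0)"
definition "f + g = Abs_mfps (\<lambda>a. mcoeff f a + mcoeff g a)"
definition "f - g = Abs_mfps (\<lambda>a. mcoeff f a - mcoeff g a)"
definition "- f = Abs_mfps (\<lambda>a. - mcoeff f a)"
definition "f * g = Abs_mfps (\<lambda>a. \<Sum>(b, c)\<in>{(b, c). b + c = a}. mcoeff f b * mcoeff g c)"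

lemma mcoeff_simps [simp]:
  "mcoeff 0 a = 0"
  "mcoeff 1 a = (if a = 0 then 1 else 0)"
  "mcoeff (f + g) a = mcoeff f a + mcoeff g a"
  "mcoeff (f - g) a = mcoeff f a - mcoeff g a"
  "mcoeff (- f) a = - mcoeff f a"
  by (simp_all add: zero_mfps_def one_mfps_def plus_mfps_def minus_mfps_def uminus_mfps_def)

lemma mcoeff_mult:
  "mcoeff (f * g) a = (\<Sum>(b, c)\<in>{(b, c). b + c = a}. mcoeff f b * mcoeff g c)"
  by (simp add: times_mfps_def)

instance
proof
  fix f g h :: "'a mfps"
  show "f * g * h = f * (g * h)"
  proof (rule mfps_eqI)
    fix a :: "'a \<Rightarrow>\<^sub>0 nat"
    let ?t = "\<lambda>(b, c, d). mcoeff f b * mcoeff g c * mcoeff h d"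
    let ?P = "\<lambda>a. {(b, c). b + c = (a :: 'a \<Rightarrow>\<^sub>0 nat)}"
    have "mcoeff (f * g * h) a
        = (\<Sum>p\<in>?P a. \<Sum>q\<in>?P (fst p). mcoeff f (fst q) * mcoeff g (snd q) * mcoeff h (snd p))"
      by (simp add: mcoeff_mult case_prod_beta sum_distrib_right)
    also have "\<dots> = (\<Sum>(p, q)\<in>Sigma (?P a) (\<lambda>p. ?P (fst p)).
        mcoeff f (fst q) * mcoeff g (snd q) * mcoeff h (snd p))"
      by (rule sum.Sigma) (auto simp: finite_exponent_pairs)
    also have "\<dots> = (\<Sum>x\<in>{(b, c, d). b + c + d = a}. ?t x)"
      by (rule sum.reindex_bij_witness[where i = "\<lambda>(b, c, d). ((b + c, d), (b, c))"
            and j = "\<lambda>(p, q). (fst q, snd q, snd p)"]) auto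
    finally have L: "mcoeff (f * g * h) a = (\<Sum>x\<in>{(b, c, d). b + c + d = a}. ?t x)" .
    have "mcoeff (f * (g * h)) a
        = (\<Sum>p\<in>?P a. \<Sum>q\<in>?P (snd p). mcoeff f (fst p) * mcoeff g (fst q) * mcoeff h (snd q))"
      by (simp add: mcoeff_mult case_prod_beta sum_distrib_left mult.assoc)
    also have "\<dots> = (\<Sum>(p, q)\<in>Sigma (?P a) (\<lambda>p. ?P (snd p)).
        mcoeff f (fst p) * mcoeff g (fst q) * mcoeff h (snd q))"
      by (rule sum.Sigma) (auto simp: finite_exponent_pairs)
    also have "\<dots> = (\<Sum>x\<in>{(b, c, d). b + c + d = a}. ?t x)"
      by (rule sum.reindex_bij_witness[where i = "\<lambda>(b, c, d). ((b, c + d), (c, d))"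
            and j = "\<lambda>(p, q). (fst p, fst q, snd q)"]) (auto simp: add.assoc)
    finally show "mcoeff (f * g * h) a = mcoeff (f * (g * h)) a" using L by simp
  qed
  show "f * g = g * f"
  proof (rule mfps_eqI)
    fix a :: "'a \<Rightarrow>\<^sub>0 nat"
    show "mcoeff (f * g) a = mcoeff (g * f) a"
      unfolding mcoeff_mult
      by (rule sum.reindex_bij_witness[where i = prod.swap and j = prod.swap])
        (auto simp: add.commute mult.commute)
  qed
  show "1 * f = f"
  proof (rule mfps_eqI)
    fix a :: "'a \<Rightarrow>\<^sub>0 nat"
    have "mcoeff (1 * f) a = (\<Sum>(b, c)\<in>{(0, a)}. mcoeff 1 b * mcoeff f c)"
      unfolding mcoeff_mult
      by (rule sum.mono_neutral_right) (auto simp: finite_exponent_pairs split: if_splits)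
    then show "mcoeff (1 * f) a = mcoeff f a" by simp
  qed
  show "(f + g) * h = f * h + g * h"
    by (rule mfps_eqI)
      (simp add: mcoeff_mult case_prod_beta distrib_right sum.distrib)
  show "(0 :: 'a mfps) \<noteq> 1"
  proof
    assume "(0 :: 'a mfps) = 1"
    then have "mcoeff (0 :: 'a mfps) 0 = mcoeff 1 0" by simp
    then show False by simp
  qed
qed (auto intro!: mfps_eqI)

end

instantiation mfps :: (type) real_algebra_1
begin

definition "r *\<^sub>R f = Abs_mfps (\<lambda>a. r *\<^sub>R mcoeff f a)"

lemma mcoeff_scaleR [simp]: "mcoeff (r *\<^sub>R f) a = r *\<^sub>R mcoeff f a"
  by (simp add: scaleR_mfps_def)

instance
proof
  fix r :: real and f g :: "'a mfps"
  show "r *\<^sub>R f * g = r *\<^sub>R (f * g)" "f * r *\<^sub>R g = r *\<^sub>R (f * g)"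
    by (rule mfps_eqI,
        simp add: mcoeff_mult case_prod_beta scaleR_right.sum)+
qed (auto intro!: mfps_eqI simp: algebra_simps)

end

definition mconst :: "complex \<Rightarrow> 'v mfps" where
  "mconst c = Abs_mfps (\<lambda>a. if a = 0 then c else 0)"

definition mvar :: "'v \<Rightarrow> 'v mfps" where
  "mvar v = Abs_mfps (\<lambda>a. if a = Poly_Mapping.single v 1 then 1 else 0)"

text \<open>An infinite sum of series makes sense when every monomial occurs in only finitely many
  terms; \<^term>\<open>has_msum\<close> includes this condition, while \<^term>\<open>msum\<close> is meaningful only
  under it.\<close>

definition msum :: "('i \<Rightarrow> 'v mfps) \<Rightarrow> 'i set \<Rightarrow> 'v mfps" where
  "msum f I = Abs_mfps (\<lambda>a. \<Sum>i | i \<in> I \<and> mcoeff (f i) a \<noteq> 0. mcoeff (f i) a)"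

definition has_msum :: "('i \<Rightarrow> 'v mfps) \<Rightarrow> 'i set \<Rightarrow> 'v mfps \<Rightarrow> bool" where
  "has_msum f I s \<longleftrightarrow> (\<forall>a. finite {i \<in> I. mcoeff (f i) a \<noteq> 0}) \<and> s = msum f I"

text \<open>Meaningful for series without constant term.\<close>

definition mexp :: "'v mfps \<Rightarrow> 'v mfps" where
  "mexp f = msum (\<lambda>k. (1 / fact k) *\<^sub>R f ^ k) UNIV"

definition mintegral :: "'m measure \<Rightarrow> ('m \<Rightarrow> 'v mfps) \<Rightarrow> 'v mfps" where
  "mintegral H F = Abs_mfps (\<lambda>a. \<integral>M. mcoeff (F M) a \<partial>H)"

section \<open>Partitions and Schur polynomials\<close>

text \<open>Parts are numbered from 1; the unused value at 0 is set to 0, so that each partition is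
  represented by exactly one function.\<close>

definition is_partition :: "(nat \<Rightarrow> nat) \<Rightarrow> bool" where
  "is_partition lam \<longleftrightarrow>
     lam 0 = 0 \<and> (\<forall>i\<ge>1. lam (i + 1) \<le> lam i) \<and> finite {i. lam i \<noteq> 0}"

definition num_rows :: "(nat \<Rightarrow> nat) \<Rightarrow> nat" where
  "num_rows lam = card {i. 1 \<le> i \<and> lam i \<noteq> 0}"

text \<open>Here \<open>t i\<close> for \<open>i \<ge> 1\<close> are elements of an arbitrary commutative real algebra, so that
  the same definition applies to numbers and to formal variables; \<open>t 0\<close> is ignored.\<close>

definition elem_schur :: "(nat \<Rightarrow> 'a) \<Rightarrow> int \<Rightarrow> 'a::{comm_ring_1,real_algebra_1}" where
  "elem_schur t k =
     (if k < 0 then 0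
      else fps_nth (Abs_fps (\<lambda>m. (1 / fact m) *\<^sub>R 1) oo Abs_fps (\<lambda>i. if i = 0 then 0 else t i))
             (nat k))"

definition schur :: "(nat \<Rightarrow> nat) \<Rightarrow> (nat \<Rightarrow> 'a) \<Rightarrow> 'a::{comm_ring_1,real_algebra_1}" where
  "schur lam t =
     Determinant.det (Matrix.mat (num_rows lam) (num_rows lam)
       (\<lambda>(i, j). elem_schur t (int (lam (i + 1)) - int i + int j)))"

section \<open>The unitary group\<close>

definition unitary_group :: "(complex^'n^'n) set" where
  "unitary_group =
     {M. M ** map_matrix cnj (Finite_Cartesian_Product.transpose M) = Finite_Cartesian_Product.mat 1
       \<and> map_matrix cnj (Finite_Cartesian_Product.transpose M) ** M = Finite_Cartesian_Product.mat 1}"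

definition normalized_haar :: "(complex^'n^'n) measure \<Rightarrow> bool" where
  "normalized_haar H \<longleftrightarrow>
     prob_space H \<and>
     space H = unitary_group \<and>
     sets H = sets (restrict_space borel unitary_group) \<and>
     (\<forall>U\<in>unitary_group. distr H H (\<lambda>M. U ** M) = H)"

text \<open>The power operation of the library on \<^typ>\<open>complex^'n^'n\<close> is entrywise.\<close>

primrec matpow :: "complex^'n^'n \<Rightarrow> nat \<Rightarrow> complex^'n^'n" where
  "matpow M 0 = Finite_Cartesian_Product.mat 1"
| "matpow M (Suc k) = M ** matpow M k"

definition mat_conj :: "complex^'n^'n \<Rightarrow> complex^'n^'n" where
  "mat_conj M = map_matrix cnj M"

definition schur_mat :: "(nat \<Rightarrow> nat) \<Rightarrow> complex^'n^'n \<Rightarrow> complex" where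
  "schur_mat lam M = schur lam (\<lambda>i. Determinants.trace (matpow M i) / of_nat i)"

definition det_weight :: "nat \<Rightarrow> nat \<Rightarrow> complex \<Rightarrow> complex^'n^'n \<Rightarrow> complex" where
  "det_weight p q z M =
     Determinants.det (Finite_Cartesian_Product.mat 1 + map_matrix (\<lambda>c. z * c) M) ^ p *
     Determinants.det (Finite_Cartesian_Product.mat 1 + map_matrix (\<lambda>c. z * c) (mat_conj M)) ^ q"

definition a_coeff ::
  "(complex^'n^'n) measure \<Rightarrow> nat \<Rightarrow> nat \<Rightarrow> (nat \<Rightarrow> nat) \<Rightarrow> (nat \<Rightarrow> nat) \<Rightarrow> complex \<Rightarrow> complex" where
  "a_coeff H p q lam mu z =
     (\<integral>M. schur_mat lam M * schur_mat mu (mat_conj M) * det_weight p q z M \<partial>H)"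

section \<open>The two families of variables\<close>

datatype ts_var = T_var nat | S_var nat

abbreviation t_var :: "nat \<Rightarrow> ts_var mfps" where "t_var i \<equiv> mvar (T_var i)"
abbreviation s_var :: "nat \<Rightarrow> ts_var mfps" where "s_var i \<equiv> mvar (S_var i)"

definition trace_exponent :: "complex^'n^'n \<Rightarrow> ts_var mfps" where
  "trace_exponent M =
     msum (\<lambda>i. Determinants.trace
                 (map_matrix (\<lambda>c. t_var i * mconst c) (matpow M i)
                  - map_matrix (\<lambda>c. s_var i * mconst c) (matpow (mat_conj M) i)))
       {1..}"

section \<open>Non-intersecting walkers\<close>

text \<open>\<open>w (t, j)\<close> is the position of walker \<open>j\<close> after instant \<open>t\<close>; \<open>t = 0\<close> is the start.\<close>

definition walks ::
  "nat \<Rightarrow> nat \<Rightarrow> nat \<Rightarrow> (nat \<Rightarrow> nat) \<Rightarrow> (nat \<Rightarrow> nat) \<Rightarrow> nat \<Rightarrow> (nat \<times> nat \<Rightarrow> int) set" where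
  "walks n p q x y k =
     {w \<in> ({0..p + q} \<times> {1..n}) \<rightarrow>\<^sub>E UNIV.
        (\<forall>j\<in>{1..n}. w (0, j) = int (x j) \<and> w (p + q, j) = int (y j)) \<and>
        (\<forall>t\<in>{0..p + q}. strict_mono_on {1..n} (\<lambda>j. w (t, j))) \<and>
        (\<forall>t\<in>{1..p}. \<forall>j\<in>{1..n}. w (t, j) - w (t - 1, j) \<in> {0, 1}) \<and>
        (\<forall>t\<in>{p + 1..p + q}. \<forall>j\<in>{1..n}. w (t, j) - w (t - 1, j) \<in> {0, - 1}) \<and>
        (\<Sum>t = 1..p + q. \<Sum>j = 1..n. \<bar>w (t, j) - w (t - 1, j)\<bar>) = int k}"

definition b_coeff ::
  "nat \<Rightarrow> nat \<Rightarrow> nat \<Rightarrow> (nat \<Rightarrow> nat) \<Rightarrow> (nat \<Rightarrow> nat) \<Rightarrow> nat \<Rightarrow> nat" where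
  "b_coeff n p q x y k = fact k * card (walks n p q x y k)"

end

theory Submission
  imports Defs "Jordan_Normal_Form.Schur_Decomposition"
begin

text \<open>Everything rests on the orthonormality of Schur functions under Haar measure, which is proved
  without the Weyl integration formula. For a polynomial class function \<open>F\<close> and any monomial, the
  integrals of \<open>F(M) (M\<^sup>* X)\<^sup>A\<close> and \<open>F(X M) (M\<^sup>*)\<^sup>A\<close> agree for unitary \<open>X\<close> by left invariance, hence for
  all \<open>X\<close>, since unitary matrices are dense for polynomials. Comparing the coefficients of \<open>X\<^sup>A\<close> and
  summing over \<open>A\<close> turns the left-hand sides into products of traces on symmetric powers, and the
  right-hand sides into \<open>F(M\<^sup>* diag(u) M) = F(diag(u))\<close>; so integration against
  \<open>\<Prod>\<^sub>j \<Sum>\<^sub>k u\<^sub>j\<^sup>k h\<^sub>k\<close> of the conjugate eigenvalues evaluates \<open>F\<close> at \<open>diag(u)\<close>. Multiplying by the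
  Vandermonde determinant of \<open>u\<close> and reading off coefficients gives orthonormality.

  The first claim follows because the Pieri rule for multiplication by \<open>det(I + zM)\<close> is the
  recursion for a single step of the walkers; the second is the Cauchy identity in \<open>t\<close> and in \<open>s\<close>,
  integrated coefficientwise.\<close>

section \<open>Polynomial functions in finitely many complex variables\<close>

text \<open>The unitary group is compact, so its density is of Zariski type. The matrices
  \<open>g\<close> whose right translation keeps polynomials vanishing on it form a multiplicative
  set closed under limits. This set contains the unitary diagonal matrices, hence all diagonal ones,
  since a polynomial vanishing on a torus is zero; then transvections as limits, and with them every
  real invertible matrix. These leave no room for a nonzero polynomial. Three devices recur. Linear
  operations that must commute with the integral are made finite: coefficients are read off by sums
  over roots of unity, and generating series are cut at a degree \<open>K\<close> above every
  exponent in play. Eigenvalue identities come from matrices degenerating to diagonal ones, and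
  division by the Vandermonde determinant takes place at distinct arguments only, the rest being
  continuity. A partition is replaced by the strictly increasing sequence of its parts plus a
  staircase, which serves at once as exponents of an alternant, row indices of a Jacobi--Trudi
  determinant and positions of walkers.\<close>

definition monom_fun :: "('v::finite \<Rightarrow> nat) \<Rightarrow> ('v \<Rightarrow> complex) \<Rightarrow> complex" where
  "monom_fun a x = (\<Prod>v\<in>UNIV. x v ^ a v)"

text \<open>Generation by monomials and sums reduces linear assertions, such as the expansion into
  coefficients, to a single monomial. The bound \<open>d\<close> decides how many roots of unity
  \<open>coeff_at\<close> has to sample.\<close>

inductive poly_fun :: "nat \<Rightarrow> (('v::finite \<Rightarrow> complex) \<Rightarrow> complex) \<Rightarrow> bool" for d where
  monom: "sum a UNIV \<le> d \<Longrightarrow> poly_fun d (\<lambda>x. c * monom_fun a x)"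
| add: "poly_fun d F \<Longrightarrow> poly_fun d G \<Longrightarrow> poly_fun d (\<lambda>x. F x + G x)"

lemma poly_fun_const [simp]: "poly_fun d (\<lambda>_. c)"
  using poly_fun.monom[of "\<lambda>_. 0" d c] by (simp add: monom_fun_def)

lemma poly_fun_var:
  assumes "1 \<le> d"
  shows "poly_fun d (\<lambda>x. x v)"
proof -
  have "monom_fun (\<lambda>w. if w = v then 1 else 0) x = x v" for x
  proof -
    have "monom_fun (\<lambda>w. if w = v then 1 else 0) x = (\<Prod>w\<in>UNIV. if w = v then x w else 1)"
      unfolding monom_fun_def by (rule prod.cong) auto
    then show ?thesis by simp
  qed
  then show ?thesis
    using poly_fun.monom[of "\<lambda>w. if w = v then 1 else 0" d 1] assms by simp
qed

lemma poly_fun_mono: "poly_fun d F \<Longrightarrow> d \<le> e \<Longrightarrow> poly_fun e F"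
  by (induction rule: poly_fun.induct) (auto intro: poly_fun.intros)

lemma monom_fun_add: "monom_fun (\<lambda>v. a v + b v) x = monom_fun a x * monom_fun b x"
  by (simp add: monom_fun_def power_add prod.distrib)

lemma poly_fun_mult:
  assumes "poly_fun d F" "poly_fun e G"
  shows "poly_fun (d + e) (\<lambda>x. F x * G x)"
  using assms(1)
proof (induction rule: poly_fun.induct)
  case (monom a c)
  show ?case using assms(2)
  proof (induction rule: poly_fun.induct)
    case (monom b c')
    have "poly_fun (d + e) (\<lambda>x. (c * c') * monom_fun (\<lambda>v. a v + b v) x)"
      using monom \<open>sum a UNIV \<le> d\<close> by (intro poly_fun.monom) (simp add: sum.distrib)
    then show ?case by (simp add: monom_fun_add mult_ac)
  next
    case (add F G)
    then show ?case by (simp add: distrib_left poly_fun.add)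
  qed
next
  case (add F G)
  then show ?case by (simp add: distrib_right poly_fun.add)
qed

lemma poly_fun_sum:
  assumes "\<And>i. i \<in> I \<Longrightarrow> poly_fun d (F i)"
  shows "poly_fun d (\<lambda>x. \<Sum>i\<in>I. F i x)"
  using assms by (induction I rule: infinite_finite_induct) (auto intro: poly_fun.add)

lemma poly_fun_prod:
  assumes "finite I" "\<And>i. i \<in> I \<Longrightarrow> poly_fun (d i) (F i)"
  shows "poly_fun (\<Sum>i\<in>I. d i) (\<lambda>x. \<Prod>i\<in>I. F i x)"
  using assms by (induction I rule: finite_induct) (auto intro: poly_fun_mult)

lemma poly_fun_power: "poly_fun d F \<Longrightarrow> poly_fun (k * d) (\<lambda>x. F x ^ k)"
  by (induction k) (auto intro: poly_fun_mult)

lemma poly_fun_scale: "poly_fun d F \<Longrightarrow> poly_fun d (\<lambda>x. c * F x)"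
  using poly_fun_mult[OF poly_fun_const[of 0 c], of d F] by simp

lemma poly_fun_scale_right: "poly_fun d F \<Longrightarrow> poly_fun d (\<lambda>x. F x * c)"
  using poly_fun_scale[of d F c] by (simp add: mult.commute)

lemma poly_fun_monom: "sum a UNIV \<le> d \<Longrightarrow> poly_fun d (monom_fun a)"
  using poly_fun.monom[of a d 1] by simp

text \<open>Affine substitutions do not raise the degree bound. This covers multiplication by a
  fixed matrix as well as restriction to a line.\<close>

lemma poly_fun_compose:
  fixes G :: "('v::finite \<Rightarrow> complex) \<Rightarrow> complex" and L :: "'v \<Rightarrow> ('w::finite \<Rightarrow> complex) \<Rightarrow> complex"
  assumes "poly_fun d G" "\<And>v. poly_fun 1 (L v)"
  shows "poly_fun d (\<lambda>x. G (\<lambda>v. L v x))"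
  using assms(1)
proof (induction rule: poly_fun.induct)
  case (monom a c)
  have "poly_fun (\<Sum>v\<in>UNIV. a v * 1) (\<lambda>x. \<Prod>v\<in>UNIV. L v x ^ a v)"
    by (intro poly_fun_prod poly_fun_power assms) simp_all
  then have "poly_fun d (\<lambda>x. \<Prod>v\<in>UNIV. L v x ^ a v)"
    by (rule poly_fun_mono) (use monom in simp)
  then show ?case unfolding monom_fun_def by (rule poly_fun_scale)
next
  case (add F G)
  show ?case by (rule poly_fun.add[OF add.IH])
qed

lemma poly_fun_line:
  assumes "poly_fun d G"
  shows "\<exists>p. \<forall>t. G (x(v := t)) = poly p t"
  using assms
proof (induction rule: poly_fun.induct)
  case (monom a c)
  have "c * monom_fun a (x(v := t)) = poly (Polynomial.monom (c * (\<Prod>w\<in>UNIV - {v}. x w ^ a w)) (a v)) t" for t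
    unfolding monom_fun_def
    by (subst prod.remove[of _ v]) (auto simp: poly_monom intro!: prod.cong)
  then show ?case by blast
next
  case (add F G)
  then obtain p q where "\<forall>t. F (x(v := t)) = poly p t" "\<forall>t. G (x(v := t)) = poly q t" by blast
  then have "\<forall>t. F (x(v := t)) + G (x(v := t)) = poly (p + q) t" by simp
  then show ?case by blast
qed

text \<open>One coordinate at a time is freed from \<open>S\<close>: along it \<open>G\<close> is a
  polynomial in one variable whose roots include the infinite set \<open>S\<close>.\<close>

lemma poly_fun_zero_extend:
  fixes G :: "('v::finite \<Rightarrow> complex) \<Rightarrow> complex"
  assumes G: "poly_fun d G" and S: "infinite S" and zero: "\<And>x. (\<And>v. x v \<in> S) \<Longrightarrow> G x = 0"
  shows "G x = 0"
proof -
  have "finite I \<Longrightarrow> (\<And>v. v \<notin> I \<Longrightarrow> x v \<in> S) \<Longrightarrow> G x = 0" for I :: "'v set" and x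
  proof (induction I arbitrary: x rule: finite_induct)
    case empty
    then show ?case using zero by simp
  next
    case (insert v I)
    obtain p where p: "\<And>t. G (x(v := t)) = poly p t" using poly_fun_line[OF G] by blast
    have "poly p t = 0" if "t \<in> S" for t
      unfolding p[symmetric] by (rule insert.IH) (use insert.prems that in auto)
    then have "S \<subseteq> {t. poly p t = 0}" by blast
    then have "p = 0" using S poly_roots_finite finite_subset by metis
    then show ?case using p[of "x v"] by simp
  qed
  from this[of UNIV x] show ?thesis by simp
qed

section \<open>Extraction of coefficients by roots of unity\<close>

lemma sum_cis_root_of_unity:
  assumes "0 < N" "\<bar>m\<bar> < int N"
  shows "(\<Sum>k<N. cis (2 * pi * real k * of_int m / real N)) = (if m = 0 then of_nat N else 0)"
proof (cases "m = 0")
  case False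
  let ?w = "cis (2 * pi * of_int m / real N)"
  have pow: "?w ^ k = cis (2 * pi * real k * of_int m / real N)" for k
    unfolding Complex.DeMoivre by (rule arg_cong[where f = cis]) (simp add: mult_ac)
  \<comment> \<open>Otherwise \<open>N\<close> would divide the nonzero integer \<open>m\<close>,
    contradicting the bound on its absolute value.\<close>
  have "?w \<noteq> 1"
  proof
    assume "?w = 1"
    then have "cos (2 * pi * of_int m / real N) = 1"
      by (metis cis.simps(1) one_complex.simps(1))
    then obtain j where "2 * pi * of_int m / real N = of_int j * 2 * pi"
      using cos_one_2pi_int by blast
    then have "of_int m = of_int j * real N" using assms by (simp add: field_simps)
    then have mj: "m = j * int N"
      by (metis of_int_eq_iff of_int_mult of_int_of_nat_eq)
    then have "j \<noteq> 0" using False by auto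
    then have "int N \<le> \<bar>m\<bar>" using mj mult_right_mono[of 1 "\<bar>j\<bar>" "int N"] by (simp add: abs_mult)
    then show False using assms by simp
  qed
  moreover have "?w ^ N = 1"
    using assms by (simp add: Complex.DeMoivre cis_multiple_2pi)
  ultimately have "(\<Sum>k<N. ?w ^ k) = 0" by (simp add: geometric_sum)
  then show ?thesis using False by (simp add: pow)
qed simp

text \<open>Reads off a coefficient of a polynomial with all exponents below \<open>N\<close> as a finite linear
  combination of its values, so that it commutes with integration over parameters.\<close>

definition coeff_at :: "nat \<Rightarrow> ('v::finite \<Rightarrow> nat) \<Rightarrow> (('v \<Rightarrow> complex) \<Rightarrow> complex) \<Rightarrow> complex" where
  "coeff_at N a G =
     (\<Sum>e\<in>UNIV \<rightarrow>\<^sub>E {..<N}. (\<Prod>v\<in>UNIV. cis (- (2 * pi * real (e v) * real (a v) / real N)) / of_nat N)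
        * G (\<lambda>v. cis (2 * pi * real (e v) / real N)))"

lemma coeff_at_add: "coeff_at N a (\<lambda>x. F x + G x) = coeff_at N a F + coeff_at N a G"
  by (simp add: coeff_at_def distrib_left sum.distrib)

lemma coeff_at_scale: "coeff_at N a (\<lambda>x. c * F x) = c * coeff_at N a F"
  by (simp add: coeff_at_def sum_distrib_left mult_ac)

lemma coeff_at_sum: "finite I \<Longrightarrow> coeff_at N a (\<lambda>x. \<Sum>i\<in>I. F i x) = (\<Sum>i\<in>I. coeff_at N a (F i))"
  unfolding coeff_at_def sum_distrib_left by (rule sum.swap)

text \<open>The sum factors over the variables into orthogonality relations for characters of the
  integers modulo \<open>N\<close>. Exponents below \<open>N\<close> are congruent only if
  equal.\<close>

lemma coeff_at_monom:
  assumes N: "0 < N" and a: "\<And>v. a v < N" and b: "\<And>v. b v < N"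
  shows "coeff_at N a (monom_fun b) = (if a = b then 1 else 0)"
proof -
  have eq: "cis (- (2 * pi * real k * real m / real N)) / of_nat N * cis (2 * pi * real k / real N) ^ l
      = cis (2 * pi * real k * of_int (int l - int m) / real N) / of_nat N" for k l m
  proof -
    have "cis (- (2 * pi * real k * real m / real N)) * cis (2 * pi * real k / real N) ^ l
        = cis (2 * pi * real k * of_int (int l - int m) / real N)"
      unfolding Complex.DeMoivre cis_mult
      by (rule arg_cong[where f = cis]) (simp add: divide_simps, simp add: algebra_simps)
    then show ?thesis by (simp del: of_int_diff)
  qed
  have "coeff_at N a (monom_fun b)
      = (\<Sum>e\<in>UNIV \<rightarrow>\<^sub>E {..<N}. \<Prod>v\<in>UNIV. cis (2 * pi * real (e v) * of_int (int (b v) - int (a v)) / real N) / of_nat N)"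
    unfolding coeff_at_def monom_fun_def prod.distrib[symmetric] eq ..
  also have "\<dots> = (\<Prod>v\<in>UNIV. \<Sum>k<N. cis (2 * pi * real k * of_int (int (b v) - int (a v)) / real N) / of_nat N)"
    by (rule prod_sum_PiE[symmetric]) auto
  also have "\<dots> = (\<Prod>v\<in>UNIV. if a v = b v then 1 else 0)"
  proof (rule prod.cong[OF refl])
    fix v
    have "\<bar>int (b v) - int (a v)\<bar> < int N" using a[of v] b[of v] by linarith
    from sum_cis_root_of_unity[OF N this]
    show "(\<Sum>k<N. cis (2 * pi * real k * of_int (int (b v) - int (a v)) / real N) / of_nat N)
        = (if a v = b v then 1 else (0::complex))"
      using N by (simp add: sum_divide_distrib[symmetric])
  qed
  also have "\<dots> = (if a = b then 1 else 0)"
  proof (cases "a = b")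
    case False
    then obtain v where "a v \<noteq> b v" by blast
    then show ?thesis using False by (auto intro: prod_zero)
  qed simp
  finally show ?thesis .
qed

text \<open>\<open>S\<close> may exceed the exponents of degree at most \<open>d\<close>, so that a
  product set with one bound per column of a matrix can be used.\<close>

lemma poly_fun_expand:
  assumes G: "poly_fun d G" and S: "finite S" "{a. sum a UNIV \<le> d} \<subseteq> S"
    and N: "\<And>a v. a \<in> S \<Longrightarrow> a v < N"
  shows "G x = (\<Sum>a\<in>S. coeff_at N a G * monom_fun a x)"
  using G
proof (induction rule: poly_fun.induct)
  case (monom b c)
  then have b: "b \<in> S" using S by blast
  have "0 < N" using N[OF b, of undefined] by simp
  have "(\<Sum>a\<in>S. coeff_at N a (\<lambda>x. c * monom_fun b x) * monom_fun a x)
      = (\<Sum>a\<in>S. if a = b then c * monom_fun b x else 0)"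
  proof (rule sum.cong[OF refl])
    fix a assume "a \<in> S"
    have "coeff_at N a (monom_fun b) = (if a = b then 1 else 0)"
      by (rule coeff_at_monom[OF \<open>0 < N\<close>]) (use N b \<open>a \<in> S\<close> in auto)
    then show "coeff_at N a (\<lambda>x. c * monom_fun b x) * monom_fun a x = (if a = b then c * monom_fun b x else 0)"
      by (simp add: coeff_at_scale)
  qed
  then show ?case using b S by simp
next
  case (add F G)
  then show ?case by (simp add: coeff_at_add distrib_right sum.distrib)
qed

lemma finite_sum_le: "finite {a :: 'v::finite \<Rightarrow> nat. sum a UNIV \<le> d}"
proof (rule finite_subset)
  show "{a :: 'v \<Rightarrow> nat. sum a UNIV \<le> d} \<subseteq> UNIV \<rightarrow>\<^sub>E {..d}"
    by (auto intro: order_trans[OF member_le_sum[of _ UNIV]])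
qed (auto intro!: finite_PiE)

no_notation Matrix.vec_index (infixl \<open>$\<close> 100)
hide_const (open) Matrix.mat Matrix.row Matrix.col Matrix.vec Determinant.det

section \<open>Unitary matrices are dense for polynomials\<close>

definition mat_of :: "('n \<times> 'n \<Rightarrow> complex) \<Rightarrow> complex^'n^'n" where
  "mat_of f = (\<chi> i j. f (i, j))"

definition entries :: "complex^'n^'n \<Rightarrow> 'n \<times> 'n \<Rightarrow> complex" where
  "entries X = (\<lambda>(i, j). X $ i $ j)"

lemma mat_of_entries [simp]: "mat_of (entries X) = X"
  by (simp add: mat_of_def entries_def vec_eq_iff)

lemma entries_mat_of [simp]: "entries (mat_of f) = f"
  by (simp add: mat_of_def entries_def fun_eq_iff)

lemma mat_of_nth [simp]: "mat_of f $ i $ j = f (i, j)"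
  by (simp add: mat_of_def)

lemma matrix_mult_nth: "(A ** B) $ i $ j = (\<Sum>k\<in>UNIV. A $ i $ k * B $ k $ j)"
  by (simp add: matrix_matrix_mult_def)

definition poly_mat :: "nat \<Rightarrow> (complex^'n^'n \<Rightarrow> complex) \<Rightarrow> bool" where
  "poly_mat d F \<longleftrightarrow> poly_fun d (\<lambda>f. F (mat_of f))"

abbreviation adjoint_mat :: "complex^'n^'n \<Rightarrow> complex^'n^'n" where
  "adjoint_mat M \<equiv> map_matrix cnj (transpose M)"

definition diag_of :: "('n \<Rightarrow> complex) \<Rightarrow> complex^'n^'n" where
  "diag_of d = (\<chi> i j. if i = j then d i else 0)"

lemma diag_of_mult_left: "(diag_of d ** A) $ i $ j = d i * A $ i $ j"
  by (simp add: matrix_mult_nth diag_of_def if_distrib[of "\<lambda>x. x * y" for y] cong: if_cong)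

lemma diag_of_mult_right: "(A ** diag_of d) $ i $ j = A $ i $ j * d j"
  by (simp add: matrix_mult_nth diag_of_def if_distrib[of "\<lambda>x. y * x" for y] cong: if_cong)

lemma adjoint_mat_mult: "adjoint_mat (A ** B) = adjoint_mat B ** adjoint_mat A"
  by (simp add: vec_eq_iff matrix_mult_nth transpose_def mult.commute)

lemma adjoint_adjoint [simp]: "adjoint_mat (adjoint_mat A) = A"
  by (simp add: vec_eq_iff transpose_def)

lemma unitary_iff: "U \<in> unitary_group \<longleftrightarrow> U ** adjoint_mat U = mat 1"
  unfolding unitary_group_def using matrix_left_right_inverse by blast

lemma unitary_mult:
  assumes "U \<in> unitary_group" "V \<in> unitary_group"
  shows "U ** V \<in> unitary_group"
proof -
  have "(U ** V) ** adjoint_mat (U ** V) = U ** (V ** adjoint_mat V) ** adjoint_mat U"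
    by (simp add: adjoint_mat_mult matrix_mul_assoc)
  then show ?thesis using assms by (simp add: unitary_iff)
qed

lemma unitary_one: "(mat 1 :: complex^'n^'n) \<in> unitary_group"
proof -
  have "adjoint_mat (mat 1) = (mat 1 :: complex^'n^'n)"
    by (simp add: vec_eq_iff mat_def transpose_def)
  then show ?thesis by (simp add: unitary_iff)
qed

lemma unitary_diag:
  assumes "\<And>v. norm (d v) = 1"
  shows "diag_of d \<in> unitary_group"
proof -
  have "d v * cnj (d v) = 1" for v
    using complex_norm_square[of "d v"] assms[of v] by simp
  then show ?thesis
    unfolding unitary_iff
    by (simp add: vec_eq_iff diag_of_mult_left transpose_def) (simp add: diag_of_def mat_def)
qed

lemma poly_mat_continuous:
  assumes "poly_mat d F"
  shows "continuous_on S F"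
proof -
  have "continuous_on UNIV (\<lambda>X. G (entries X))" if "poly_fun d G" for G :: "('a \<times> 'a \<Rightarrow> complex) \<Rightarrow> complex"
    using that
    by (induction rule: poly_fun.induct)
      (auto simp: monom_fun_def entries_def case_prod_beta intro!: continuous_intros)
  from this[of "\<lambda>f. F (mat_of f)"] assms have "continuous_on UNIV F"
    by (simp add: poly_mat_def)
  then show ?thesis using continuous_on_subset by blast
qed

lemma poly_mat_linear_subst:
  assumes F: "poly_mat d F" and g: "\<And>i j. poly_mat 1 (\<lambda>X. g X $ i $ j)"
  shows "poly_mat d (\<lambda>X. F (g X))"
proof -
  have "poly_fun 1 (\<lambda>f. entries (g (mat_of f)) v)" for v
    using g unfolding poly_mat_def by (cases v) (simp add: entries_def)
  from poly_fun_compose[OF F[unfolded poly_mat_def] this]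
  have "poly_fun d (\<lambda>f. F (mat_of (\<lambda>v. entries (g (mat_of f)) v)))" .
  then show ?thesis by (simp add: poly_mat_def)
qed

lemma poly_mat_mult_right: "poly_mat d F \<Longrightarrow> poly_mat d (\<lambda>X. F (X ** B))"
  by (rule poly_mat_linear_subst)
    (auto simp: poly_mat_def matrix_mult_nth intro!: poly_fun_sum poly_fun_scale_right poly_fun_var)

lemma poly_mat_mult_left: "poly_mat d F \<Longrightarrow> poly_mat d (\<lambda>X. F (B ** X))"
  by (rule poly_mat_linear_subst)
    (auto simp: poly_mat_def matrix_mult_nth intro!: poly_fun_sum poly_fun_scale poly_fun_var)

lemma poly_mat_det: "poly_mat CARD('n) (Determinants.det :: complex^'n^'n \<Rightarrow> complex)"
proof -
  have "poly_fun (\<Sum>i\<in>(UNIV::'n set). 1) (\<lambda>f. \<Prod>i\<in>UNIV. f (i, p i))" for p :: "'n \<Rightarrow> 'n"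
    by (rule poly_fun_prod) (auto intro: poly_fun_var)
  then have "poly_fun (\<Sum>i\<in>(UNIV::'n set). 1)
      (\<lambda>f. \<Sum>p | p permutes UNIV. of_int (sign p) * (\<Prod>i\<in>(UNIV::'n set). f (i, p i)))"
    by (intro poly_fun_sum poly_fun_scale)
  then show ?thesis
    by (simp add: poly_mat_def Determinants.det_def)
qed

text \<open>If \<open>F\<close> vanishes on the unitary group and \<open>g\<close> has this
  property, then \<open>F g = F (mat 1 ** g) = 0\<close>. Unlike that conclusion alone, the property
  passes to products.\<close>

definition density_preserving :: "complex^'n^'n \<Rightarrow> bool" where
  "density_preserving g \<longleftrightarrow>
     (\<forall>d F. poly_mat d F \<longrightarrow> (\<forall>U\<in>unitary_group. F U = 0) \<longrightarrow> (\<forall>U\<in>unitary_group. F (U ** g) = 0))"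

lemma density_preserving_mult:
  assumes "density_preserving a" "density_preserving b"
  shows "density_preserving (a ** b)"
  unfolding density_preserving_def
proof (intro allI impI)
  fix d and F :: "complex^'a^'a \<Rightarrow> complex"
  assume F: "poly_mat d F" "\<forall>U\<in>unitary_group. F U = 0"
  then have "\<forall>U\<in>unitary_group. F (U ** b) = 0" using assms(2) unfolding density_preserving_def by blast
  then show "\<forall>U\<in>unitary_group. F (U ** (a ** b)) = 0"
    using assms(1)[unfolded density_preserving_def, rule_format, OF poly_mat_mult_right[OF F(1), of b]]
    by (simp add: matrix_mul_assoc)
qed

lemma density_preserving_unitary: "g \<in> unitary_group \<Longrightarrow> density_preserving g"
  by (simp add: density_preserving_def unitary_mult)

text \<open>For fixed unitary \<open>U\<close>, the value at \<open>U ** diag_of x\<close> is a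
  polynomial in \<open>x\<close> that vanishes when all \<open>x v\<close> lie on the unit circle,
  an infinite set.\<close>

lemma density_preserving_diag: "density_preserving (diag_of x)"
  unfolding density_preserving_def
proof (intro allI impI ballI)
  fix d and F :: "complex^'a^'a \<Rightarrow> complex" and U :: "complex^'a^'a"
  assume F: "poly_mat d F" "\<forall>U\<in>unitary_group. F U = 0" and U: "U \<in> unitary_group"
  have "poly_fun d (\<lambda>x. F (mat_of (\<lambda>(i, j). U $ i $ j * x j)))"
    using F(1) unfolding poly_mat_def
    by (rule poly_fun_compose) (auto intro!: poly_fun_scale poly_fun_var)
  moreover have "mat_of (\<lambda>(i, j). U $ i $ j * x j) = U ** diag_of x" for x
    by (simp add: vec_eq_iff diag_of_mult_right)
  ultimately have "poly_fun d (\<lambda>x. F (U ** diag_of x))" by simp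
  moreover have "infinite (sphere (0::complex) 1)"
  proof -
    have "inj_on cis {0<..<1}"
    proof (rule inj_onI)
      fix s t :: real assume "s \<in> {0<..<1}" "t \<in> {0<..<1}" "cis s = cis t"
      moreover from this have "cos s = cos t" by (metis cis.simps(1))
      ultimately show "s = t" using pi_gt3 by (auto intro: cos_inj_pi[of s t])
    qed
    moreover have "infinite {0<..<1::real}" by (rule infinite_Ioo) simp
    ultimately have "infinite (cis ` {0<..<1})" by (simp only: finite_image_iff not_False_eq_True)
    moreover have "cis ` {0<..<1} \<subseteq> sphere 0 1" by (auto simp del: image_subset_iff)
    ultimately show ?thesis using infinite_super by blast
  qed
  ultimately show "F (U ** diag_of x) = 0"
    by (rule poly_fun_zero_extend) (auto intro!: F(2)[rule_format] unitary_mult U unitary_diag)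
qed

lemma density_preserving_limit:
  assumes "\<And>k. density_preserving (g k)" and lim: "g \<longlonglongrightarrow> l"
  shows "density_preserving l"
  unfolding density_preserving_def
proof (intro allI impI ballI)
  fix d and F :: "complex^'a^'a \<Rightarrow> complex" and U :: "complex^'a^'a"
  assume F: "poly_mat d F" "\<forall>U\<in>unitary_group. F U = 0" and U: "U \<in> unitary_group"
  have "continuous_on UNIV (\<lambda>X. F (U ** X))"
    by (rule poly_mat_continuous[OF poly_mat_mult_left[OF F(1)]])
  then have "(\<lambda>k. F (U ** g k)) \<longlonglongrightarrow> F (U ** l)"
    using lim by (intro continuous_on_tendsto_compose[where f = "\<lambda>X. F (U ** X)"]) auto
  moreover have "F (U ** g k) = 0" for k
    using assms(1)[of k] F U unfolding density_preserving_def by blast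
  ultimately have "(\<lambda>k. 0) \<longlonglongrightarrow> F (U ** l)" by simp
  then show "F (U ** l) = 0" by (simp add: LIMSEQ_const_iff)
qed

definition plane_rotation :: "'n \<Rightarrow> 'n \<Rightarrow> real \<Rightarrow> complex^'n^'n" where
  "plane_rotation m n \<theta> =
     (\<chi> i j. if i = m \<and> j = m \<or> i = n \<and> j = n then of_real (cos \<theta>)
            else if i = m \<and> j = n then - of_real (sin \<theta>)
            else if i = n \<and> j = m then of_real (sin \<theta>)
            else if i = j then 1 else 0)"

lemma plane_rotation_unitary:
  assumes "m \<noteq> n"
  shows "plane_rotation m n \<theta> \<in> unitary_group"
proof -
  let ?R = "plane_rotation m n \<theta>"
  have sq: "complex_of_real (cos \<theta>) * complex_of_real (cos \<theta>) + complex_of_real (sin \<theta>) * complex_of_real (sin \<theta>) = 1"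
    by (metis of_real_1 of_real_add of_real_mult power2_eq_square sin_cos_squared_add2)
  have R: "?R $ i $ k * cnj (?R $ j $ k) = 0" if "k \<noteq> m" "k \<noteq> n" "i \<noteq> k" for i j k
    using that by (auto simp: plane_rotation_def)
  have "(\<Sum>k\<in>UNIV. ?R $ i $ k * cnj (?R $ j $ k)) = (if i = j then 1 else 0)" for i j
  proof -
    \<comment> \<open>Row \<open>i\<close> has nonzero entries only in the columns \<open>m\<close>,
      \<open>n\<close> and \<open>i\<close>.\<close>
    have "(\<Sum>k\<in>UNIV. ?R $ i $ k * cnj (?R $ j $ k))
        = (\<Sum>k\<in>{m, n} \<union> {i}. ?R $ i $ k * cnj (?R $ j $ k))"
      by (intro sum.mono_neutral_right ballI R) auto
    also have "\<dots> = (if i = j then 1 else 0)"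
    proof -
      consider "i = m" | "i = n" | "i \<noteq> m" "i \<noteq> n" by blast
      then show ?thesis
      proof cases
        case 1
        then show ?thesis
          using assms sq by (simp add: plane_rotation_def insert_absorb add.commute)
      next
        case 2
        have n: "{m, n} \<union> {n} = {m, n}" by blast
        have "(\<Sum>k\<in>{m, n} \<union> {i}. ?R $ i $ k * cnj (?R $ j $ k))
            = ?R $ n $ m * cnj (?R $ j $ m) + ?R $ n $ n * cnj (?R $ j $ n)"
          unfolding 2 n using assms by simp
        also have "\<dots> = (if n = j then 1 else 0)"
        proof (cases "j = n")
          case True
          then show ?thesis using assms trans[OF add.commute sq] by (simp add: plane_rotation_def)
        next
          case False
          then show ?thesis using assms by (simp add: plane_rotation_def)
        qed
        finally show ?thesis unfolding 2 .
      next
        case 3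
        then show ?thesis using assms by (simp add: plane_rotation_def)
      qed
    qed
    finally show ?thesis .
  qed
  then show ?thesis
    unfolding unitary_iff by (simp add: vec_eq_iff matrix_mult_nth transpose_def mat_def)
qed

text \<open>A transvection is a limit of rotations sandwiched between diagonal matrices: in the plane,
  conjugating the rotation by \<open>\<theta>\<close> with \<open>diag (1, - sin \<theta>)\<close> gives
  \<open>[[cos \<theta>, 1], [- sin\<^sup>2 \<theta>, cos \<theta>]]\<close>.\<close>

lemma density_preserving_transvection:
  fixes m n :: "'n::finite"
  assumes "m \<noteq> n"
  shows "density_preserving (\<chi> i j. of_bool (i = m \<and> j = n \<or> i = j) :: complex^'n^'n)"
proof -
  define \<theta> where "\<theta> k = inverse (real (Suc k))" for k
  define D where "D c = diag_of (\<lambda>v::'n. if v = n then c else 1)" for c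
  define g where "g k = D (- of_real (sin (\<theta> k))) ** plane_rotation m n (\<theta> k) ** D (- inverse (of_real (sin (\<theta> k))))" for k
  have s: "sin (\<theta> k) \<noteq> 0" for k
  proof -
    have "0 < \<theta> k" "\<theta> k \<le> 1" by (simp_all add: \<theta>_def inverse_le_1_iff)
    then have "0 < sin (\<theta> k)" using pi_gt3 by (intro sin_gt_zero) auto
    then show ?thesis by simp
  qed
  have g: "g k $ i $ j = (if i = m \<and> j = m \<or> i = n \<and> j = n then of_real (cos (\<theta> k))
            else if i = m \<and> j = n then 1
            else if i = n \<and> j = m then - of_real (sin (\<theta> k) ^ 2)
            else if i = j then 1 else 0)" for k i j
    using assms s[of k]
    by (simp add: g_def D_def diag_of_mult_right diag_of_mult_left plane_rotation_def power2_eq_square)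
  have \<theta>: "\<theta> \<longlonglongrightarrow> 0" unfolding \<theta>_def by (rule LIMSEQ_inverse_real_of_nat)
  have c: "(\<lambda>k. complex_of_real (cos (\<theta> k))) \<longlonglongrightarrow> 1"
    using tendsto_of_real[OF tendsto_cos[OF \<theta>], where ?'a = complex] by simp
  have s2: "(\<lambda>k. - complex_of_real (sin (\<theta> k) ^ 2)) \<longlonglongrightarrow> 0"
    using tendsto_minus[OF tendsto_of_real[OF tendsto_power[OF tendsto_sin[OF \<theta>]], where ?'a = complex, of 2]] by simp
  show ?thesis
  proof (rule density_preserving_limit)
    show "density_preserving (g k)" for k
      unfolding g_def D_def
      by (intro density_preserving_mult density_preserving_diag density_preserving_unitary
          plane_rotation_unitary assms)
    show "g \<longlonglongrightarrow> (\<chi> i j. of_bool (i = m \<and> j = n \<or> i = j))"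
    proof (intro vec_tendstoI)
      fix i j
      consider "i = m \<and> j = m \<or> i = n \<and> j = n" | "i = m" "j = n" | "i = n" "j = m"
        | "\<not> (i = m \<and> j = m \<or> i = n \<and> j = n)" "\<not> (i = m \<and> j = n)" "\<not> (i = n \<and> j = m)" by blast
      then show "(\<lambda>k. g k $ i $ j) \<longlonglongrightarrow> (\<chi> i j. of_bool (i = m \<and> j = n \<or> i = j)) $ i $ j"
      proof cases
        case 1
        then have "(\<lambda>k. g k $ i $ j) = (\<lambda>k. complex_of_real (cos (\<theta> k)))" "i = j" by (auto simp: g)
        then show ?thesis using c by simp
      next
        case 2
        then have "(\<lambda>k. g k $ i $ j) = (\<lambda>k. 1)" using assms by (auto simp: g)
        then show ?thesis using 2 by simp
      next
        case 3
        then have "(\<lambda>k. g k $ i $ j) = (\<lambda>k. - complex_of_real (sin (\<theta> k) ^ 2))" using assms by (auto simp: g)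
        then show ?thesis using 3 assms s2 by simp
      next
        case 4
        then show ?thesis by (simp only: g vec_lambda_beta of_bool_def if_False simp_thms tendsto_const)
      qed
    qed
  qed
qed

definition complexify :: "real^'n^'n \<Rightarrow> complex^'n^'n" where
  "complexify A = (\<chi> i j. of_real (A $ i $ j))"

lemma complexify_mult: "complexify (A ** B) = complexify A ** complexify B"
  by (simp add: complexify_def vec_eq_iff matrix_mult_nth)

text \<open>Induction over products of elementary matrices: invertibility passes to both factors
  because the determinant is multiplicative, a zero row excludes it, and the remaining generators
  are diagonal matrices, permutation matrices (unitary) and transvections.\<close>

lemma complexify_density_preserving:
  fixes A :: "real^'n^'n"
  assumes "invertible A"
  shows "density_preserving (complexify A)"
proof -
  have "invertible A \<longrightarrow> density_preserving (complexify A)"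
  proof (induction A rule: induct_matrix_elementary_alt)
    case (1 A B)
    have "invertible A" "invertible B" if "invertible (A ** B)"
      using that by (simp_all add: invertible_det_nz det_mul)
    with 1 show ?case by (auto simp: complexify_mult intro: density_preserving_mult)
  next
    case (2 A i)
    then have "Determinants.det A = 0" by (rule det_zero_row(2))
    then show ?case by (simp add: invertible_det_nz)
  next
    case (3 A)
    have "complexify A = diag_of (\<lambda>i. of_real (A $ i $ i))"
      using 3 by (auto simp: complexify_def diag_of_def vec_eq_iff)
    then show ?case by (simp add: density_preserving_diag)
  next
    case (4 m n)
    let ?\<tau> = "Transposition.transpose m n"
    have "i = ?\<tau> j \<longleftrightarrow> j = ?\<tau> i" for i j by (metis transpose_involutory)
    then have g: "complexify (\<chi> i j. mat 1 $ i $ ?\<tau> j) = (\<chi> i j. if j = ?\<tau> i then 1 else 0)"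
      by (simp add: complexify_def mat_def vec_eq_iff)
    have inj: "?\<tau> i = ?\<tau> j \<longleftrightarrow> i = j" for i j by (metis transpose_involutory)
    have "(\<Sum>k\<in>UNIV. (if k = ?\<tau> i then 1 else 0) * cnj (if k = ?\<tau> j then 1 else 0)) = (if i = j then 1 else 0)" for i j
    proof -
      have "(\<Sum>k\<in>UNIV. (if k = ?\<tau> i then 1 else 0) * cnj (if k = ?\<tau> j then 1 else 0))
          = (\<Sum>k\<in>UNIV. if k = ?\<tau> i then (if k = ?\<tau> j then 1 else 0) else 0)"
        by (rule sum.cong) auto
      then show ?thesis by (simp add: inj)
    qed
    then have "complexify (\<chi> i j. mat 1 $ i $ ?\<tau> j) \<in> unitary_group"
      unfolding unitary_iff vec_eq_iff matrix_mult_nth g by (simp add: transpose_def mat_def)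
    then show ?case by (simp add: density_preserving_unitary)
  next
    case (5 m n)
    have "complexify (\<chi> i j. of_bool (i = m \<and> j = n \<or> i = j)) = (\<chi> i j. of_bool (i = m \<and> j = n \<or> i = j))"
      by (simp add: complexify_def vec_eq_iff)
    with density_preserving_transvection[OF 5] show ?case by simp
  qed
  then show ?thesis using assms by simp
qed

text \<open>\<open>F\<close> vanishes at real invertible matrices, so \<open>F\<close> times the
  determinant vanishes at all real matrices and hence, as a polynomial in the entries, at all
  complex ones. The determinant is then cancelled on a line.\<close>

lemma poly_mat_zero_of_unitary:
  fixes F :: "complex^'n^'n \<Rightarrow> complex"
  assumes F: "poly_mat d F" and zero: "\<And>U. U \<in> unitary_group \<Longrightarrow> F U = 0"
  shows "F X = 0"
proof -
  have real: "F (complexify A) = 0" if "invertible A" for A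
    using complexify_density_preserving[OF that] F zero unitary_one
    unfolding density_preserving_def by (metis matrix_mul_lid)
  have FD: "poly_fun (d + CARD('n)) (\<lambda>f. F (mat_of f) * Determinants.det (mat_of f :: complex^'n^'n))"
    using F poly_mat_det[where 'n = 'n] unfolding poly_mat_def by (rule poly_fun_mult)
  have "F (mat_of f) * Determinants.det (mat_of f) = 0" for f
  proof (rule poly_fun_zero_extend[OF FD])
    show "infinite (\<real> :: complex set)"
      unfolding Reals_def by (simp add: finite_image_iff inj_on_def infinite_UNIV_char_0)
    fix x :: "'n \<times> 'n \<Rightarrow> complex"
    assume x: "\<And>v. x v \<in> \<real>"
    define A where "A = (\<chi> i j. Re (x (i, j)))"
    have A: "mat_of x = complexify A"
      using x by (simp add: A_def vec_eq_iff complexify_def)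
    have "Determinants.det (complexify A) = of_real (Determinants.det A)"
      by (simp add: Determinants.det_def complexify_def)
    then show "F (mat_of x) * Determinants.det (mat_of x) = 0"
      using real[of A] unfolding A by (cases "invertible A") (auto simp: invertible_det_nz)
  qed
  then have FD0: "F X * Determinants.det X = 0" for X
    by (metis mat_of_entries)
  \<comment> \<open>The line from \<open>X\<close> at \<open>t = 0\<close> to the identity at
    \<open>t = 1\<close>. There the determinant is 1, so its restriction \<open>q\<close> is a
    nonzero polynomial.\<close>
  define L where "L t = mat_of (\<lambda>v. entries X v + t * (entries (mat 1) v - entries X v))" for t
  have line: "\<exists>p. \<forall>t. G (L t) = poly p t" if "poly_mat e G" for e G
  proof -
    have "poly_fun e (\<lambda>x :: unit \<Rightarrow> complex. G (mat_of (\<lambda>v. entries X v + x () * (entries (mat 1) v - entries X v))))"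
      using that unfolding poly_mat_def
      by (rule poly_fun_compose)
        (auto intro!: poly_fun.add poly_fun_scale_right poly_fun_var)
    from poly_fun_line[OF this, of "\<lambda>_. 0" "()"] show ?thesis by (simp add: L_def)
  qed
  obtain p where p: "\<And>t. F (L t) = poly p t" using line[OF F] by blast
  obtain q where q: "\<And>t. Determinants.det (L t) = poly q t" using line[OF poly_mat_det] by blast
  have "poly (p * q) t = 0" for t using FD0[of "L t"] by (simp add: p q)
  then have "p * q = 0" by (metis poly_all_0_iff_0)
  moreover have "poly q 1 = 1" using q[of 1] by (simp add: L_def)
  ultimately have "p = 0" by auto
  then show ?thesis using p[of 0] by (simp add: L_def)
qed

section \<open>Eigenvalues\<close>

definition class_fun :: "(complex^'n^'n \<Rightarrow> 'a) \<Rightarrow> bool" where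
  "class_fun f \<longleftrightarrow> (\<forall>P Q M. P ** Q = mat 1 \<longrightarrow> Q ** P = mat 1 \<longrightarrow> f (P ** M ** Q) = f M)"

lemma class_funD: "class_fun f \<Longrightarrow> P ** Q = mat 1 \<Longrightarrow> f (P ** M ** Q) = f M"
  unfolding class_fun_def using matrix_left_right_inverse by blast

text \<open>Transports matrices indexed by numbers to matrices indexed by a finite type, in order to
  import Schur triangularization.\<close>

definition of_jnf :: "('n::finite \<Rightarrow> nat) \<Rightarrow> complex Matrix.mat \<Rightarrow> complex^'n^'n" where
  "of_jnf e A = (\<chi> i j. A $$ (e i, e j))"

lemma of_jnf_mult:
  fixes e :: "'n::finite \<Rightarrow> nat"
  assumes e: "bij_betw e UNIV {0..<n}" and A: "A \<in> carrier_mat n n" and B: "B \<in> carrier_mat n n"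
  shows "of_jnf e (A * B) = of_jnf e A ** of_jnf e B"
proof -
  have lt: "e i < n" for i using bij_betwE[OF e] by simp
  have "(A * B) $$ (e i, e j) = (\<Sum>k\<in>UNIV. A $$ (e i, e k) * B $$ (e k, e j))" for i j
  proof -
    have "(A * B) $$ (e i, e j) = (\<Sum>k\<in>{0..<n}. A $$ (e i, k) * B $$ (k, e j))"
      using A B lt by (auto simp: scalar_prod_def intro!: sum.cong)
    also have "\<dots> = (\<Sum>k\<in>UNIV. A $$ (e i, e k) * B $$ (e k, e j))"
      by (rule sum.reindex_bij_betw[OF e, symmetric])
    finally show ?thesis .
  qed
  then show ?thesis by (simp add: of_jnf_def vec_eq_iff matrix_mult_nth)
qed

lemma of_jnf_one:
  assumes e: "bij_betw e UNIV {0..<n}"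
  shows "of_jnf e (1\<^sub>m n) = mat 1"
proof -
  have "e i < n" for i using bij_betwE[OF e] by simp
  moreover have "e i = e j \<longleftrightarrow> i = j" for i j using e by (auto simp: bij_betw_def inj_on_def)
  ultimately show ?thesis by (simp add: of_jnf_def vec_eq_iff mat_def)
qed

text \<open>The index type carries no order; triangularity refers to the one induced by the
  enumeration \<open>e\<close>.\<close>

lemma triangularizable:
  fixes M :: "complex^'n^'n" and e :: "'n \<Rightarrow> nat"
  assumes e: "bij_betw e UNIV {0..<n}"
  obtains P T Q where "P ** Q = mat 1" "M = P ** T ** Q" "\<And>i j. e j < e i \<Longrightarrow> T $ i $ j = 0"
proof -
  define e' where "e' = inv_into UNIV e"
  have e': "e' (e i) = i" for i using e by (simp add: e'_def bij_betw_def inv_into_f_f)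
  have lt: "e i < n" for i using bij_betwE[OF e] by simp
  define A where "A = Matrix.mat n n (\<lambda>(a, b). M $ e' a $ e' b)"
  have A: "A \<in> carrier_mat n n" by (simp add: A_def)
  obtain as where "char_poly A = (\<Prod>a\<leftarrow>as. [:- a, 1:])" using char_poly_factorized[OF A] by blast
  from schur_decomposition_exists[OF A this] obtain B where
    B: "upper_triangular B" "similar_mat A B" by blast
  obtain m P Q where "{A, B, P, Q} \<subseteq> carrier_mat m m" "P * Q = 1\<^sub>m m" "A = P * B * Q"
    using similar_matD[OF B(2)] by blast
  moreover from this(1) have "m = n" using carrier_matD(1)[OF A] carrier_matD(1)[of A m m] by simp
  ultimately have PQ: "{A, B, P, Q} \<subseteq> carrier_mat n n" "P * Q = 1\<^sub>m n" "A = P * B * Q" by simp_all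
  have M: "M = of_jnf e A" using lt by (simp add: of_jnf_def A_def vec_eq_iff e')
  show thesis
  proof (rule that)
    show "of_jnf e P ** of_jnf e Q = mat 1"
      using PQ of_jnf_mult[OF e, of P Q] of_jnf_one[OF e] by simp
    show "M = of_jnf e P ** of_jnf e B ** of_jnf e Q"
      using PQ mult_carrier_mat[of P n n B n] by (simp add: M of_jnf_mult[OF e, of P B, symmetric] of_jnf_mult[OF e, of "P * B" Q, symmetric])
    show "of_jnf e B $ i $ j = 0" if "e j < e i" for i j
      using that B(1) PQ(1) lt[of i] carrier_matD(1)[of B n n] by (simp add: of_jnf_def upper_triangular_def)
  qed
qed

text \<open>Conjugating a triangular matrix by \<open>diag (\<epsilon>, \<epsilon>\<^sup>2, \<dots>)\<close> lets the entries above the diagonal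
  tend to 0, so a continuous class function cannot see them.\<close>

lemma continuous_class_fun_diag:
  fixes M :: "complex^'n^'n"
  obtains w :: "'n \<Rightarrow> complex" where
    "\<And>f :: complex^'n^'n \<Rightarrow> complex. continuous_on UNIV f \<Longrightarrow> class_fun f \<Longrightarrow> f M = f (diag_of w)"
proof -
  obtain e :: "'n \<Rightarrow> nat" where e: "bij_betw e UNIV {0..<CARD('n)}"
    using ex_bij_betw_finite_nat[of "UNIV :: 'n set"] by auto
  obtain P T Q where PQ: "P ** Q = mat 1" "M = P ** T ** Q" and T: "\<And>i j. e j < e i \<Longrightarrow> T $ i $ j = 0"
    using triangularizable[OF e, of M] by blast
  define w where "w i = T $ i $ i" for i
  define E where "E k = inverse (complex_of_real (real (Suc k)))" for k
  have E0: "E k \<noteq> 0" for k unfolding E_def by (simp del: of_nat_Suc)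
  define g where "g k = diag_of (\<lambda>i. inverse (E k) ^ e i) ** T ** diag_of (\<lambda>i. E k ^ e i)" for k
  have "E \<longlonglongrightarrow> 0"
    using tendsto_of_real[OF LIMSEQ_inverse_real_of_nat, where ?'a = complex] unfolding E_def by simp
  have lim: "g \<longlonglongrightarrow> diag_of w"
  proof (intro vec_tendstoI)
    fix i j
    have g: "g k $ i $ j = inverse (E k) ^ e i * E k ^ e j * T $ i $ j" for k
      by (simp add: g_def diag_of_mult_right diag_of_mult_left)
    consider "e j < e i" | "i = j" | "e i < e j"
      using e by (metis bij_betw_imp_inj_on injD linorder_neqE_nat)
    then show "(\<lambda>k. g k $ i $ j) \<longlonglongrightarrow> diag_of w $ i $ j"
    proof cases
      case 1
      then have "i \<noteq> j" by auto
      with 1 show ?thesis by (simp add: g T diag_of_def)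
    next
      case 2
      have "inverse (E k) ^ e j * E k ^ e j = 1" for k
        using E0[of k] by (simp add: power_mult_distrib[symmetric])
      then have "(\<lambda>k. g k $ i $ j) = (\<lambda>k. T $ i $ i)" unfolding g unfolding 2 by (simp only: mult_1)
      with 2 show ?thesis by (simp add: w_def diag_of_def)
    next
      case 3
      have "inverse (E k) ^ e i * E k ^ e j = E k ^ (e j - e i)" for k
        using 3 E0[of k] by (simp add: power_diff divide_simps)
      then have "(\<lambda>k. g k $ i $ j) = (\<lambda>k. E k ^ (e j - e i) * T $ i $ j)" by (simp add: g)
      moreover have "(\<lambda>k. E k ^ (e j - e i) * T $ i $ j) \<longlonglongrightarrow> 0 ^ (e j - e i) * T $ i $ j"
        by (intro tendsto_intros \<open>E \<longlonglongrightarrow> 0\<close>)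
      moreover have "i \<noteq> j" using 3 by auto
      ultimately show ?thesis using 3 by (simp add: diag_of_def power_0_left)
    qed
  qed
  show thesis
  proof (rule that)
    fix f :: "complex^'n^'n \<Rightarrow> complex"
    assume f: "continuous_on UNIV f" "class_fun f"
    have "f (g k) = f M" for k
    proof -
      have "diag_of (\<lambda>i. inverse (E k) ^ e i) ** diag_of (\<lambda>i. E k ^ e i) = (mat 1 :: complex^'n^'n)"
        using E0[of k]
        by (simp add: vec_eq_iff diag_of_mult_left) (simp add: diag_of_def mat_def power_mult_distrib[symmetric])
      then show ?thesis using f(2) PQ by (simp add: g_def class_funD)
    qed
    moreover have "(\<lambda>k. f (g k)) \<longlonglongrightarrow> f (diag_of w)"
      by (rule continuous_on_tendsto_compose[OF f(1) lim]) auto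
    ultimately show "f M = f (diag_of w)" by (simp add: LIMSEQ_const_iff)
  qed
qed

section \<open>The trace on symmetric powers\<close>

text \<open>\<open>sym_entry K M\<close> is the matrix of the substitution \<open>x \<mapsto> M x\<close> on monomials of degree
  at most \<open>K\<close>.\<close>

definition sym_entry :: "nat \<Rightarrow> complex^'n^'n \<Rightarrow> ('n \<Rightarrow> nat) \<Rightarrow> ('n \<Rightarrow> nat) \<Rightarrow> complex" where
  "sym_entry K M a b = coeff_at (Suc K) b (\<lambda>x. monom_fun a (\<lambda>i. \<Sum>j\<in>UNIV. M $ i $ j * x j))"

definition exps_le :: "nat \<Rightarrow> ('n::finite \<Rightarrow> nat) set" where
  "exps_le K = {a. sum a UNIV \<le> K}"

lemma finite_exps_le [simp]: "finite (exps_le K)"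
  unfolding exps_le_def by (rule finite_sum_le)

lemma exps_le_less: "a \<in> exps_le K \<Longrightarrow> a v < Suc K"
  unfolding exps_le_def using member_le_sum[of v UNIV a] by simp

lemma poly_fun_monom_linear:
  assumes "a \<in> exps_le K"
  shows "poly_fun K (\<lambda>x. monom_fun a (\<lambda>i. \<Sum>j\<in>UNIV. M $ i $ j * x j))"
proof -
  have "poly_fun 1 (\<lambda>x. \<Sum>j\<in>UNIV. M $ i $ j * x j)" for i
    by (intro poly_fun_sum poly_fun_scale poly_fun_var) simp
  from poly_fun_compose[OF poly_fun_monom[of a K] this] assms show ?thesis
    by (simp add: exps_le_def)
qed

lemma monom_linear_expand:
  assumes "a \<in> exps_le K"
  shows "monom_fun a (\<lambda>i. \<Sum>j\<in>UNIV. M $ i $ j * x j) = (\<Sum>b\<in>exps_le K. sym_entry K M a b * monom_fun b x)"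
  unfolding sym_entry_def
  using poly_fun_expand[OF poly_fun_monom_linear[OF assms, of M], of "exps_le K" "Suc K" x]
  by (auto simp: exps_le_def finite_sum_le intro: exps_le_less[unfolded exps_le_def])

lemma coeff_at_monom_exps:
  assumes "a \<in> exps_le K" "b \<in> exps_le K"
  shows "coeff_at (Suc K) a (monom_fun b) = (if a = b then 1 else 0)"
  using assms by (intro coeff_at_monom) (auto dest: exps_le_less)

text \<open>Substituting \<open>M ** N\<close> is substituting \<open>M\<close> into the monomial
  and then \<open>N\<close> into each resulting monomial, so the substitution matrices
  multiply.\<close>

lemma sym_entry_mult:
  assumes "a \<in> exps_le K" "b \<in> exps_le K"
  shows "sym_entry K (M ** N) a b = (\<Sum>c\<in>exps_le K. sym_entry K M a c * sym_entry K N c b)"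
proof -
  have "(\<Sum>j\<in>UNIV. (M ** N) $ i $ j * x j) = (\<Sum>k\<in>UNIV. M $ i $ k * (\<Sum>j\<in>UNIV. N $ k $ j * x j))" for i x
  proof -
    have "(\<Sum>j\<in>UNIV. (M ** N) $ i $ j * x j) = (\<Sum>j\<in>UNIV. \<Sum>k\<in>UNIV. M $ i $ k * (N $ k $ j * x j))"
      by (simp add: matrix_mult_nth sum_distrib_right mult.assoc)
    also have "\<dots> = (\<Sum>k\<in>UNIV. \<Sum>j\<in>UNIV. M $ i $ k * (N $ k $ j * x j))" by (rule sum.swap)
    finally show ?thesis by (simp add: sum_distrib_left)
  qed
  then have "sym_entry K (M ** N) a b
      = coeff_at (Suc K) b (\<lambda>x. monom_fun a (\<lambda>i. \<Sum>k\<in>UNIV. M $ i $ k * (\<Sum>j\<in>UNIV. N $ k $ j * x j)))"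
    by (simp add: sym_entry_def)
  also have "\<dots> = coeff_at (Suc K) b (\<lambda>x. \<Sum>c\<in>exps_le K. sym_entry K M a c * monom_fun c (\<lambda>k. \<Sum>j\<in>UNIV. N $ k $ j * x j))"
    by (simp only: monom_linear_expand[OF assms(1)])
  finally show ?thesis by (simp add: coeff_at_sum coeff_at_scale sym_entry_def)
qed

text \<open>The series of traces on symmetric powers, with the \<open>k\<close>-th power weighted by
  \<open>u ^ k\<close>, cut at degree \<open>K\<close>.\<close>

definition sym_trace :: "nat \<Rightarrow> complex \<Rightarrow> complex^'n^'n \<Rightarrow> complex" where
  "sym_trace K u M = (\<Sum>a\<in>exps_le K. u ^ sum a UNIV * sym_entry K M a a)"

text \<open>A linear substitution commutes with the scaling \<open>x \<mapsto> t x\<close>, which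
  multiplies a monomial by \<open>t\<close> to its degree.\<close>

lemma sym_entry_degree:
  assumes ab: "a \<in> exps_le K" "b \<in> exps_le K" and "sum a UNIV \<noteq> sum b UNIV"
  shows "sym_entry K M a b = 0"
proof -
  have scal: "monom_fun c (\<lambda>i. t * x i) = t ^ sum c UNIV * monom_fun c x" for c t and x :: "'a \<Rightarrow> complex"
    by (simp add: monom_fun_def power_mult_distrib prod.distrib power_sum)
  have "sym_entry K M a b * t ^ sum b UNIV = t ^ sum a UNIV * sym_entry K M a b" for t
  proof -
    have "t ^ sum a UNIV * sym_entry K M a b
        = coeff_at (Suc K) b (\<lambda>x. monom_fun a (\<lambda>i. t * (\<Sum>j\<in>UNIV. M $ i $ j * x j)))"
      by (simp add: scal sym_entry_def coeff_at_scale)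
    also have "\<dots> = coeff_at (Suc K) b (\<lambda>x. monom_fun a (\<lambda>i. \<Sum>j\<in>UNIV. M $ i $ j * (t * x j)))"
      by (simp add: sum_distrib_left mult_ac)
    also have "\<dots> = coeff_at (Suc K) b (\<lambda>x. \<Sum>c\<in>exps_le K. (sym_entry K M a c * t ^ sum c UNIV) * monom_fun c x)"
      by (simp only: monom_linear_expand[OF ab(1)] scal mult.assoc)
    also have "\<dots> = (\<Sum>c\<in>exps_le K. (sym_entry K M a c * t ^ sum c UNIV) * (if b = c then 1 else 0))"
      by (simp add: coeff_at_sum coeff_at_scale coeff_at_monom_exps ab cong: sum.cong)
    also have "\<dots> = sym_entry K M a b * t ^ sum b UNIV"
      using ab by (simp add: if_distrib[of "\<lambda>x. y * x" for y] cong: if_cong)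
    finally show ?thesis ..
  qed
  \<comment> \<open>Powers of 2 with different exponents differ, so this one value of
    \<open>t\<close> separates the degrees.\<close>
  from this[of 2] have "sym_entry K M a b = 0 \<or> (2::complex) ^ sum b UNIV = 2 ^ sum a UNIV" by auto
  moreover have "(2::complex) ^ k = 2 ^ l \<longleftrightarrow> k = l" for k l
  proof
    assume "(2::complex) ^ k = 2 ^ l"
    then have "norm ((2::complex) ^ k) = norm ((2::complex) ^ l)" by simp
    then show "k = l" by (simp add: norm_power)
  qed simp
  ultimately show ?thesis using assms(3) by auto
qed

text \<open>Cyclicity of the trace survives the weights \<open>u ^ sum a UNIV\<close>, because
  entries linking different degrees vanish.\<close>

lemma sym_trace_class: "class_fun (sym_trace K u :: complex^'n^'n \<Rightarrow> complex)"
  unfolding class_fun_def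
proof (intro allI impI)
  fix P Q M :: "complex^'n^'n"
  assume PQ: "P ** Q = mat 1" "Q ** P = mat 1"
  have comm: "sym_trace K u (A ** B) = sym_trace K u (B ** A)" for A B :: "complex^'n^'n"
  proof -
    have "sym_trace K u (A ** B) = (\<Sum>a\<in>exps_le K. \<Sum>c\<in>exps_le K. u ^ sum a UNIV * (sym_entry K A a c * sym_entry K B c a))"
      by (simp add: sym_trace_def sym_entry_mult sum_distrib_left cong: sum.cong)
    also have "\<dots> = (\<Sum>a\<in>exps_le K. \<Sum>c\<in>exps_le K. u ^ sum c UNIV * (sym_entry K B c a * sym_entry K A a c))"
    proof (intro sum.cong refl)
      fix a c :: "'n \<Rightarrow> nat" assume "a \<in> exps_le K" "c \<in> exps_le K"
      then show "u ^ sum a UNIV * (sym_entry K A a c * sym_entry K B c a)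
          = u ^ sum c UNIV * (sym_entry K B c a * sym_entry K A a c)"
        using sym_entry_degree[of a K c A] by (cases "sum a UNIV = sum c UNIV") auto
    qed
    also have "\<dots> = (\<Sum>c\<in>exps_le K. \<Sum>a\<in>exps_le K. u ^ sum c UNIV * (sym_entry K B c a * sym_entry K A a c))"
      by (rule sum.swap)
    also have "\<dots> = sym_trace K u (B ** A)"
      by (simp add: sym_trace_def sym_entry_mult sum_distrib_left cong: sum.cong)
    finally show ?thesis .
  qed
  have "sym_trace K u (P ** M ** Q) = sym_trace K u (Q ** (P ** M))" by (rule comm)
  then show "sym_trace K u (P ** M ** Q) = sym_trace K u M"
    by (simp add: matrix_mul_assoc PQ)
qed

lemma sym_entry_continuous: "continuous_on S (\<lambda>M. sym_entry K M a b)"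
  unfolding sym_entry_def coeff_at_def monom_fun_def by (intro continuous_intros)

lemma sym_trace_continuous: "continuous_on S (sym_trace K u)"
  unfolding sym_trace_def[abs_def] by (intro continuous_intros sym_entry_continuous)

lemma sym_trace_diag:
  "sym_trace K u (diag_of d) = (\<Sum>a\<in>exps_le K. u ^ sum a UNIV * monom_fun a d)"
proof -
  have "sym_entry K (diag_of d) a a = monom_fun a d" if "a \<in> exps_le K" for a
  proof -
    have "monom_fun a (\<lambda>i. \<Sum>j\<in>UNIV. diag_of d $ i $ j * x j) = monom_fun a d * monom_fun a x" for x
      by (simp add: diag_of_def if_distrib[of "\<lambda>x. x * y" for y] monom_fun_def power_mult_distrib prod.distrib
          cong: if_cong)
    then show ?thesis using that by (simp add: sym_entry_def coeff_at_scale coeff_at_monom_exps)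
  qed
  then show ?thesis by (simp add: sym_trace_def)
qed

section \<open>A reproducing formula for Haar measure\<close>

lemma continuous_on_matrix_mult [continuous_intros]:
  fixes f g :: "'a::topological_space \<Rightarrow> complex^'n^'n"
  assumes "continuous_on S f" "continuous_on S g"
  shows "continuous_on S (\<lambda>x. f x ** g x)"
  unfolding matrix_matrix_mult_def using assms by (intro continuous_intros)

lemma continuous_on_adjoint_mat [continuous_intros]:
  fixes f :: "'a::topological_space \<Rightarrow> complex^'n^'n"
  assumes "continuous_on S f"
  shows "continuous_on S (\<lambda>x. adjoint_mat (f x))"
  unfolding map_matrix_def transpose_def
  using assms by (simp, intro continuous_intros)

lemma compact_unitary_group: "compact (unitary_group :: (complex^'n^'n) set)"
  unfolding compact_eq_bounded_closed
proof
  have eq: "unitary_group = {U :: complex^'n^'n. U ** adjoint_mat U = mat 1}"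
    using unitary_iff by blast
  show "closed (unitary_group :: (complex^'n^'n) set)"
    unfolding eq by (intro closed_Collect_eq continuous_intros)
  have "norm U \<le> (\<Sum>i\<in>(UNIV::'n set). \<Sum>j\<in>(UNIV::'n set). 1)" if "U \<in> unitary_group" for U :: "complex^'n^'n"
  proof -
    have entry: "norm (U $ i $ j) \<le> 1" for i j
    proof -
      have "(\<Sum>k\<in>UNIV. U $ i $ k * cnj (U $ i $ k)) = 1"
        using that unfolding unitary_iff
        by (simp add: vec_eq_iff matrix_mult_nth transpose_def mat_def)
      then have "complex_of_real (\<Sum>k\<in>UNIV. (norm (U $ i $ k))\<^sup>2) = 1"
        by (simp only: of_real_sum complex_norm_square)
      then have "(\<Sum>k\<in>UNIV. (norm (U $ i $ k))\<^sup>2) = 1" using of_real_eq_1_iff by blast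
      moreover have "(norm (U $ i $ j))\<^sup>2 \<le> (\<Sum>k\<in>UNIV. (norm (U $ i $ k))\<^sup>2)"
        by (rule member_le_sum) auto
      ultimately show ?thesis by (metis abs_norm_cancel abs_square_le_1)
    qed
    have "norm U \<le> (\<Sum>i\<in>UNIV. norm (U $ i))" unfolding norm_vec_def by (rule L2_set_le_sum) simp
    also have "\<dots> \<le> (\<Sum>i\<in>UNIV. \<Sum>j\<in>UNIV. norm (U $ i $ j))"
      unfolding norm_vec_def[of "U $ _"] by (intro sum_mono L2_set_le_sum) simp
    also have "\<dots> \<le> (\<Sum>i\<in>(UNIV::'n set). \<Sum>j\<in>(UNIV::'n set). 1)" by (intro sum_mono entry)
    finally show ?thesis .
  qed
  then show "bounded (unitary_group :: (complex^'n^'n) set)" unfolding bounded_iff by blast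
qed

lemma haar_integrable:
  fixes f :: "complex^'n^'n \<Rightarrow> complex"
  assumes H: "normalized_haar H" and f: "continuous_on UNIV f"
  shows "integrable H f"
proof -
  interpret prob_space H using H by (simp add: normalized_haar_def)
  have sets: "sets H = sets (restrict_space borel unitary_group)" and space: "space H = unitary_group"
    using H by (simp_all add: normalized_haar_def)
  have "f \<in> borel_measurable H"
    unfolding measurable_cong_sets[OF sets refl]
    using f by (intro borel_measurable_continuous_on_restrict) (rule continuous_on_subset, auto)
  moreover have "bounded (f ` unitary_group)"
    using f by (intro compact_imp_bounded compact_continuous_image compact_unitary_group)
      (rule continuous_on_subset, auto)
  then obtain B where "\<And>U. U \<in> unitary_group \<Longrightarrow> norm (f U) \<le> B" unfolding bounded_iff by blast
  ultimately show ?thesis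
    by (intro integrable_const_bound[of _ B]) (auto simp: space)
qed

lemma haar_left_invariant:
  fixes f :: "complex^'n^'n \<Rightarrow> complex"
  assumes H: "normalized_haar H" and f: "continuous_on UNIV f" and U: "U \<in> unitary_group"
  shows "(\<integral>M. f (U ** M) \<partial>H) = (\<integral>M. f M \<partial>H)"
proof -
  have sets: "sets H = sets (restrict_space borel unitary_group)" and space: "space H = unitary_group"
    and inv: "distr H H (\<lambda>M. U ** M) = H"
    using H U by (simp_all add: normalized_haar_def)
  have "(\<lambda>M. U ** M) \<in> borel_measurable (restrict_space borel unitary_group)"
    by (intro borel_measurable_continuous_on_restrict continuous_intros)
  then have "(\<lambda>M. U ** M) \<in> measurable H H"
    unfolding measurable_cong_sets[OF sets sets]
    by (intro measurable_restrict_space2) (auto simp: space_restrict_space intro: unitary_mult U)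
  moreover have "f \<in> borel_measurable H" using haar_integrable[OF H f] by simp
  ultimately have "(\<integral>M. f M \<partial>distr H H (\<lambda>M. U ** M)) = (\<integral>M. f (U ** M) \<partial>H)"
    by (rule integral_distr)
  then show ?thesis by (simp add: inv)
qed

lemma coeff_at_integral:
  assumes "\<And>x. integrable H (\<lambda>M. G M x)"
  shows "coeff_at N a (\<lambda>x. \<integral>M. G M x \<partial>H) = (\<integral>M. coeff_at N a (G M) \<partial>H)"
  unfolding coeff_at_def using assms by (subst Bochner_Integration.integral_sum) auto

section \<open>Monomials in the entries of a matrix, column by column\<close>

definition col_exps_le :: "nat \<Rightarrow> ('n::finite \<Rightarrow> 'n \<Rightarrow> nat) set" where
  "col_exps_le K = UNIV \<rightarrow>\<^sub>E exps_le K"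

definition flat :: "('n::finite \<Rightarrow> 'n \<Rightarrow> nat) \<Rightarrow> 'n \<times> 'n \<Rightarrow> nat" where
  "flat B = (\<lambda>(i, j). B j i)"

lemma inj_flat: "inj_on flat S"
  by (auto simp: inj_on_def flat_def fun_eq_iff)

lemma finite_col_exps_le [simp]: "finite (col_exps_le K)"
  unfolding col_exps_le_def by (intro finite_PiE) auto

lemma col_exps_leD: "B \<in> col_exps_le K \<Longrightarrow> B j \<in> exps_le K"
  by (auto simp: col_exps_le_def)

lemma flat_less: "B \<in> col_exps_le K \<Longrightarrow> flat B v < Suc K"
  by (cases v) (auto simp: flat_def dest: col_exps_leD intro: exps_le_less)

lemma sum_flat: "sum (flat B) UNIV = (\<Sum>j\<in>UNIV. sum (B j) UNIV)"
proof -
  have "sum (flat B) UNIV = (\<Sum>i\<in>UNIV. \<Sum>j\<in>UNIV. B j i)"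
    by (simp add: flat_def sum.cartesian_product UNIV_Times_UNIV[symmetric] del: UNIV_Times_UNIV)
  then show ?thesis by (simp add: sum.swap[of "\<lambda>i j. B j i"])
qed

lemma monom_flat: "monom_fun (flat B) (entries X) = (\<Prod>j\<in>UNIV. monom_fun (B j) (\<lambda>i. X $ i $ j))"
proof -
  have "monom_fun (flat B) (entries X) = (\<Prod>i\<in>UNIV. \<Prod>j\<in>UNIV. (X $ i $ j) ^ B j i)"
    unfolding monom_fun_def flat_def entries_def
    by (simp add: prod.cartesian_product UNIV_Times_UNIV[symmetric] case_prod_beta del: UNIV_Times_UNIV)
  then show ?thesis unfolding monom_fun_def by (simp add: prod.swap[of "\<lambda>i j. (X $ i $ j) ^ B j i"])
qed

text \<open>Left multiplication acts on every column of \<open>X\<close> separately, so the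
  coefficients are products over columns. The product set \<open>col_exps_le K\<close> is what the
  product of the column sums expands into.\<close>

lemma monom_flat_mult:
  assumes "B \<in> col_exps_le K"
  shows "monom_fun (flat B) (entries (M ** X)) =
    (\<Sum>C\<in>col_exps_le K. (\<Prod>j\<in>UNIV. sym_entry K M (B j) (C j)) * monom_fun (flat C) (entries X))"
proof -
  have "monom_fun (flat B) (entries (M ** X))
      = (\<Prod>j\<in>UNIV. \<Sum>c\<in>exps_le K. sym_entry K M (B j) c * monom_fun c (\<lambda>i. X $ i $ j))"
    unfolding monom_flat matrix_mult_nth by (simp only: monom_linear_expand[OF col_exps_leD[OF assms]])
  also have "\<dots> = (\<Sum>C\<in>col_exps_le K. \<Prod>j\<in>UNIV. sym_entry K M (B j) (C j) * monom_fun (C j) (\<lambda>i. X $ i $ j))"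
    unfolding col_exps_le_def by (rule prod_sum_PiE) auto
  finally show ?thesis by (simp add: prod.distrib monom_flat)
qed

lemma coeff_at_flat:
  assumes "B \<in> col_exps_le K" "C \<in> col_exps_le K"
  shows "coeff_at (Suc K) (flat B) (monom_fun (flat C)) = (if B = C then 1 else 0)"
proof -
  have "flat B = flat C \<longleftrightarrow> B = C" using inj_flat[of UNIV] by (auto dest: injD)
  then show ?thesis
    using coeff_at_monom[of "Suc K" "flat B" "flat C"] flat_less[OF assms(1)] flat_less[OF assms(2)] by simp
qed

text \<open>These diagonal coefficients, weighted and summed over \<open>B\<close>, are the terms of
  a product of \<open>sym_trace\<close> values.\<close>

lemma coeff_at_monom_flat_mult:
  assumes B: "B \<in> col_exps_le K"
  shows "coeff_at (Suc K) (flat B) (\<lambda>x. monom_fun (flat B) (entries (M ** mat_of x)))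
    = (\<Prod>j\<in>UNIV. sym_entry K M (B j) (B j))"
proof -
  have "coeff_at (Suc K) (flat B) (\<lambda>x. monom_fun (flat B) (entries (M ** mat_of x)))
      = (\<Sum>C\<in>col_exps_le K. (\<Prod>j\<in>UNIV. sym_entry K M (B j) (C j)) * (if B = C then 1 else 0))"
    using B by (simp add: monom_flat_mult coeff_at_sum coeff_at_scale coeff_at_flat cong: sum.cong)
  then show ?thesis using B by (simp add: if_distrib[of "\<lambda>x. y * x" for y] cong: if_cong)
qed

lemma poly_mat_expand_flat:
  fixes F :: "complex^'n^'n \<Rightarrow> complex"
  assumes F: "poly_mat d F" and "d \<le> K"
  shows "F X = (\<Sum>B\<in>col_exps_le K. coeff_at (Suc K) (flat B) (\<lambda>x. F (mat_of x)) * monom_fun (flat B) (entries X))"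
proof -
  have sub: "{a. sum a UNIV \<le> d} \<subseteq> flat ` (col_exps_le K :: ('n \<Rightarrow> 'n \<Rightarrow> nat) set)"
  proof
    fix a :: "'n \<times> 'n \<Rightarrow> nat" assume "a \<in> {a. sum a UNIV \<le> d}"
    then have a: "sum a UNIV \<le> K" using assms(2) by simp
    define B where "B j i = a (i, j)" for i j
    have fB: "a = flat B" by (simp add: flat_def B_def fun_eq_iff)
    have "sum (B j) UNIV \<le> K" for j
      using a member_le_sum[of j UNIV "\<lambda>j. sum (B j) UNIV"] by (simp add: fB sum_flat)
    then have "B \<in> col_exps_le K" by (auto simp: col_exps_le_def exps_le_def)
    then show "a \<in> flat ` col_exps_le K" using fB by blast
  qed
  have "F (mat_of (entries X)) = (\<Sum>a\<in>flat ` (col_exps_le K :: ('n \<Rightarrow> 'n \<Rightarrow> nat) set).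
      coeff_at (Suc K) a (\<lambda>x. F (mat_of x)) * monom_fun a (entries X))"
    by (rule poly_fun_expand[OF F[unfolded poly_mat_def] _ sub]) (auto intro: flat_less)
  then show ?thesis by (simp add: sum.reindex[OF inj_flat])
qed

lemma poly_mat_sum_monom_flat:
  "poly_mat (CARD('n) * K) (\<lambda>X :: complex^'n^'n. \<Sum>B\<in>col_exps_le K. c B * monom_fun (flat B) (entries X))"
proof -
  have "sum (flat B) UNIV \<le> CARD('n) * K" if "B \<in> col_exps_le K" for B :: "'n \<Rightarrow> 'n \<Rightarrow> nat"
    using sum_bounded_above[of UNIV "\<lambda>j. sum (B j) UNIV" K] col_exps_leD[OF that]
    by (simp add: sum_flat exps_le_def)
  then show ?thesis
    unfolding poly_mat_def by (auto intro!: poly_fun_sum poly_fun_scale poly_fun_monom)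
qed

lemma continuous_on_monom_entries [continuous_intros]:
  assumes "continuous_on S g"
  shows "continuous_on S (\<lambda>x. monom_fun a (entries (g x)))"
  unfolding monom_fun_def entries_def case_prod_beta using assms by (intro continuous_intros)

lemma continuous_on_coeff_at:
  assumes "\<And>x. continuous_on S (\<lambda>M. G M x)"
  shows "continuous_on S (\<lambda>M. coeff_at N a (G M))"
  unfolding coeff_at_def by (intro continuous_intros assms)

text \<open>For unitary \<open>X\<close> the two integrals agree by the substitution \<open>M \<mapsto> X M\<close>; both are polynomials
  in \<open>X\<close>.\<close>

lemma haar_exchange:
  fixes F :: "complex^'n^'n \<Rightarrow> complex"
  assumes H: "normalized_haar H" and F: "poly_mat d F" "d \<le> K" and B: "B \<in> col_exps_le K"
  shows "(\<integral>M. F M * monom_fun (flat B) (entries (adjoint_mat M ** X)) \<partial>H)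
    = (\<integral>M. F (X ** M) * monom_fun (flat B) (entries (adjoint_mat M)) \<partial>H)"
proof -
  note cF = poly_mat_continuous[OF F(1)]
  have cFX: "continuous_on UNIV (\<lambda>M. F (X ** M))" for X :: "complex^'n^'n"
    by (rule poly_mat_continuous[OF poly_mat_mult_left[OF F(1)]])
  define L where "L X = (\<integral>M. F M * monom_fun (flat B) (entries (adjoint_mat M ** X)) \<partial>H)" for X
  define R where "R X = (\<integral>M. F (X ** M) * monom_fun (flat B) (entries (adjoint_mat M)) \<partial>H)" for X
  define cL where "cL C = (\<integral>M. F M * (\<Prod>j\<in>UNIV. sym_entry K (adjoint_mat M) (B j) (C j)) \<partial>H)" for C
  define fR where "fR C M = coeff_at (Suc K) (flat C) (\<lambda>x. F (mat_of x ** M))" for C M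
  define cR where "cR C = (\<integral>M. fR C M * monom_fun (flat B) (entries (adjoint_mat M)) \<partial>H)" for C
  have sym_cont: "continuous_on UNIV (\<lambda>M. sym_entry K (adjoint_mat M) a b)" for a b :: "'n \<Rightarrow> nat"
    by (rule continuous_on_compose2[OF sym_entry_continuous[of UNIV]]) (auto intro!: continuous_intros)
  have L: "L X = (\<Sum>C\<in>col_exps_le K. cL C * monom_fun (flat C) (entries X))" for X
  proof -
    have "L X = (\<integral>M. (\<Sum>C\<in>col_exps_le K. F M * (\<Prod>j\<in>UNIV. sym_entry K (adjoint_mat M) (B j) (C j))
        * monom_fun (flat C) (entries X)) \<partial>H)"
      unfolding L_def monom_flat_mult[OF B] by (simp add: sum_distrib_left mult.assoc)
    also have "\<dots> = (\<Sum>C\<in>col_exps_le K. (\<integral>M. F M * (\<Prod>j\<in>UNIV. sym_entry K (adjoint_mat M) (B j) (C j))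
        * monom_fun (flat C) (entries X) \<partial>H))"
      by (intro Bochner_Integration.integral_sum haar_integrable[OF H] continuous_intros cF sym_cont)
    finally show ?thesis by (simp add: cL_def)
  qed
  have fR_cont: "continuous_on UNIV (fR C)" for C
    unfolding fR_def by (intro continuous_on_coeff_at cFX)
  have R: "R X = (\<Sum>C\<in>col_exps_le K. cR C * monom_fun (flat C) (entries X))" for X
  proof -
    have "R X = (\<integral>M. (\<Sum>C\<in>col_exps_le K. fR C M * monom_fun (flat B) (entries (adjoint_mat M))
        * monom_fun (flat C) (entries X)) \<partial>H)"
      unfolding R_def fR_def poly_mat_expand_flat[OF poly_mat_mult_right[OF F(1)] F(2), of X]
      by (simp add: sum_distrib_left mult_ac)
    also have "\<dots> = (\<Sum>C\<in>col_exps_le K. (\<integral>M. fR C M * monom_fun (flat B) (entries (adjoint_mat M))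
        * monom_fun (flat C) (entries X) \<partial>H))"
      by (intro Bochner_Integration.integral_sum haar_integrable[OF H] continuous_intros fR_cont)
    finally show ?thesis by (simp add: cR_def)
  qed
  have poly: "poly_mat (CARD('n) * K) (\<lambda>X. L X - R X)"
    using poly_mat_sum_monom_flat[of K "\<lambda>C. cL C - cR C"]
    by (simp add: L R sum_subtractf left_diff_distrib)
  have "L U - R U = 0" if U: "U \<in> unitary_group" for U
  proof -
    have "L U = (\<integral>M. F (U ** M) * monom_fun (flat B) (entries (adjoint_mat (U ** M) ** U)) \<partial>H)"
      unfolding L_def by (rule haar_left_invariant[OF H _ U, symmetric]) (intro continuous_intros cF)
    also have "\<dots> = R U"
    proof -
      have "adjoint_mat U ** U = mat 1"
        using U by (simp add: unitary_group_def)
      then have "adjoint_mat (U ** M) ** U = adjoint_mat M" for M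
        by (simp add: adjoint_mat_mult matrix_mul_assoc[symmetric])
      then show ?thesis by (simp add: R_def)
    qed
    finally show ?thesis by simp
  qed
  from poly_mat_zero_of_unitary[OF poly this, of X] show ?thesis by (simp add: L_def R_def)
qed

text \<open>The cut at \<open>K\<close> loses nothing: since \<open>d \<le> K\<close>, the exponent
  families in \<open>col_exps_le K\<close> already contain every monomial of
  \<open>X \<mapsto> F (X ** M)\<close>.\<close>

theorem haar_reproducing:
  fixes F :: "complex^'n^'n \<Rightarrow> complex"
  assumes H: "normalized_haar H" and F: "poly_mat d F" "d \<le> K" and cl: "class_fun F"
  shows "(\<integral>M. F M * (\<Prod>j\<in>UNIV. sym_trace K (u j) (adjoint_mat M)) \<partial>H) = F (diag_of u)"
proof -
  interpret prob_space H using H by (simp add: normalized_haar_def)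
  note cF = poly_mat_continuous[OF F(1)]
  have cFX: "continuous_on UNIV (\<lambda>M. F (X ** M))" for X :: "complex^'n^'n"
    by (rule poly_mat_continuous[OF poly_mat_mult_left[OF F(1)]])
  have sym_cont: "continuous_on UNIV (\<lambda>M. sym_entry K (adjoint_mat M) a b)" for a b :: "'n \<Rightarrow> nat"
    by (rule continuous_on_compose2[OF sym_entry_continuous[of UNIV]]) (auto intro!: continuous_intros)
  define U where "U B = (\<Prod>j\<in>UNIV. u j ^ sum (B j) UNIV)" for B :: "'n \<Rightarrow> 'n \<Rightarrow> nat"
  define T where "T B M = (\<Prod>j\<in>UNIV. sym_entry K (adjoint_mat M) (B j) (B j))" for B :: "'n \<Rightarrow> 'n \<Rightarrow> nat" and M :: "complex^'n^'n"
  define f where "f B M = coeff_at (Suc K) (flat B) (\<lambda>x. F (mat_of x ** M))" for B M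
  have T_cont: "continuous_on UNIV (T B)" for B
    unfolding T_def by (intro continuous_intros sym_cont)
  have f_cont: "continuous_on UNIV (f B)" for B
    unfolding f_def by (intro continuous_on_coeff_at cFX)
  have exchange: "(\<integral>M. F M * T B M \<partial>H) = (\<integral>M. f B M * monom_fun (flat B) (entries (adjoint_mat M)) \<partial>H)"
    if B: "B \<in> col_exps_le K" for B
  proof -
    have "(\<integral>M. F M * T B M \<partial>H)
        = (\<integral>M. coeff_at (Suc K) (flat B) (\<lambda>x. F M * monom_fun (flat B) (entries (adjoint_mat M ** mat_of x))) \<partial>H)"
      by (simp add: T_def coeff_at_monom_flat_mult[OF B, symmetric] coeff_at_scale)
    also have "\<dots> = coeff_at (Suc K) (flat B)
        (\<lambda>x. \<integral>M. F M * monom_fun (flat B) (entries (adjoint_mat M ** mat_of x)) \<partial>H)"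
      by (intro coeff_at_integral[symmetric] haar_integrable[OF H] continuous_intros cF)
    also have "\<dots> = coeff_at (Suc K) (flat B)
        (\<lambda>x. \<integral>M. F (mat_of x ** M) * monom_fun (flat B) (entries (adjoint_mat M)) \<partial>H)"
      by (simp add: haar_exchange[OF H F B])
    also have "\<dots> = (\<integral>M. coeff_at (Suc K) (flat B)
        (\<lambda>x. F (mat_of x ** M) * monom_fun (flat B) (entries (adjoint_mat M))) \<partial>H)"
      by (intro coeff_at_integral haar_integrable[OF H] continuous_intros cFX)
    also have "\<dots> = (\<integral>M. f B M * monom_fun (flat B) (entries (adjoint_mat M)) \<partial>H)"
      by (simp add: f_def mult.commute[of _ "monom_fun _ _"] coeff_at_scale)
    finally show ?thesis .
  qed
  have sym_trace_prod: "(\<Prod>j\<in>UNIV. sym_trace K (u j) (adjoint_mat M)) = (\<Sum>B\<in>col_exps_le K. U B * T B M)" for M :: "complex^'n^'n"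
  proof -
    have "(\<Prod>j\<in>UNIV. sym_trace K (u j) (adjoint_mat M))
        = (\<Sum>B\<in>col_exps_le K. \<Prod>j\<in>UNIV. u j ^ sum (B j) UNIV * sym_entry K (adjoint_mat M) (B j) (B j))"
      unfolding sym_trace_def col_exps_le_def by (rule prod_sum_PiE) auto
    then show ?thesis by (simp add: U_def T_def prod.distrib)
  qed
  have "(\<integral>M. F M * (\<Prod>j\<in>UNIV. sym_trace K (u j) (adjoint_mat M)) \<partial>H)
      = (\<integral>M. (\<Sum>B\<in>col_exps_le K. U B * (F M * T B M)) \<partial>H)"
    by (simp add: sym_trace_prod sum_distrib_left mult_ac)
  also have "\<dots> = (\<Sum>B\<in>col_exps_le K. U B * (\<integral>M. F M * T B M \<partial>H))"
    by (subst Bochner_Integration.integral_sum)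
      (auto intro!: haar_integrable[OF H] continuous_intros cF T_cont)
  also have "\<dots> = (\<Sum>B\<in>col_exps_le K. (\<integral>M. f B M * (U B * monom_fun (flat B) (entries (adjoint_mat M))) \<partial>H))"
    by (simp add: exchange mult.left_commute[of _ "U _"] cong: sum.cong)
  also have "\<dots> = (\<integral>M. (\<Sum>B\<in>col_exps_le K. f B M * (U B * monom_fun (flat B) (entries (adjoint_mat M)))) \<partial>H)"
    by (rule Bochner_Integration.integral_sum[symmetric])
      (intro haar_integrable[OF H] continuous_intros f_cont)
  also have "\<dots> = (\<integral>M. F (diag_of u) \<partial>H)"
  proof (rule Bochner_Integration.integral_cong[OF refl])
    fix M assume "M \<in> space H"
    then have M: "adjoint_mat M ** M = mat 1"
      using H by (simp add: normalized_haar_def unitary_group_def)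
    \<comment> \<open>The weights rescale column \<open>j\<close> by \<open>u j\<close>. The sum
      over \<open>B\<close> is therefore the expansion of \<open>X \<mapsto> F (X ** M)\<close>
      evaluated at \<open>X = adjoint_mat M ** diag_of u\<close>.\<close>
    have "U B * monom_fun (flat B) (entries (adjoint_mat M)) = monom_fun (flat B) (entries (adjoint_mat M ** diag_of u))"
      for B :: "'n \<Rightarrow> 'n \<Rightarrow> nat"
      unfolding monom_flat diag_of_mult_right unfolding U_def monom_fun_def power_mult_distrib prod.distrib power_sum
      by (simp add: mult.commute)
    then have "(\<Sum>B\<in>col_exps_le K. f B M * (U B * monom_fun (flat B) (entries (adjoint_mat M))))
        = F (adjoint_mat M ** diag_of u ** M)"
      using poly_mat_expand_flat[OF poly_mat_mult_right[OF F(1)] F(2), of "adjoint_mat M ** diag_of u" M]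
      by (simp add: f_def)
    then show "(\<Sum>B\<in>col_exps_le K. f B M * (U B * monom_fun (flat B) (entries (adjoint_mat M)))) = F (diag_of u)"
      using class_funD[OF cl M] by simp
  qed
  finally show ?thesis by (simp add: prob_space)
qed

section \<open>Elementary Schur polynomials\<close>

text \<open>Division by a positive integer goes through \<open>scaleR\<close>, so recursions can be
  solved for complex numbers and for formal series alike.\<close>

lemma real_algebra_of_nat_cancel:
  fixes a b :: "'a::real_algebra_1"
  assumes "of_nat (Suc k) * a = of_nat (Suc k) * b"
  shows "a = b"
proof -
  have "real (Suc k) *\<^sub>R a = real (Suc k) *\<^sub>R b"
    using assms by (simp only: scaleR_conv_of_real of_real_of_nat_eq)
  then show ?thesis by (simp del: of_nat_Suc)
qed

definition schur_series :: "(nat \<Rightarrow> 'a) \<Rightarrow> 'a::{comm_ring_1,real_algebra_1} fps" where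
  "schur_series t = Abs_fps (\<lambda>k. elem_schur t (int k))"

definition exponent_series :: "(nat \<Rightarrow> 'a) \<Rightarrow> 'a::zero fps" where
  "exponent_series t = Abs_fps (\<lambda>i. if i = 0 then 0 else t i)"

lemma elem_schur_neg [simp]: "k < 0 \<Longrightarrow> elem_schur t k = 0"
  by (simp add: elem_schur_def)

lemma elem_schur_0 [simp]: "elem_schur t 0 = 1"
  by (simp add: elem_schur_def)

lemma elem_schur_nth: "elem_schur t (int k) = fps_nth (schur_series t) k"
  by (simp add: schur_series_def)

lemma schur_series_0: "fps_nth (schur_series t) 0 = 1"
  by (simp add: schur_series_def)

text \<open>The differential equation of the exponential. With constant term 1 it characterizes the
  generating series of the elementary Schur polynomials.\<close>

lemma schur_series_deriv:
  fixes t :: "nat \<Rightarrow> 'a::{comm_ring_1,real_algebra_1}"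
  shows "fps_deriv (schur_series t) = fps_deriv (exponent_series t) * schur_series t"
proof (rule fps_ext)
  fix k
  define T where "T = exponent_series t"
  define c :: "nat \<Rightarrow> 'a" where "c m = (1 / fact m) *\<^sub>R 1" for m
  have T0: "fps_nth T 0 = 0" by (simp add: T_def exponent_series_def)
  have c: "of_nat (Suc m) * c (Suc m) = c m" for m
  proof -
    have "of_nat (Suc m) * c (Suc m) = (real (Suc m) * (1 / fact (Suc m))) *\<^sub>R (1::'a)"
      unfolding c_def by (simp only: scaleR_conv_of_real of_real_mult of_real_of_nat_eq mult_1_right)
    also have "real (Suc m) * (1 / fact (Suc m)) = 1 / fact m" by (simp add: divide_simps)
    finally show ?thesis by (simp add: c_def)
  qed
  \<comment> \<open>As \<open>T\<close> has no constant term, \<open>T ^ m\<close> starts in degree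
    \<open>m\<close>. The sum can thus be cut at one bound \<open>K\<close> common to several
    coefficients.\<close>
  have E: "fps_nth (schur_series t) k = (\<Sum>m\<le>K. c m * fps_nth (T ^ m) k)" if "k \<le> K" for k K
  proof -
    have "fps_nth (schur_series t) k = (\<Sum>m=0..k. c m * fps_nth (T ^ m) k)"
      by (simp add: schur_series_def elem_schur_def fps_compose_nth T_def exponent_series_def c_def)
    also have "\<dots> = (\<Sum>m\<le>K. c m * fps_nth (T ^ m) k)"
      using that startsby_zero_power_prefix[OF T0] by (intro sum.mono_neutral_left) auto
    finally show ?thesis .
  qed
  have "fps_nth (fps_deriv (schur_series t)) k = (\<Sum>m\<le>Suc k. c m * fps_nth (fps_deriv (T ^ m)) k)"
    by (simp only: fps_deriv_nth Suc_eq_plus1[symmetric] E[OF order_refl] sum_distrib_left mult.left_commute)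
  also have "\<dots> = (\<Sum>m\<le>k. c (Suc m) * fps_nth (fps_deriv (T ^ Suc m)) k)"
    by (subst sum.atMost_Suc_shift) simp
  also have "\<dots> = (\<Sum>m\<le>k. c m * fps_nth (fps_deriv T * T ^ m) k)"
  proof (rule sum.cong[OF refl])
    fix m
    have "c (Suc m) * fps_nth (fps_deriv (T ^ Suc m)) k = of_nat (Suc m) * c (Suc m) * fps_nth (fps_deriv T * T ^ m) k"
      by (simp only: fps_deriv_power mult.assoc fps_mult_left_const_nth diff_Suc_1) (simp only: mult.left_commute)
    then show "c (Suc m) * fps_nth (fps_deriv (T ^ Suc m)) k = c m * fps_nth (fps_deriv T * T ^ m) k"
      by (simp only: c)
  qed
  also have "\<dots> = (\<Sum>i=0..k. fps_nth (fps_deriv T) i * (\<Sum>m\<le>k. c m * fps_nth (T ^ m) (k - i)))"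
    unfolding fps_mult_nth sum_distrib_left by (subst sum.swap) (simp add: mult_ac)
  also have "\<dots> = (\<Sum>i=0..k. fps_nth (fps_deriv T) i * fps_nth (schur_series t) (k - i))"
    by (simp add: E[of "k - _" k])
  finally show "fps_nth (fps_deriv (schur_series t)) k = fps_nth (fps_deriv (exponent_series t) * schur_series t) k"
    by (simp add: fps_mult_nth T_def)
qed

text \<open>The equation determines the coefficient of degree \<open>l + 1\<close> from the lower
  ones. The product rules for \<open>schur_series\<close> follow because both sides solve the same
  equation.\<close>

lemma schur_series_unique:
  fixes F :: "'a::{comm_ring_1,real_algebra_1} fps"
  assumes "fps_nth F 0 = 1" and F: "fps_deriv F = fps_deriv (exponent_series t) * F"
  shows "F = schur_series t"
proof (rule fps_ext)
  fix k
  show "fps_nth F k = fps_nth (schur_series t) k"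
  proof (induction k rule: less_induct)
    case (less k)
    show ?case
    proof (cases k)
      case 0
      then show ?thesis using assms(1) by (simp add: schur_series_0)
    next
      case (Suc l)
      have "of_nat (Suc l) * fps_nth F (Suc l) = fps_nth (fps_deriv F) l" by simp
      also have "\<dots> = fps_nth (fps_deriv (schur_series t)) l"
        unfolding F schur_series_deriv fps_mult_nth using less.IH Suc by (intro sum.cong) auto
      also have "\<dots> = of_nat (Suc l) * fps_nth (schur_series t) (Suc l)" by simp
      finally show ?thesis unfolding Suc by (rule real_algebra_of_nat_cancel)
    qed
  qed
qed

lemma schur_series_add:
  "schur_series (\<lambda>i. s i + t i) = schur_series s * schur_series t"
proof (rule schur_series_unique[symmetric])
  have "exponent_series (\<lambda>i. s i + t i) = exponent_series s + exponent_series t"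
    by (simp add: exponent_series_def fps_eq_iff)
  then show "fps_deriv (schur_series s * schur_series t)
      = fps_deriv (exponent_series (\<lambda>i. s i + t i)) * (schur_series s * schur_series t)"
    by (simp add: schur_series_deriv algebra_simps)
qed (simp add: schur_series_0)

lemma schur_series_zero: "schur_series (\<lambda>i. 0) = 1"
  by (rule schur_series_unique[symmetric]) (simp_all add: exponent_series_def fps_eq_iff)

lemma schur_series_sum: "schur_series (\<lambda>i. \<Sum>j\<in>J. t j i) = (\<Prod>j\<in>J. schur_series (t j))"
  by (induction J rule: infinite_finite_induct) (simp_all add: schur_series_zero schur_series_add)

text \<open>The exponent here is the series of \<open>- log (1 - w z)\<close>.\<close>

lemma schur_series_geometric:
  fixes w :: complex
  shows "schur_series (\<lambda>i. w ^ i / of_nat i) = Abs_fps (\<lambda>m. w ^ m)"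
proof (rule schur_series_unique[symmetric])
  show "fps_deriv (Abs_fps (\<lambda>m. w ^ m)) = fps_deriv (exponent_series (\<lambda>i. w ^ i / of_nat i)) * Abs_fps (\<lambda>m. w ^ m)"
  proof (rule fps_ext)
    fix k
    have "(\<Sum>i=0..k. w ^ Suc i * w ^ (k - i)) = (\<Sum>i=0..k. w ^ Suc k)"
      by (rule sum.cong) (simp_all add: power_add[symmetric])
    then show "fps_nth (fps_deriv (Abs_fps (\<lambda>m. w ^ m))) k
        = fps_nth (fps_deriv (exponent_series (\<lambda>i. w ^ i / of_nat i)) * Abs_fps (\<lambda>m. w ^ m)) k"
      by (simp add: fps_mult_nth exponent_series_def del: of_nat_Suc power_Suc)
  qed
qed simp

definition power_sum :: "nat \<Rightarrow> (nat \<Rightarrow> complex) \<Rightarrow> nat \<Rightarrow> complex" where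
  "power_sum n w i = (\<Sum>j<n. w j ^ i)"

text \<open>The complete homogeneous symmetric polynomials of \<open>w 0, ..., w (n - 1)\<close>.
  Going through power sums makes them match traces of matrix powers directly.\<close>

definition complete_hom :: "nat \<Rightarrow> (nat \<Rightarrow> complex) \<Rightarrow> int \<Rightarrow> complex" where
  "complete_hom n w = elem_schur (\<lambda>i. power_sum n w i / of_nat i)"

lemma complete_hom_series:
  "schur_series (\<lambda>i. power_sum n w i / of_nat i) = (\<Prod>j<n. Abs_fps (\<lambda>m. w j ^ m))"
  by (simp add: power_sum_def sum_divide_distrib schur_series_sum schur_series_geometric)

lemma complete_hom_nth: "complete_hom n w (int k) = fps_nth (\<Prod>j<n. Abs_fps (\<lambda>m. w j ^ m)) k"
  by (simp add: complete_hom_def elem_schur_nth complete_hom_series)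

text \<open>Exponent vectors of degree \<open>k\<close> are the multisets of size \<open>k\<close>,
  over which a coefficient of a product of series is expanded.\<close>

lemma sum_monom_fun_fixed_degree:
  fixes d :: "'v::finite \<Rightarrow> complex"
  shows "(\<Sum>a | sum a UNIV = k. monom_fun a d) = fps_nth (\<Prod>v\<in>UNIV. Abs_fps (\<lambda>m. d v ^ m)) k"
proof -
  have size: "size X = (\<Sum>v\<in>UNIV. count X v)" for X :: "'v multiset"
    unfolding size_multiset_overloaded_eq
    by (rule sum.mono_neutral_left) (auto simp: not_in_iff)
  have count: "count (Abs_multiset a) = a" for a :: "'v \<Rightarrow> nat"
    by (simp add: count_Abs_multiset)
  have "fps_nth (\<Prod>v\<in>UNIV. Abs_fps (\<lambda>m. d v ^ m)) k
      = (\<Sum>X | size X = k. monom_fun (count X) d)"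
    by (simp add: fps_prod_nth' multisets_of_size_def monom_fun_def)
  also have "\<dots> = (\<Sum>a | sum a UNIV = k. monom_fun a d)"
    by (rule sum.reindex_bij_witness[of _ Abs_multiset count]) (auto simp: size count count_inverse)
  finally show ?thesis ..
qed

lemma sym_trace_diag_complete_hom:
  fixes w :: "nat \<Rightarrow> complex" and e :: "'n::finite \<Rightarrow> nat"
  assumes e: "bij_betw e UNIV {..<n}"
  shows "sym_trace K u (diag_of (\<lambda>i. w (e i)) :: complex^'n^'n) = (\<Sum>k\<le>K. u ^ k * complete_hom n w (int k))"
proof -
  have "sym_trace K u (diag_of (\<lambda>i. w (e i)) :: complex^'n^'n)
      = (\<Sum>a\<in>exps_le K. u ^ sum a UNIV * monom_fun a (\<lambda>i. w (e i)))"
    by (rule sym_trace_diag)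
  also have "\<dots> = (\<Sum>k\<le>K. \<Sum>a | a \<in> exps_le K \<and> sum a UNIV = k. u ^ sum a UNIV * monom_fun a (\<lambda>i. w (e i)))"
    by (rule sum.group[symmetric]) (auto simp: exps_le_def finite_sum_le)
  also have "\<dots> = (\<Sum>k\<le>K. u ^ k * complete_hom n w (int k))"
  proof (rule sum.cong[OF refl])
    fix k assume "k \<in> {..K}"
    then have "{a :: 'n \<Rightarrow> nat. a \<in> exps_le K \<and> sum a UNIV = k} = {a. sum a UNIV = k}"
      by (auto simp: exps_le_def)
    then have "(\<Sum>a | a \<in> exps_le K \<and> sum a UNIV = k. u ^ sum a UNIV * monom_fun a (\<lambda>i. w (e i)))
        = u ^ k * (\<Sum>a | sum a UNIV = k. monom_fun a (\<lambda>i. w (e i)))"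
      by (simp add: sum_distrib_left)
    also have "(\<Sum>a | sum a UNIV = k. monom_fun a (\<lambda>i. w (e i))) = complete_hom n w (int k)"
      unfolding sum_monom_fun_fixed_degree complete_hom_nth
      by (simp add: prod.reindex_bij_betw[OF e, of "\<lambda>j. Abs_fps (\<lambda>m. w j ^ m)"])
    finally show "(\<Sum>a | a \<in> exps_le K \<and> sum a UNIV = k. u ^ sum a UNIV * monom_fun a (\<lambda>i. w (e i)))
        = u ^ k * complete_hom n w (int k)" .
  qed
  finally show ?thesis .
qed

section \<open>Determinantal identities\<close>

definition detf :: "nat \<Rightarrow> (nat \<Rightarrow> nat \<Rightarrow> 'a) \<Rightarrow> 'a::comm_ring_1" where
  "detf n f = Determinant.det (Matrix.mat n n (\<lambda>(i, j). f i j))"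

lemma detf_leibniz: "detf n f = (\<Sum>p | p permutes {0..<n}. signof p * (\<Prod>i=0..<n. f i (p i)))"
proof -
  have "detf n f = (\<Sum>p | p permutes {0..<n}. signof p * (\<Prod>i=0..<n. Matrix.mat n n (\<lambda>(i, j). f i j) $$ (i, p i)))"
    unfolding detf_def by (rule det_def') simp
  also have "\<dots> = (\<Sum>p | p permutes {0..<n}. signof p * (\<Prod>i=0..<n. f i (p i)))"
    by (intro sum.cong refl arg_cong2[where f = "(*)"] prod.cong) (auto simp: permutes_in_image)
  finally show ?thesis .
qed

lemma detf_cong: "(\<And>i j. i < n \<Longrightarrow> j < n \<Longrightarrow> f i j = g i j) \<Longrightarrow> detf n f = detf n g"
  unfolding detf_leibniz
  by (intro sum.cong refl arg_cong2[where f = "(*)"] prod.cong) (auto simp: permutes_in_image)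

lemma detf_transpose: "detf n (\<lambda>i j. f j i) = detf n f"
proof -
  have "detf n (\<lambda>i j. f j i) = Determinant.det (transpose_mat (Matrix.mat n n (\<lambda>(i, j). f i j)))"
    unfolding detf_def by (rule arg_cong[where f = Determinant.det]) auto
  then show ?thesis unfolding detf_def by (simp add: Determinant.det_transpose[of _ n])
qed

lemma detf_mult: "detf n (\<lambda>i j. \<Sum>l<n. f i l * g l j) = detf n f * detf n g"
proof -
  have "Matrix.mat n n (\<lambda>(i, j). \<Sum>l<n. f i l * g l j)
      = Matrix.mat n n (\<lambda>(i, j). f i j) * Matrix.mat n n (\<lambda>(i, j). g i j)"
    by (rule eq_matI) (auto simp: scalar_prod_def lessThan_atLeast0 intro!: sum.cong)
  then show ?thesis unfolding detf_def by (simp add: Determinant.det_mult[of _ n])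
qed

lemma detf_permute_rows: "p permutes {0..<n} \<Longrightarrow> detf n (\<lambda>i j. f (p i) j) = signof p * detf n f"
proof -
  assume p: "p permutes {0..<n}"
  have "Matrix.mat n n (\<lambda>(i, j). f (p i) j) = Matrix.mat n n (\<lambda>(i, j). Matrix.mat n n (\<lambda>(i, j). f i j) $$ (p i, j))"
    by (rule eq_matI) (use p in \<open>auto simp: permutes_in_image\<close>)
  then show ?thesis unfolding detf_def using Determinant.det_permute_rows[of "Matrix.mat n n (\<lambda>(i, j). f i j)" n p] p by simp
qed

lemma detf_identical_rows:
  assumes "i < n" "k < n" "i \<noteq> k" "\<And>j. j < n \<Longrightarrow> f i j = f k j"
  shows "detf n f = 0"
  unfolding detf_def
  by (rule Determinant.det_identical_rows[of _ n i k]) (use assms in auto)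

lemma detf_unitriangular:
  assumes "\<And>i j. i < j \<Longrightarrow> j < n \<Longrightarrow> f i j = 0" "\<And>i. i < n \<Longrightarrow> f i i = 1"
  shows "detf n f = 1"
proof -
  have "detf n f = prod_list (diag_mat (Matrix.mat n n (\<lambda>(i, j). f i j)))"
    unfolding detf_def by (rule Determinant.det_lower_triangular[where n = n]) (use assms in auto)
  also have "\<dots> = (\<Prod>i=0..<n. f i i)" by (simp add: diag_mat_def prod.list_conv_set_nth)
  finally show ?thesis using assms(2) by simp
qed

lemma detf_scale_cols: "detf n (\<lambda>i j. f i j * c j) = detf n f * (\<Prod>j<n. c j)"
proof -
  have "(\<Prod>i=0..<n. c (p i)) = (\<Prod>j<n. c j)" if "p permutes {0..<n}" for p
    using prod.permute[OF that, of c] by (simp add: o_def lessThan_atLeast0)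
  then show ?thesis
    by (auto simp: detf_leibniz prod.distrib sum_distrib_right mult.assoc intro!: sum.cong)
qed

section \<open>The Cauchy--Binet formula\<close>

definition strict_seqs :: "nat \<Rightarrow> nat \<Rightarrow> (nat \<Rightarrow> nat) set" where
  "strict_seqs n N = {x \<in> {0..<n} \<rightarrow>\<^sub>E {0..<N}. strict_mono_on {0..<n} x}"

lemma finite_strict_seqs [simp]: "finite (strict_seqs n N)"
  unfolding strict_seqs_def by (rule finite_subset[of _ "{0..<n} \<rightarrow>\<^sub>E {0..<N}"]) (auto intro!: finite_PiE)

lemma strict_mono_on_image_unique:
  fixes x y :: "nat \<Rightarrow> nat"
  assumes "strict_mono_on {0..<n} x" "strict_mono_on {0..<n} y" "x ` {0..<n} = y ` {0..<n}" "i < n"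
  shows "x i = y i"
proof -
  have "sorted_wrt (<) (map x [0..<n])" if "strict_mono_on {0..<n} x" for x :: "nat \<Rightarrow> nat"
    using that by (auto simp: sorted_wrt_iff_nth_less strict_mono_on_def)
  then have "map x [0..<n] = map y [0..<n]"
    using assms by (intro sorted_distinct_set_unique) (auto simp: strict_sorted_iff)
  then show ?thesis using assms(4) by simp
qed

text \<open>An injective map is, in a unique way, the increasing enumeration of its image composed
  with a permutation. Extensionality of \<open>strict_seqs\<close> makes each
  \<open>n\<close>-element subset of \<open>{0..<N}\<close> occur once.\<close>

lemma bij_betw_strict_permutation:
  "bij_betw (\<lambda>(x, p). restrict (x \<circ> p) {0..<n}) (strict_seqs n N \<times> {p. p permutes {0..<n}})
     {f \<in> {0..<n} \<rightarrow>\<^sub>E {0..<N}. inj_on f {0..<n}}"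
proof (rule bij_betw_imageI)
  let ?g = "\<lambda>(x, p). restrict (x \<circ> p) {0..<n}"
  have inj: "inj_on x {0..<n}" if "x \<in> strict_seqs n N" for x
    using that by (auto simp: strict_seqs_def intro: strict_mono_on_imp_inj_on)
  show "inj_on ?g (strict_seqs n N \<times> {p. p permutes {0..<n}})"
  proof (rule inj_onI, clarify)
    fix x p y q
    assume x: "x \<in> strict_seqs n N" and y: "y \<in> strict_seqs n N"
      and p: "p permutes {0..<n}" and q: "q permutes {0..<n}"
      and eq: "restrict (x \<circ> p) {0..<n} = restrict (y \<circ> q) {0..<n}"
    have eqi: "x (p i) = y (q i)" if "i < n" for i using fun_cong[OF eq, of i] that by simp
    have "x ` {0..<n} = (\<lambda>i. x (p i)) ` {0..<n}" using permutes_image[OF p] by (metis image_image)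
    also have "\<dots> = (\<lambda>i. y (q i)) ` {0..<n}" using eqi by (intro image_cong) auto
    also have "\<dots> = y ` {0..<n}" using permutes_image[OF q] by (metis image_image)
    finally have "x i = y i" if "i < n" for i
      using strict_mono_on_image_unique[of n x y i] x y that by (auto simp: strict_seqs_def)
    moreover have "x i = y i" if "\<not> i < n" for i
    proof -
      have "x \<in> {0..<n} \<rightarrow>\<^sub>E {0..<N}" "y \<in> {0..<n} \<rightarrow>\<^sub>E {0..<N}" "i \<notin> {0..<n}"
        using x y that by (simp_all add: strict_seqs_def)
      then show ?thesis by (metis PiE_arb)
    qed
    ultimately have xy: "x = y" by blast
    have "p i = q i" for i
    proof (cases "i < n")
      case True
      then have "p i < n" "q i < n" using p q permutes_in_image[of p] permutes_in_image[of q] by auto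
      moreover have "x (p i) = x (q i)" using eqi[OF True] by (simp only: xy)
      ultimately show ?thesis using inj_onD[OF inj[OF x]] by simp
    next
      case False
      then show ?thesis using p q by (simp add: permutes_def)
    qed
    then show "x = y \<and> p = q" using xy by blast
  qed
  show "?g ` (strict_seqs n N \<times> {p. p permutes {0..<n}}) = {f \<in> {0..<n} \<rightarrow>\<^sub>E {0..<N}. inj_on f {0..<n}}"
  proof (intro subset_antisym subsetI)
    fix f assume "f \<in> ?g ` (strict_seqs n N \<times> {p. p permutes {0..<n}})"
    then obtain x p where x: "x \<in> strict_seqs n N" and p: "p permutes {0..<n}" and f: "f = restrict (x \<circ> p) {0..<n}"
      by auto
    have pn: "p i < n" if "i < n" for i using p permutes_in_image[of p _ i] that by fastforce
    have "inj_on (x \<circ> p) {0..<n}"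
      using inj[OF x] permutes_inj_on[OF p] permutes_image[OF p] by (intro comp_inj_on) auto
    then show "f \<in> {f \<in> {0..<n} \<rightarrow>\<^sub>E {0..<N}. inj_on f {0..<n}}"
      using x pn unfolding f by (auto simp: strict_seqs_def inj_on_restrict_eq)
  next
    fix f assume "f \<in> {f \<in> {0..<n} \<rightarrow>\<^sub>E {0..<N}. inj_on f {0..<n}}"
    then have f: "f \<in> {0..<n} \<rightarrow>\<^sub>E {0..<N}" "inj_on f {0..<n}" by auto
    define l where "l = sorted_list_of_set (f ` {0..<n})"
    have len: "length l = n" using card_image[OF f(2)] by (simp add: l_def)
    define x where "x = restrict (\<lambda>i. l ! i) {0..<n}"
    have set: "set l = f ` {0..<n}" by (simp add: l_def)
    have x: "x \<in> strict_seqs n N"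
    proof -
      have "strict_mono_on {0..<n} x"
        using strict_sorted_list_of_set[of "f ` {0..<n}"] len
        by (auto simp: strict_mono_on_def x_def sorted_wrt_iff_nth_less l_def)
      moreover have "l ! i < N" if "i < n" for i
        using f(1) set len nth_mem[of i l] that by auto
      ultimately show ?thesis by (auto simp: strict_seqs_def x_def)
    qed
    have ximg: "x ` {0..<n} = f ` {0..<n}"
    proof -
      have "set l = (\<lambda>i. l ! i) ` {0..<n}" using len by (auto simp: set_conv_nth)
      then show ?thesis using set by (simp add: x_def)
    qed
    define p where "p i = (if i < n then inv_into {0..<n} x (f i) else i)" for i
    have xp: "x (p i) = f i" "p i < n" if "i < n" for i
    proof -
      have "f i \<in> x ` {0..<n}" using that by (simp add: ximg)
      then show "x (p i) = f i" "p i < n"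
        using that inv_into_into[of "f i" x "{0..<n}"] by (auto simp: p_def f_inv_into_f)
    qed
    have "inj_on p {0..<n}"
    proof (rule inj_onI)
      fix i j assume "i \<in> {0..<n}" "j \<in> {0..<n}" "p i = p j"
      then have "f i = f j" using xp(1)[of i] xp(1)[of j] by simp
      then show "i = j" using f(2) \<open>i \<in> {0..<n}\<close> \<open>j \<in> {0..<n}\<close> by (auto dest: inj_onD)
    qed
    moreover have "p ` {0..<n} \<subseteq> {0..<n}" using xp(2) by auto
    ultimately have "bij_betw p {0..<n} {0..<n}"
      by (simp add: bij_betw_def endo_inj_surj)
    then have p: "p permutes {0..<n}" by (rule bij_imp_permutes) (simp add: p_def)
    have "f = restrict (x \<circ> p) {0..<n}"
    proof
      fix i show "f i = restrict (x \<circ> p) {0..<n} i"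
        using xp(1)[of i] PiE_arb[OF f(1), of i] by (cases "i < n") auto
    qed
    then show "f \<in> ?g ` (strict_seqs n N \<times> {p. p permutes {0..<n}})" using x p by force
  qed
qed

text \<open>Expand every row over all functions \<open>f\<close>. A repeated value of
  \<open>f\<close> gives two equal rows and contributes 0; injective functions are grouped by their
  image. The first factor is transposed so that both determinants take the form of
  \<open>schur_det\<close> and \<open>alternant\<close>.\<close>

lemma cauchy_binet:
  fixes A B :: "nat \<Rightarrow> nat \<Rightarrow> 'a::comm_ring_1"
  shows "detf n (\<lambda>i j. \<Sum>y=0..<N. A i y * B y j)
    = (\<Sum>x\<in>strict_seqs n N. detf n (\<lambda>i j. A j (x i)) * detf n (\<lambda>i j. B (x i) j))"
proof -
  let ?F = "{0..<n} \<rightarrow>\<^sub>E {0..<N}" and ?P = "{p. p permutes {0..<n}}"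
  have fF: "finite ?F" by (intro finite_PiE) auto
  have "detf n (\<lambda>i j. \<Sum>y=0..<N. A i y * B y j)
      = (\<Sum>p\<in>?P. signof p * (\<Sum>f\<in>?F. \<Prod>i=0..<n. A i (f i) * B (f i) (p i)))"
    unfolding detf_leibniz by (subst prod_sum_PiE) auto
  also have "\<dots> = (\<Sum>p\<in>?P. \<Sum>f\<in>?F. (\<Prod>i=0..<n. A i (f i)) * (signof p * (\<Prod>i=0..<n. B (f i) (p i))))"
    by (simp add: sum_distrib_left prod.distrib mult_ac)
  also have "\<dots> = (\<Sum>f\<in>?F. (\<Prod>i=0..<n. A i (f i)) * detf n (\<lambda>i j. B (f i) j))"
    unfolding detf_leibniz sum_distrib_left by (rule sum.swap)
  also have "\<dots> = (\<Sum>f | f \<in> ?F \<and> inj_on f {0..<n}. (\<Prod>i=0..<n. A i (f i)) * detf n (\<lambda>i j. B (f i) j))"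
  proof (rule sum.mono_neutral_right[OF fF])
    show "\<forall>f\<in>?F - {f \<in> ?F. inj_on f {0..<n}}. (\<Prod>i=0..<n. A i (f i)) * detf n (\<lambda>i j. B (f i) j) = 0"
    proof
      fix f assume "f \<in> ?F - {f \<in> ?F. inj_on f {0..<n}}"
      then obtain i k where "i < n" "k < n" "i \<noteq> k" "f i = f k" by (auto simp: inj_on_def)
      then have "detf n (\<lambda>i j. B (f i) j) = 0" by (intro detf_identical_rows[of i n k]) auto
      then show "(\<Prod>i=0..<n. A i (f i)) * detf n (\<lambda>i j. B (f i) j) = 0" by simp
    qed
  qed auto
  also have "\<dots> = (\<Sum>(x, p)\<in>strict_seqs n N \<times> ?P. (\<Prod>i=0..<n. A i (x (p i))) * detf n (\<lambda>i j. B (x (p i)) j))"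
    unfolding sum.reindex_bij_betw[OF bij_betw_strict_permutation, symmetric]
    by (intro sum.cong refl, clarify, intro arg_cong2[where f = "(*)"] prod.cong detf_cong) auto
  also have "\<dots> = (\<Sum>x\<in>strict_seqs n N. \<Sum>p\<in>?P. (\<Prod>i=0..<n. A i (x (p i))) * detf n (\<lambda>i j. B (x (p i)) j))"
    by (simp add: sum.cartesian_product)
  also have "\<dots> = (\<Sum>x\<in>strict_seqs n N. (\<Sum>p\<in>?P. signof p * (\<Prod>i=0..<n. A i (x (p i)))) * detf n (\<lambda>i j. B (x i) j))"
    by (auto simp: detf_permute_rows[where f = "\<lambda>i j. B (x i) j" for x] sum_distrib_left mult_ac intro!: sum.cong)
  also have "\<dots> = (\<Sum>x\<in>strict_seqs n N. detf n (\<lambda>i j. A i (x j)) * detf n (\<lambda>i j. B (x i) j))"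
    by (simp add: detf_leibniz)
  also have "\<dots> = (\<Sum>x\<in>strict_seqs n N. detf n (\<lambda>i j. A j (x i)) * detf n (\<lambda>i j. B (x i) j))"
    by (simp add: detf_transpose[of n "\<lambda>i j. A i (x j)" for x, symmetric])
  finally show ?thesis .
qed

section \<open>Alternants and Jacobi--Trudi determinants\<close>

definition alternant :: "nat \<Rightarrow> (nat \<Rightarrow> 'a) \<Rightarrow> (nat \<Rightarrow> nat) \<Rightarrow> 'a::comm_ring_1" where
  "alternant n w x = detf n (\<lambda>i j. w j ^ x i)"

text \<open>The Jacobi--Trudi determinant with rows and columns in reverse order, indexed by a
  sequence of positions instead of a partition; \<open>shape\<close> translates between the
  two.\<close>

definition schur_det :: "(int \<Rightarrow> 'a) \<Rightarrow> nat \<Rightarrow> (nat \<Rightarrow> nat) \<Rightarrow> 'a::comm_ring_1" where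
  "schur_det h n x = detf n (\<lambda>i j. h (int (x i) - int j))"

text \<open>A finite form of the Cauchy identity: \<open>\<Prod>\<^sub>j \<Sum>\<^sub>m h\<^sub>m w\<^sub>j\<^sup>m\<close> is multiplied by the Vandermonde
  determinant and expanded by Cauchy--Binet.\<close>

lemma alternant_mult_prod:
  fixes h :: "int \<Rightarrow> 'a::comm_ring_1"
  assumes h: "\<And>k. k < 0 \<or> int K < k \<Longrightarrow> h k = 0"
  shows "alternant n w (\<lambda>i. i) * (\<Prod>j<n. \<Sum>m\<le>K. h (int m) * w j ^ m)
    = (\<Sum>x\<in>strict_seqs n (K + n). schur_det h n x * alternant n w x)"
proof -
  \<comment> \<open>Multiplication by \<open>w j ^ i\<close> shifts the index of \<open>h\<close> by
    \<open>i\<close>. The range \<open>K + n\<close> accommodates all shifts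
    \<open>i < n\<close>.\<close>
  have eq: "w j ^ i * (\<Sum>m\<le>K. h (int m) * w j ^ m) = (\<Sum>y=0..<K + n. h (int y - int i) * w j ^ y)"
    if "i < n" for i j
  proof -
    have "w j ^ i * (\<Sum>m\<le>K. h (int m) * w j ^ m) = (\<Sum>m\<in>{0..K}. h (int (m + i) - int i) * w j ^ (m + i))"
      by (simp add: sum_distrib_left power_add mult_ac atMost_atLeast0)
    also have "\<dots> = (\<Sum>y\<in>{0 + i..K + i}. h (int y - int i) * w j ^ y)"
      by (rule sum.shift_bounds_cl_nat_ivl[symmetric])
    also have "\<dots> = (\<Sum>y=0..<K + n. h (int y - int i) * w j ^ y)"
      using that by (intro sum.mono_neutral_left) (auto simp: h)
    finally show ?thesis .
  qed
  have "alternant n w (\<lambda>i. i) * (\<Prod>j<n. \<Sum>m\<le>K. h (int m) * w j ^ m)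
      = detf n (\<lambda>i j. \<Sum>y=0..<K + n. h (int y - int i) * w j ^ y)"
    unfolding alternant_def detf_scale_cols[symmetric] by (rule detf_cong) (rule eq)
  also have "\<dots> = (\<Sum>x\<in>strict_seqs n (K + n). schur_det h n x * alternant n w x)"
    by (simp add: cauchy_binet alternant_def schur_det_def)
  finally show ?thesis .
qed

text \<open>Multiplying the product of all geometric series by the factors \<open>1 - w i z\<close>
  with \<open>i \<noteq> j\<close> leaves the series of \<open>w j\<close>. So every power of
  \<open>w j\<close> is a combination of complete homogeneous polynomials with coefficients
  \<open>C l j\<close>, \<open>l < n\<close>, and the alternant factors through
  \<open>detf n C\<close>.\<close>

lemma jacobi_trudi:
  fixes w :: "nat \<Rightarrow> complex"
  shows "alternant n w x = schur_det (complete_hom n w) n x * alternant n w (\<lambda>i. i)"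
proof -
  define G where "G i = Abs_fps (\<lambda>m. w i ^ m)" for i
  define L where "L i = 1 - fps_const (w i) * fps_X" for i
  define C where "C l j = fps_nth (\<Prod>i\<in>{..<n} - {j}. L i) l" for l j
  have GL: "G i * L i = 1" for i
  proof (rule fps_ext)
    fix k
    show "fps_nth (G i * L i) k = fps_nth 1 k"
    proof (cases k)
      case (Suc m)
      have "G i * L i = G i - fps_const (w i) * (G i * fps_X)"
        unfolding L_def right_diff_distrib by (simp only: mult_1_right mult.left_commute)
      then show ?thesis by (simp add: Suc G_def)
    qed (simp add: G_def L_def fps_mult_nth_0)
  qed
  have deg: "fps_nth (\<Prod>i\<in>S. L i) l = 0" if "finite S" "card S < l" for S l
    using that
  proof (induction S arbitrary: l rule: finite_induct)
    case (insert i S)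
    then obtain m where "l = Suc m" by (cases l) auto
    with insert show ?case
      by (simp add: L_def left_diff_distrib mult.assoc)
  qed simp
  have Cz: "C l j = 0" if "j < n" "n \<le> l" for l j
    unfolding C_def using that by (intro deg) auto
  have key: "w j ^ y = (\<Sum>l<n. complete_hom n w (int y - int l) * C l j)" if "j < n" for y j
  proof -
    have "(\<Prod>i<n. G i) * (\<Prod>i\<in>{..<n} - {j}. L i) = G j * ((\<Prod>i\<in>{..<n} - {j}. G i) * (\<Prod>i\<in>{..<n} - {j}. L i))"
      using that by (subst prod.remove[of _ j]) (auto simp: mult.assoc)
    also have "\<dots> = G j" by (simp add: prod.distrib[symmetric] GL)
    finally have "w j ^ y = fps_nth ((\<Prod>i\<in>{..<n} - {j}. L i) * (\<Prod>i<n. G i)) y"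
      by (simp add: G_def mult.commute)
    also have "\<dots> = (\<Sum>l=0..y. C l j * complete_hom n w (int (y - l)))"
      by (simp only: fps_mult_nth C_def complete_hom_nth G_def)
    also have "\<dots> = (\<Sum>l=0..y. complete_hom n w (int y - int l) * C l j)"
      by (intro sum.cong) (auto simp: of_nat_diff mult.commute)
    also have "\<dots> = (\<Sum>l\<in>{..<n + Suc y}. complete_hom n w (int y - int l) * C l j)"
      by (intro sum.mono_neutral_left) (auto simp: complete_hom_def)
    also have "\<dots> = (\<Sum>l<n. complete_hom n w (int y - int l) * C l j)"
      using that by (intro sum.mono_neutral_right) (auto simp: Cz)
    finally show ?thesis .
  qed
  have alt: "alternant n w x = schur_det (complete_hom n w) n x * detf n C" for x
    unfolding alternant_def schur_det_def detf_mult[symmetric] by (rule detf_cong) (rule key)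
  \<comment> \<open>At the sequence \<open>0, 1, ..., n - 1\<close> the matrix is unitriangular.
    This identifies \<open>detf n C\<close> with the Vandermonde determinant.\<close>
  have "schur_det (complete_hom n w) n (\<lambda>i. i) = 1"
    unfolding schur_det_def by (rule detf_unitriangular) (auto simp: complete_hom_def)
  with alt[of "\<lambda>i. i"] alt[of x] show ?thesis by simp
qed

text \<open>A kernel vector would be the coefficient list of a nonzero polynomial of degree below
  \<open>n\<close> with \<open>n\<close> distinct roots.\<close>

lemma alternant_nonzero:
  fixes w :: "nat \<Rightarrow> complex"
  assumes inj: "inj_on w {0..<n}"
  shows "alternant n w (\<lambda>i. i) \<noteq> 0"
proof
  assume "alternant n w (\<lambda>i. i) = 0"
  then have "detf n (\<lambda>i j. w i ^ j) = 0"
    unfolding alternant_def by (simp add: detf_transpose[of n "\<lambda>i j. w j ^ i", symmetric])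
  then obtain v where v: "v \<in> carrier_vec n" "v \<noteq> 0\<^sub>v n"
    "Matrix.mat n n (\<lambda>(i, j). w i ^ j) *\<^sub>v v = 0\<^sub>v n"
    unfolding detf_def by (subst (asm) det_0_iff_vec_prod_zero_field[of _ n]) auto
  define P where "P = (\<Sum>j<n. Polynomial.monom (vec_index v j) j)"
  have "poly P (w i) = 0" if "i < n" for i
  proof -
    have "vec_index (Matrix.mat n n (\<lambda>(i, j). w i ^ j) *\<^sub>v v) i = 0" using v(3) that by simp
    then show ?thesis
      using that v(1) by (simp add: P_def poly_sum poly_monom scalar_prod_def mult.commute lessThan_atLeast0)
  qed
  then have roots: "w ` {0..<n} \<subseteq> {z. poly P z = 0}" by auto
  have coeff: "Polynomial.coeff P j = vec_index v j" if "j < n" for j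
    using that by (simp add: P_def coeff_sum)
  have "\<exists>j<n. vec_index v j \<noteq> 0"
  proof (rule ccontr)
    assume "\<not> (\<exists>j<n. vec_index v j \<noteq> 0)"
    then have "v = 0\<^sub>v n" using v(1) by (intro eq_vecI) auto
    with v(2) show False by simp
  qed
  then obtain j where j: "j < n" "vec_index v j \<noteq> 0" by blast
  then have P: "P \<noteq> 0" using coeff by auto
  have "degree P \<le> n - 1"
    unfolding P_def by (intro degree_sum_le) (auto intro: order_trans[OF degree_monom_le])
  moreover have "n = card (w ` {0..<n})" using card_image[OF inj] by simp
  moreover have "card (w ` {0..<n}) \<le> card {z. poly P z = 0}"
    using roots poly_roots_finite[OF P] by (intro card_mono)
  moreover have "card {z. poly P z = 0} \<le> degree P" by (rule card_poly_roots_bound[OF P])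
  ultimately show False using j by linarith
qed

lemma elem_schur_recursion:
  "of_nat (Suc k) * elem_schur t (int (Suc k)) = (\<Sum>i=0..k. of_nat (Suc i) * t (Suc i) * elem_schur t (int (k - i)))"
proof -
  have "fps_nth (fps_deriv (schur_series t)) k = fps_nth (fps_deriv (exponent_series t) * schur_series t) k"
    by (simp only: schur_series_deriv)
  then show ?thesis
    by (simp add: fps_mult_nth schur_series_def exponent_series_def del: of_nat_Suc of_nat_diff)
qed

text \<open>By the recursion, \<open>elem_schur\<close> is a polynomial in finitely many
  \<open>t i\<close>. The abstract closure property \<open>P\<close> serves for continuity and for
  polynomial dependence on a matrix.\<close>

lemma elem_schur_closed:
  fixes t :: "'b \<Rightarrow> nat \<Rightarrow> complex" and P :: "('b \<Rightarrow> complex) \<Rightarrow> bool"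
  assumes const: "\<And>c. P (\<lambda>_. c)" and t: "\<And>i. P (\<lambda>x. t x i)"
    and sum: "\<And>(F :: nat \<Rightarrow> 'b \<Rightarrow> complex) A. finite A \<Longrightarrow> (\<And>i. i \<in> A \<Longrightarrow> P (F i)) \<Longrightarrow> P (\<lambda>x. \<Sum>i\<in>A. F i x)"
    and mult: "\<And>F G. P F \<Longrightarrow> P G \<Longrightarrow> P (\<lambda>x. F x * G x)"
  shows "P (\<lambda>x. elem_schur (t x) k)"
proof (cases "k < 0")
  case False
  have "P (\<lambda>x. elem_schur (t x) (int m))" for m
  proof (induction m rule: less_induct)
    case (less m)
    show ?case
    proof (cases m)
      case 0
      then show ?thesis by (simp add: const)
    next
      case (Suc l)
      have "elem_schur (t x) (int (Suc l))
          = (1 / of_nat (Suc l)) * (\<Sum>i=0..l. of_nat (Suc i) * t x (Suc i) * elem_schur (t x) (int (l - i)))" for x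
        unfolding elem_schur_recursion[symmetric] by (simp del: of_nat_Suc)
      moreover have "P (\<lambda>x. (1 / of_nat (Suc l)) * (\<Sum>i=0..l. of_nat (Suc i) * t x (Suc i) * elem_schur (t x) (int (l - i))))"
        by (intro mult const sum t less.IH) (use Suc in auto)
      ultimately show ?thesis unfolding Suc by presburger
    qed
  qed
  from this[of "nat k"] False show ?thesis by simp
qed (simp add: const)

section \<open>Continuity and the passage from distinct to arbitrary arguments\<close>

lemma continuous_on_elem_schur:
  fixes t :: "'b::topological_space \<Rightarrow> nat \<Rightarrow> complex"
  assumes "\<And>i. continuous_on S (\<lambda>x. t x i)"
  shows "continuous_on S (\<lambda>x. elem_schur (t x) k)"
  by (rule elem_schur_closed[where P = "continuous_on S"]) (intro continuous_intros assms; assumption)+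

lemma continuous_on_schur_det:
  fixes h :: "'b::topological_space \<Rightarrow> int \<Rightarrow> complex"
  assumes "\<And>k. continuous_on S (\<lambda>x. h x k)"
  shows "continuous_on S (\<lambda>x. schur_det (h x) n y)"
  unfolding schur_det_def detf_leibniz by (intro continuous_intros assms)

text \<open>Cancelling a Vandermonde determinant requires distinct arguments. Moving
  \<open>w i\<close> by \<open>of_nat i * \<epsilon>\<close> makes the first \<open>n\<close> of
  them distinct for all small nonzero \<open>\<epsilon>\<close>, and continuity gives the value at
  0.\<close>

lemma eq_of_eq_on_distinct:
  fixes f g :: "(nat \<Rightarrow> complex) \<Rightarrow> complex"
  assumes eq: "\<And>w. inj_on w {0..<n} \<Longrightarrow> f w = g w"
    and f: "continuous_on UNIV (\<lambda>\<epsilon>. f (\<lambda>i. w i + of_nat i * \<epsilon>))"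
    and g: "continuous_on UNIV (\<lambda>\<epsilon>. g (\<lambda>i. w i + of_nat i * \<epsilon>))"
  shows "f w = g w"
proof -
  define v where "v \<epsilon> i = w i + of_nat i * \<epsilon>" for \<epsilon> i
  have "\<forall>\<^sub>F \<epsilon> in at 0. v \<epsilon> i \<noteq> v \<epsilon> j" if "i \<noteq> j" for i j
  \<comment> \<open>Equal values are separated by a nonzero multiple of \<open>\<epsilon>\<close>;
    different values stay different near 0.\<close>
  proof (cases "w i = w j")
    case True
    have "\<forall>\<^sub>F \<epsilon> in at (0::complex). \<epsilon> \<noteq> 0" by (simp add: eventually_at_filter)
    then show ?thesis by eventually_elim (use that True in \<open>simp add: v_def\<close>)
  next
    case False
    have "((\<lambda>\<epsilon>. v \<epsilon> i - v \<epsilon> j) \<longlongrightarrow> v 0 i - v 0 j) (at 0)"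
      unfolding v_def by (intro tendsto_intros)
    then have "\<forall>\<^sub>F \<epsilon> in at 0. v \<epsilon> i - v \<epsilon> j \<noteq> 0"
      by (rule tendsto_imp_eventually_ne) (use False in \<open>simp add: v_def\<close>)
    then show ?thesis by eventually_elim auto
  qed
  then have "\<forall>\<^sub>F \<epsilon> in at 0. \<forall>ij\<in>{0..<n} \<times> {0..<n}. fst ij \<noteq> snd ij \<longrightarrow> v \<epsilon> (fst ij) \<noteq> v \<epsilon> (snd ij)"
    by (intro eventually_ball_finite) (auto intro: eventually_mono)
  then have ev: "\<forall>\<^sub>F \<epsilon> in at 0. f (v \<epsilon>) = g (v \<epsilon>)"
    by eventually_elim (intro eq, auto simp: inj_on_def)
  have "isCont (\<lambda>\<epsilon>. f (v \<epsilon>)) 0" "isCont (\<lambda>\<epsilon>. g (v \<epsilon>)) 0"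
    using f g unfolding v_def by (simp_all add: continuous_on_eq_continuous_at)
  then have "((\<lambda>\<epsilon>. f (v \<epsilon>)) \<longlongrightarrow> f (v 0)) (at 0)" "((\<lambda>\<epsilon>. g (v \<epsilon>)) \<longlongrightarrow> g (v 0)) (at 0)"
    unfolding isCont_def .
  then have "f (v 0) = g (v 0)"
    using tendsto_unique[of "at (0::complex)"] Lim_transform_eventually[OF _ ev] by (metis at_neq_bot)
  moreover have "v 0 = w" by (simp add: v_def fun_eq_iff)
  ultimately show ?thesis by simp
qed

lemma continuous_on_schur_det_complete_hom:
  assumes "\<And>i. continuous_on S (\<lambda>x. w x i)"
  shows "continuous_on S (\<lambda>x. schur_det (complete_hom n (w x)) n y)"
  unfolding complete_hom_def power_sum_def divide_inverse
  by (intro continuous_on_schur_det continuous_on_elem_schur continuous_intros assms)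

section \<open>The Pieri rule\<close>

definition add_ind :: "(nat \<Rightarrow> nat) \<Rightarrow> nat set \<Rightarrow> nat \<Rightarrow> nat" where
  "add_ind x E = (\<lambda>i. x i + of_bool (i \<in> E))"

text \<open>The factors scale the columns, so row \<open>i\<close> becomes the sum of its old
  version and \<open>z\<close> times the version with exponent raised by 1. Expanding the rows
  selects a set \<open>E\<close> of raised exponents, that is, of walkers that move.\<close>

lemma alternant_pieri:
  fixes w :: "nat \<Rightarrow> 'a::comm_ring_1"
  assumes x: "strict_mono_on {0..<n} x"
  shows "alternant n w x * (\<Prod>j<n. 1 + z * w j)
    = (\<Sum>E | E \<subseteq> {0..<n} \<and> strict_mono_on {0..<n} (add_ind x E). z ^ card E * alternant n w (add_ind x E))"
proof -
  have "alternant n w x * (\<Prod>j<n. 1 + z * w j) = detf n (\<lambda>i j. z * w j ^ Suc (x i) + w j ^ x i)"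
    unfolding alternant_def detf_scale_cols[symmetric] by (rule detf_cong) (simp add: algebra_simps)
  also have "\<dots> = (\<Sum>p | p permutes {0..<n}. signof p *
      (\<Sum>E\<in>Pow {0..<n}. z ^ card E * (\<Prod>i=0..<n. w (p i) ^ add_ind x E i)))"
  proof -
    have "(\<Prod>i=0..<n. z * w (p i) ^ Suc (x i) + w (p i) ^ x i)
        = (\<Sum>E\<in>Pow {0..<n}. z ^ card E * (\<Prod>i=0..<n. w (p i) ^ add_ind x E i))" for p
    proof (subst prod_add)
      have "(\<Prod>i\<in>E. z * w (p i) ^ Suc (x i)) * (\<Prod>i\<in>{0..<n} - E. w (p i) ^ x i)
          = z ^ card E * (\<Prod>i=0..<n. w (p i) ^ add_ind x E i)" if "E \<in> Pow {0..<n}" for E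
      proof -
        have "(\<Prod>i=0..<n. w (p i) ^ add_ind x E i)
            = (\<Prod>i\<in>{0..<n} - E. w (p i) ^ add_ind x E i) * (\<Prod>i\<in>E. w (p i) ^ add_ind x E i)"
          using that by (intro prod.subset_diff) auto
        also have "\<dots> = (\<Prod>i\<in>{0..<n} - E. w (p i) ^ x i) * (\<Prod>i\<in>E. w (p i) ^ Suc (x i))"
          by (intro arg_cong2[where f = "(*)"] prod.cong) (auto simp: add_ind_def)
        finally show ?thesis by (simp add: prod.distrib mult_ac del: power_Suc)
      qed
      then show "(\<Sum>E\<in>Pow {0..<n}. (\<Prod>i\<in>E. z * w (p i) ^ Suc (x i)) * (\<Prod>i\<in>{0..<n} - E. w (p i) ^ x i))
          = (\<Sum>E\<in>Pow {0..<n}. z ^ card E * (\<Prod>i=0..<n. w (p i) ^ add_ind x E i))"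
        by (rule sum.cong[OF refl])
    qed simp
    then show ?thesis by (simp only: detf_leibniz)
  qed
  also have "\<dots> = (\<Sum>E\<in>Pow {0..<n}. z ^ card E * alternant n w (add_ind x E))"
    unfolding alternant_def detf_leibniz sum_distrib_left
    by (subst sum.swap) (simp add: mult_ac)
  also have "\<dots> = (\<Sum>E | E \<subseteq> {0..<n} \<and> strict_mono_on {0..<n} (add_ind x E). z ^ card E * alternant n w (add_ind x E))"
  proof (rule sum.mono_neutral_right)
    show "\<forall>E\<in>Pow {0..<n} - {E. E \<subseteq> {0..<n} \<and> strict_mono_on {0..<n} (add_ind x E)}.
        z ^ card E * alternant n w (add_ind x E) = 0"
    proof
      fix E assume "E \<in> Pow {0..<n} - {E. E \<subseteq> {0..<n} \<and> strict_mono_on {0..<n} (add_ind x E)}"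
      then obtain i k where ik: "i < k" "k < n" "\<not> add_ind x E i < add_ind x E k"
        by (auto simp: strict_mono_on_def)
      moreover have "x i < x k" using x ik by (auto simp: strict_mono_on_def)
      \<comment> \<open>A gap of at least 1 shrinks by at most 1, so strictness fails only through a
        collision, which produces equal rows. This is how non-intersection enters.\<close>
      ultimately have "add_ind x E i = add_ind x E k"
        by (cases "i \<in> E"; cases "k \<in> E") (auto simp: add_ind_def)
      then have "alternant n w (add_ind x E) = 0"
        unfolding alternant_def using ik by (intro detf_identical_rows[of i n k]) auto
      then show "z ^ card E * alternant n w (add_ind x E) = 0" by simp
    qed
  qed auto
  finally show ?thesis .
qed

lemma schur_det_pieri:
  fixes w :: "nat \<Rightarrow> complex"
  assumes x: "strict_mono_on {0..<n} x"
  shows "schur_det (complete_hom n w) n x * (\<Prod>j<n. 1 + z * w j)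
    = (\<Sum>E | E \<subseteq> {0..<n} \<and> strict_mono_on {0..<n} (add_ind x E).
        z ^ card E * schur_det (complete_hom n w) n (add_ind x E))"
proof (rule eq_of_eq_on_distinct[where n = n
      and f = "\<lambda>w. schur_det (complete_hom n w) n x * (\<Prod>j<n. 1 + z * w j)"
      and g = "\<lambda>w. \<Sum>E | E \<subseteq> {0..<n} \<and> strict_mono_on {0..<n} (add_ind x E).
        z ^ card E * schur_det (complete_hom n w) n (add_ind x E)"])
  fix w :: "nat \<Rightarrow> complex"
  assume "inj_on w {0..<n}"
  then have nz: "alternant n w (\<lambda>i. i) \<noteq> 0" by (rule alternant_nonzero)
  have "schur_det (complete_hom n w) n x * (\<Prod>j<n. 1 + z * w j) * alternant n w (\<lambda>i. i)
      = alternant n w x * (\<Prod>j<n. 1 + z * w j)"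
    by (simp add: jacobi_trudi[of n w x])
  also have "\<dots> = (\<Sum>E | E \<subseteq> {0..<n} \<and> strict_mono_on {0..<n} (add_ind x E).
      z ^ card E * schur_det (complete_hom n w) n (add_ind x E)) * alternant n w (\<lambda>i. i)"
    unfolding alternant_pieri[OF x] by (simp add: jacobi_trudi[of n w "add_ind x _"] sum_distrib_right mult.assoc)
  finally show "schur_det (complete_hom n w) n x * (\<Prod>j<n. 1 + z * w j)
    = (\<Sum>E | E \<subseteq> {0..<n} \<and> strict_mono_on {0..<n} (add_ind x E).
        z ^ card E * schur_det (complete_hom n w) n (add_ind x E))"
    using nz by simp
qed (intro continuous_intros continuous_on_schur_det_complete_hom)+

section \<open>Class functions of a matrix as functions of its eigenvalues\<close>

lemma matpow_conj:
  assumes "Q ** P = mat 1" "P ** Q = mat 1"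
  shows "matpow (P ** M ** Q) k = P ** matpow M k ** Q"
proof (induction k)
  case (Suc k)
  have "matpow (P ** M ** Q) (Suc k) = P ** M ** (Q ** P) ** matpow M k ** Q"
    by (simp add: Suc matrix_mul_assoc)
  then show ?case by (simp add: assms matrix_mul_assoc)
qed (simp add: assms)

lemma trace_conj:
  fixes P Q M :: "complex^'n^'n"
  assumes "Q ** P = mat 1"
  shows "trace (P ** M ** Q) = trace M"
proof -
  have "trace (P ** M ** Q) = trace (Q ** (P ** M))" by (rule trace_mul_sym)
  then show ?thesis by (simp add: matrix_mul_assoc assms)
qed

lemma trace_matpow_class: "class_fun (\<lambda>M :: complex^'n^'n. trace (matpow M k))"
  by (simp add: class_fun_def matpow_conj trace_conj)

lemma trace_matpow_diag: "trace (matpow (diag_of d :: complex^'n^'n) k) = (\<Sum>i\<in>UNIV. d i ^ k)"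
proof -
  have "matpow (diag_of d :: complex^'n^'n) k = diag_of (\<lambda>i. d i ^ k)"
  proof (induction k)
    case 0
    show ?case by (simp add: diag_of_def mat_def)
  next
    case (Suc k)
    then show ?case by (simp add: vec_eq_iff diag_of_mult_left) (simp add: diag_of_def)
  qed
  then show ?thesis by (simp add: trace_def diag_of_def)
qed

section \<open>Polynomial dependence on the matrix entries\<close>

definition polynomial_mat :: "(complex^'n^'n \<Rightarrow> complex) \<Rightarrow> bool" where
  "polynomial_mat F \<longleftrightarrow> (\<exists>d. poly_mat d F)"

lemma polynomial_mat_const: "polynomial_mat (\<lambda>_. c)"
  unfolding polynomial_mat_def poly_mat_def by (intro exI[of _ 0]) simp

lemma polynomial_mat_mult: "polynomial_mat F \<Longrightarrow> polynomial_mat G \<Longrightarrow> polynomial_mat (\<lambda>M. F M * G M)"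
  unfolding polynomial_mat_def poly_mat_def by (elim exE) (rule exI, rule poly_fun_mult)

lemma polynomial_mat_add: "polynomial_mat F \<Longrightarrow> polynomial_mat G \<Longrightarrow> polynomial_mat (\<lambda>M. F M + G M)"
  unfolding polynomial_mat_def poly_mat_def
  by (metis poly_fun.add poly_fun_mono max.cobounded1 max.cobounded2)

lemma polynomial_mat_sum:
  "(\<And>i. i \<in> I \<Longrightarrow> polynomial_mat (F i)) \<Longrightarrow> polynomial_mat (\<lambda>M. \<Sum>i\<in>I. F i M)"
  by (induction I rule: infinite_finite_induct) (auto intro: polynomial_mat_const polynomial_mat_add)

lemma polynomial_mat_prod:
  "(\<And>i. i \<in> I \<Longrightarrow> polynomial_mat (F i)) \<Longrightarrow> polynomial_mat (\<lambda>M. \<Prod>i\<in>I. F i M)"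
  by (induction I rule: infinite_finite_induct) (auto intro: polynomial_mat_const polynomial_mat_mult)

lemma polynomial_mat_entry: "polynomial_mat (\<lambda>M. M $ i $ j)"
  unfolding polynomial_mat_def poly_mat_def by (intro exI[of _ 1]) (simp add: poly_fun_var)

lemma polynomial_mat_trace_matpow: "polynomial_mat (\<lambda>M. trace (matpow M k))"
proof -
  have "polynomial_mat (\<lambda>M. matpow M k $ i $ j)" for i j
  proof (induction k arbitrary: i j)
    case 0
    show ?case by (simp add: polynomial_mat_const)
  next
    case (Suc k)
    show ?case
      by (simp only: matpow.simps matrix_mult_nth)
        (intro polynomial_mat_sum polynomial_mat_mult polynomial_mat_entry Suc.IH)
  qed
  then show ?thesis unfolding trace_def by (intro polynomial_mat_sum)
qed

lemma polynomial_mat_continuous: "polynomial_mat F \<Longrightarrow> continuous_on S F"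
  unfolding polynomial_mat_def using poly_mat_continuous by blast

text \<open>The complete homogeneous polynomials of the eigenvalues, written in traces so that they
  are polynomial in the entries, as \<open>haar_reproducing\<close> demands.\<close>

definition trace_schur :: "complex^'n^'n \<Rightarrow> int \<Rightarrow> complex" where
  "trace_schur M = elem_schur (\<lambda>i. trace (matpow M i) / of_nat i)"

lemma polynomial_mat_trace_schur: "polynomial_mat (\<lambda>M. trace_schur M k)"
  unfolding trace_schur_def divide_inverse
  by (rule elem_schur_closed[where P = polynomial_mat])
    (intro polynomial_mat_const polynomial_mat_mult polynomial_mat_sum polynomial_mat_trace_matpow; assumption)+

lemma polynomial_mat_schur_det: "polynomial_mat (\<lambda>M. schur_det (trace_schur M) n x)"
  unfolding schur_det_def detf_leibniz
  by (intro polynomial_mat_sum polynomial_mat_mult polynomial_mat_const polynomial_mat_prod polynomial_mat_trace_schur)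

lemma trace_schur_conj:
  fixes P Q M :: "complex^'n^'n"
  assumes "P ** Q = mat 1" "Q ** P = mat 1"
  shows "trace_schur (P ** M ** Q) = trace_schur M"
  unfolding trace_schur_def using assms by (simp add: matpow_conj trace_conj)

lemma mat_conj_mult: "mat_conj (A ** B) = mat_conj A ** mat_conj B"
  by (simp add: mat_conj_def vec_eq_iff matrix_mult_nth)

lemma mat_conj_one: "mat_conj (mat 1) = mat 1"
  by (simp add: mat_conj_def vec_eq_iff mat_def)

lemma class_fun_mat_conj:
  assumes "class_fun f"
  shows "class_fun (\<lambda>M. f (mat_conj M))"
  unfolding class_fun_def
proof (intro allI impI)
  fix P Q M :: "complex^'a^'a"
  assume "P ** Q = mat 1" "Q ** P = mat 1"
  then have "mat_conj P ** mat_conj Q = mat 1"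
    by (metis mat_conj_mult mat_conj_one)
  then show "f (mat_conj (P ** M ** Q)) = f (mat_conj M)"
    using assms by (simp add: mat_conj_mult class_funD)
qed

lemma class_fun_adjoint:
  assumes "class_fun f"
  shows "class_fun (\<lambda>M. f (adjoint_mat M))"
  unfolding class_fun_def
proof (intro allI impI)
  fix P Q M :: "complex^'a^'a"
  assume "P ** Q = mat 1" "Q ** P = mat 1"
  moreover have "adjoint_mat (mat 1) = (mat 1 :: complex^'a^'a)"
    by (simp add: vec_eq_iff mat_def transpose_def)
  ultimately have "adjoint_mat Q ** adjoint_mat P = mat 1"
    by (metis adjoint_mat_mult)
  then show "f (adjoint_mat (P ** M ** Q)) = f (adjoint_mat M)"
    using assms by (simp add: adjoint_mat_mult class_funD matrix_mul_assoc[symmetric])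
      (simp add: class_funD matrix_mul_assoc)
qed

lemma continuous_on_mat_conj: "continuous_on S (mat_conj :: complex^'n^'n \<Rightarrow> complex^'n^'n)"
  unfolding mat_conj_def[abs_def] map_matrix_def by (intro continuous_intros)

definition det_one_plus :: "complex \<Rightarrow> complex^'n^'n \<Rightarrow> complex" where
  "det_one_plus z M = Determinants.det (mat 1 + map_matrix (\<lambda>c. z * c) M)"

lemma det_one_plus_class: "class_fun (det_one_plus z)"
  unfolding class_fun_def
proof (intro allI impI)
  fix P Q M :: "complex^'a^'a"
  assume PQ: "P ** Q = mat 1" "Q ** P = mat 1"
  have "mat 1 + map_matrix (\<lambda>c. z * c) (P ** M ** Q)
      = P ** (mat 1 + map_matrix (\<lambda>c. z * c) M) ** Q"
  proof -
    have "map_matrix (\<lambda>c. z * c) (A ** B) = A ** map_matrix (\<lambda>c. z * c) B"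
      "map_matrix (\<lambda>c. z * c) (A ** B) = map_matrix (\<lambda>c. z * c) A ** B" for A B :: "complex^'a^'a"
      by (simp_all add: vec_eq_iff matrix_mult_nth sum_distrib_left mult_ac)
    then have "map_matrix (\<lambda>c. z * c) (P ** M ** Q) = P ** map_matrix (\<lambda>c. z * c) M ** Q"
      by metis
    moreover have "(A + B) ** C = A ** C + B ** C" for A B C :: "complex^'a^'a"
      by (simp add: vec_eq_iff matrix_mult_nth distrib_right sum.distrib)
    ultimately show ?thesis
      by (simp add: matrix_add_ldistrib PQ)
  qed
  moreover have "Determinants.det P * Determinants.det Q = 1"
    using arg_cong[OF PQ(1), of Determinants.det] by (simp add: det_mul)
  ultimately show "det_one_plus z (P ** M ** Q) = det_one_plus z M"
    by (simp add: det_one_plus_def det_mul mult.commute mult.left_commute mult.assoc[symmetric])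
qed

lemma det_one_plus_continuous: "continuous_on S (det_one_plus z)"
  unfolding det_one_plus_def[abs_def] Determinants.det_def map_matrix_def
  by (simp, intro continuous_intros)

lemma det_one_plus_diag: "det_one_plus z (diag_of d :: complex^'n^'n) = (\<Prod>i\<in>UNIV. 1 + z * d i)"
proof -
  have "mat 1 + map_matrix (\<lambda>c. z * c) (diag_of d) = diag_of (\<lambda>i. 1 + z * d i)"
    by (simp add: vec_eq_iff diag_of_def mat_def)
  then show ?thesis
    unfolding det_one_plus_def by (simp add: det_diagonal diag_of_def)
qed

section \<open>Evaluation on sequences of eigenvalues\<close>

definition index_of :: "'n::finite \<Rightarrow> nat" where
  "index_of = (SOME e. bij_betw e UNIV {..<CARD('n)})"

lemma bij_index_of: "bij_betw (index_of :: 'n::finite \<Rightarrow> nat) UNIV {..<CARD('n)}"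
proof -
  have "\<exists>e :: 'n \<Rightarrow> nat. bij_betw e UNIV {..<CARD('n)}"
    using ex_bij_betw_finite_nat[of "UNIV :: 'n set"] by (auto simp: lessThan_atLeast0)
  then show ?thesis unfolding index_of_def by (rule someI_ex)
qed

abbreviation diag_seq :: "(nat \<Rightarrow> complex) \<Rightarrow> complex^'n^'n" where
  "diag_seq w \<equiv> diag_of (\<lambda>i. w (index_of i))"

lemma trace_matpow_diag_seq: "trace (matpow (diag_seq w :: complex^'n^'n) k) = power_sum CARD('n) w k"
  unfolding trace_matpow_diag power_sum_def by (rule sum.reindex_bij_betw[OF bij_index_of])

lemma det_one_plus_diag_seq: "det_one_plus z (diag_seq w :: complex^'n^'n) = (\<Prod>j<CARD('n). 1 + z * w j)"
  unfolding det_one_plus_diag by (rule prod.reindex_bij_betw[OF bij_index_of])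

lemma trace_schur_diag_seq: "trace_schur (diag_seq w :: complex^'n^'n) = complete_hom CARD('n) w"
  by (simp add: trace_schur_def trace_matpow_diag_seq complete_hom_def)

lemma mat_conj_diag_seq: "mat_conj (diag_seq w) = diag_seq (\<lambda>i. cnj (w i))"
  by (simp add: mat_conj_def diag_of_def vec_eq_iff)

lemma adjoint_diag_seq: "adjoint_mat (diag_seq w) = diag_seq (\<lambda>i. cnj (w i))"
  by (simp add: transpose_def diag_of_def vec_eq_iff)

text \<open>One sequence serves all continuous class functions simultaneously. Conjugation and
  adjunction preserve continuity and conjugation invariance, so the same sequence, conjugated,
  describes those two matrices.\<close>

lemma eigenvalues:
  fixes M :: "complex^'n^'n"
  obtains w :: "nat \<Rightarrow> complex" where
    "\<And>f :: complex^'n^'n \<Rightarrow> complex. continuous_on UNIV f \<Longrightarrow> class_fun f \<Longrightarrow>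
        f M = f (diag_seq w) \<and> f (mat_conj M) = f (diag_seq (\<lambda>i. cnj (w i)))
        \<and> f (adjoint_mat M) = f (diag_seq (\<lambda>i. cnj (w i)))"
proof -
  obtain d :: "'n \<Rightarrow> complex" where
    d: "\<And>f :: complex^'n^'n \<Rightarrow> complex. continuous_on UNIV f \<Longrightarrow> class_fun f \<Longrightarrow> f M = f (diag_of d)"
    using continuous_class_fun_diag[of M] by blast
  define w where "w j = d (inv_into UNIV index_of j)" for j
  have "inj (index_of :: 'n \<Rightarrow> nat)" using bij_index_of by (rule bij_betw_imp_inj_on)
  then have w: "diag_of d = diag_seq w" by (simp add: w_def inv_f_f)
  show thesis
  proof (rule that, intro conjI)
    fix f :: "complex^'n^'n \<Rightarrow> complex"
    assume f: "continuous_on UNIV f" "class_fun f"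
    show "f M = f (diag_seq w)" using d[OF f] by (simp add: w)
    have "continuous_on UNIV (\<lambda>M. f (mat_conj M))"
      using continuous_on_compose2[OF f(1) continuous_on_mat_conj] by simp
    from d[OF this class_fun_mat_conj[OF f(2)]] show "f (mat_conj M) = f (diag_seq (\<lambda>i. cnj (w i)))"
      by (simp only: w mat_conj_diag_seq)
    have "continuous_on UNIV (\<lambda>M. f (adjoint_mat M))"
      using f(1) by (rule continuous_on_compose2) (auto intro!: continuous_intros)
    from d[OF this class_fun_adjoint[OF f(2)]] show "f (adjoint_mat M) = f (diag_seq (\<lambda>i. cnj (w i)))"
      by (simp only: w adjoint_diag_seq)
  qed
qed

lemma trace_schur_class: "class_fun (\<lambda>M :: complex^'n^'n. trace_schur M k)"
  by (simp add: class_fun_def trace_schur_conj)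

lemma schur_det_class: "class_fun (\<lambda>M :: complex^'n^'n. schur_det (trace_schur M) n x)"
  by (simp add: class_fun_def trace_schur_conj)

lemma trace_schur_eigenvalues:
  fixes M :: "complex^'n^'n"
  assumes "\<And>f :: complex^'n^'n \<Rightarrow> complex. continuous_on UNIV f \<Longrightarrow> class_fun f \<Longrightarrow> f M = f (diag_seq w)"
  shows "trace_schur M = complete_hom CARD('n) w"
  using assms[OF polynomial_mat_continuous[OF polynomial_mat_trace_schur] trace_schur_class]
  by (simp add: fun_eq_iff trace_schur_diag_seq)

text \<open>The reproducing formula produces the adjoint, the theorem has the entrywise conjugate.
  They are transposes of each other and share their symmetric functions.\<close>

lemma sym_trace_adjoint:
  fixes M :: "complex^'n^'n"
  shows "sym_trace K u (adjoint_mat M) = (\<Sum>k\<le>K. u ^ k * trace_schur (mat_conj M) (int k))"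
proof -
  obtain w :: "nat \<Rightarrow> complex" where
    w: "\<And>f :: complex^'n^'n \<Rightarrow> complex. continuous_on UNIV f \<Longrightarrow> class_fun f \<Longrightarrow>
        f M = f (diag_seq w) \<and> f (mat_conj M) = f (diag_seq (\<lambda>i. cnj (w i)))
        \<and> f (adjoint_mat M) = f (diag_seq (\<lambda>i. cnj (w i)))"
    using eigenvalues[of M] by blast
  have "sym_trace K u (adjoint_mat M) = (\<Sum>k\<le>K. u ^ k * complete_hom CARD('n) (\<lambda>i. cnj (w i)) (int k))"
    using w[OF sym_trace_continuous sym_trace_class, of K u]
    by (simp add: sym_trace_diag_complete_hom[OF bij_index_of, of K u "\<lambda>i. cnj (w i)"])
  also have "complete_hom CARD('n) (\<lambda>i. cnj (w i)) = trace_schur (mat_conj M)"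
    by (rule trace_schur_eigenvalues[symmetric]) (use w in blast)
  finally show ?thesis .
qed

section \<open>Orthonormality of Schur functions\<close>

text \<open>The monomials of an alternant have the exponents \<open>x \<circ> p\<close>. For
  strictly increasing \<open>x\<close>, only \<open>p = id\<close> gives an increasing sequence, so
  the coefficient at \<open>y\<close> tests equality with \<open>x\<close>.\<close>

lemma coeff_at_alternant:
  fixes e :: "'v::finite \<Rightarrow> nat"
  assumes e: "bij_betw e UNIV {0..<n}"
    and x: "strict_mono_on {0..<n} x" "\<And>i. i < n \<Longrightarrow> x i < N"
    and y: "strict_mono_on {0..<n} y" "\<And>i. i < n \<Longrightarrow> y i < N"
    and "0 < N"
  shows "coeff_at N (\<lambda>v. y (e v)) (\<lambda>X. alternant n (\<lambda>j. X (inv_into UNIV e j)) x)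
    = of_bool (\<forall>i<n. x i = y i)"
proof -
  let ?P = "{p. p permutes {0..<n}}"
  have lt: "e v < n" for v using bij_betwE[OF e] by simp
  have pn: "p i < n" if "p \<in> ?P" "i < n" for p i using that permutes_in_image[of p "{0..<n}" i] by simp
  have alt: "alternant n (\<lambda>j. X (inv_into UNIV e j)) x
      = (\<Sum>p\<in>?P. of_int (sign p) * monom_fun (\<lambda>v. x (p (e v))) X)" for X
  proof -
    have "alternant n (\<lambda>j. X (inv_into UNIV e j)) x
        = (\<Sum>p\<in>?P. of_int (sign p) * (\<Prod>i=0..<n. X (inv_into UNIV e i) ^ x (p i)))"
      unfolding alternant_def detf_transpose[of n "\<lambda>i j. X (inv_into UNIV e j) ^ x i", symmetric]
      by (simp add: detf_leibniz)
    also have "\<dots> = (\<Sum>p\<in>?P. of_int (sign p) * monom_fun (\<lambda>v. x (p (e v))) X)"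
      unfolding monom_fun_def
      using e by (simp add: prod.reindex_bij_betw[OF e, symmetric] bij_betw_def inv_into_f_f)
    finally show ?thesis .
  qed
  have cond: "(\<lambda>v. y (e v)) = (\<lambda>v. x (p (e v))) \<longleftrightarrow> p = id \<and> (\<forall>i<n. x i = y i)" if p: "p \<in> ?P" for p
  proof
    assume "(\<lambda>v. y (e v)) = (\<lambda>v. x (p (e v)))"
    then have yx: "y i = x (p i)" if "i < n" for i
      using that e by (metis atLeastLessThan_iff bij_betw_imp_surj_on image_iff zero_le)
    have "y ` {0..<n} = x ` {0..<n}"
    proof -
      have "y ` {0..<n} = (\<lambda>i. x (p i)) ` {0..<n}" using yx by (intro image_cong) auto
      also have "\<dots> = x ` {0..<n}" using permutes_image[of p "{0..<n}"] p by (metis image_image mem_Collect_eq)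
      finally show ?thesis .
    qed
    then have eq: "x i = y i" if "i < n" for i
      using strict_mono_on_image_unique[OF x(1) y(1) _ that] by simp
    have "p i = i" for i
    proof (cases "i < n")
      case True
      have "x (p i) = x i" using yx[OF True] eq[OF True] by simp
      moreover have "inj_on x {0..<n}" using x(1) by (rule strict_mono_on_imp_inj_on)
      ultimately show ?thesis using True pn[OF p True] by (auto dest: inj_onD)
    next
      case False
      then show ?thesis using p by (simp add: permutes_def)
    qed
    then show "p = id \<and> (\<forall>i<n. x i = y i)" using eq by auto
  next
    assume "p = id \<and> (\<forall>i<n. x i = y i)"
    then show "(\<lambda>v. y (e v)) = (\<lambda>v. x (p (e v)))" using lt by auto
  qed
  have "coeff_at N (\<lambda>v. y (e v)) (\<lambda>X. alternant n (\<lambda>j. X (inv_into UNIV e j)) x)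
      = (\<Sum>p\<in>?P. of_int (sign p) * (if (\<lambda>v. y (e v)) = (\<lambda>v. x (p (e v))) then 1 else 0))"
  proof -
    have "coeff_at N (\<lambda>v. y (e v)) (monom_fun (\<lambda>v. x (p (e v))))
        = (if (\<lambda>v. y (e v)) = (\<lambda>v. x (p (e v))) then 1 else 0)" if "p \<in> ?P" for p
      by (rule coeff_at_monom[OF \<open>0 < N\<close>]) (use lt x(2) y(2) pn[OF that] in auto)
    then show ?thesis
      unfolding alt by (simp add: coeff_at_sum coeff_at_scale finite_permutations)
  qed
  also have "\<dots> = (\<Sum>p\<in>?P. if p = id then of_bool (\<forall>i<n. x i = y i) else 0)"
    by (intro sum.cong) (auto simp: cond)
  also have "\<dots> = of_bool (\<forall>i<n. x i = y i)"
    by (simp add: finite_permutations permutes_id)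
  finally show ?thesis .
qed

abbreviation schur_of :: "complex^'n^'n \<Rightarrow> (nat \<Rightarrow> nat) \<Rightarrow> complex" where
  "schur_of (M :: complex^'n^'n) x \<equiv> schur_det (trace_schur M) CARD('n) x"

lemma schur_det_cong:
  assumes "\<And>i. i < n \<Longrightarrow> x i = y i"
  shows "schur_det h n x = schur_det h n y"
  unfolding schur_det_def by (rule detf_cong) (simp add: assms)

lemma continuous_on_schur_of: "continuous_on S (\<lambda>M :: complex^'n^'n. schur_of M x)"
  by (rule polynomial_mat_continuous[OF polynomial_mat_schur_det])

lemma continuous_on_comp_mat_conj:
  fixes f :: "complex^'n^'n \<Rightarrow> complex"
  assumes "continuous_on UNIV f"
  shows "continuous_on UNIV (\<lambda>M. f (mat_conj M))"
  using continuous_on_compose2[OF assms continuous_on_mat_conj] by simp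

theorem schur_orthonormal:
  fixes H :: "(complex^'n^'n) measure"
  assumes H: "normalized_haar H"
    and x: "strict_mono_on {0..<CARD('n)} x" and y: "strict_mono_on {0..<CARD('n)} y"
  shows "(\<integral>M. schur_of M x * schur_of (mat_conj M) y \<partial>H) = of_bool (\<forall>i<CARD('n). x i = y i)"
proof -
  let ?n = "CARD('n)"
  define F where "F M = schur_of M x" for M :: "complex^'n^'n"
  obtain d where d: "poly_mat d F"
    using polynomial_mat_schur_det[of ?n x] unfolding polynomial_mat_def F_def by blast
  \<comment> \<open>Large enough for the reproducing formula, for reading off the exponents
    \<open>x\<close> and \<open>y\<close> below \<open>K + n\<close>, and for the truncated
    \<open>h\<close> to agree with the full series in the determinant of \<open>y\<close>.\<close>
  define K where "K = d + (\<Sum>i<?n. x i + y i)"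
  have K: "d \<le> K" by (simp add: K_def)
  have xK: "x i \<le> K" and yK: "y i \<le> K" if "i < ?n" for i
    using member_le_sum[of i "{..<?n}" "\<lambda>i. x i + y i"] that by (auto simp: K_def)
  \<comment> \<open>Truncation as in \<open>sym_trace K\<close>, which turns the generating series
    into the polynomial that \<open>alternant_mult_prod\<close> requires.\<close>
  define h where "h M k = (if int K < k then 0 else trace_schur (mat_conj M) k)" for M :: "complex^'n^'n" and k
  have h_cont: "continuous_on UNIV (\<lambda>M. schur_det (h M) ?n s)" for s
  proof (rule continuous_on_schur_det)
    fix k
    show "continuous_on UNIV (\<lambda>M. h M k)"
      unfolding h_def
      using continuous_on_comp_mat_conj[OF polynomial_mat_continuous[OF polynomial_mat_trace_schur]]
      by (cases "int K < k") simp_all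
  qed
  define c where "c s = (\<integral>M. F M * schur_det (h M) ?n s \<partial>H)" for s
  have inner: "(\<Sum>m\<le>K. h M (int m) * u ^ m) = (\<Sum>m\<le>K. u ^ m * trace_schur (mat_conj M) (int m))" for M u
    by (rule sum.cong) (auto simp: h_def)
  have F_class: "class_fun F" unfolding F_def by (rule schur_det_class)
  have F_cont: "continuous_on UNIV F" using poly_mat_continuous[OF d] .
  \<comment> \<open>\<open>F (diag_seq v)\<close> is computed twice: by Jacobi--Trudi and by the
    reproducing formula. The wanted integral becomes the coefficient of one alternant in the
    expansion of another.\<close>
  have main: "alternant ?n v x = (\<Sum>s\<in>strict_seqs ?n (K + ?n). c s * alternant ?n v s)" for v
  proof -
    have "alternant ?n v x = alternant ?n v (\<lambda>i. i) * F (diag_seq v)"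
      by (simp add: F_def trace_schur_diag_seq jacobi_trudi[of ?n v x])
    also have "F (diag_seq v)
        = (\<integral>M. F M * (\<Prod>j\<in>UNIV. sym_trace K (v (index_of (j :: 'n))) (adjoint_mat M)) \<partial>H)"
      by (rule haar_reproducing[OF H d K F_class, symmetric])
    also have "\<dots> = (\<integral>M. F M * (\<Prod>j<?n. \<Sum>m\<le>K. h M (int m) * v j ^ m) \<partial>H)"
      unfolding prod.reindex_bij_betw[OF bij_index_of, of "\<lambda>j. sym_trace K (v j) (adjoint_mat _)"]
      by (simp only: sym_trace_adjoint inner)
    also have "alternant ?n v (\<lambda>i. i) * \<dots>
        = (\<integral>M. (\<Sum>s\<in>strict_seqs ?n (K + ?n). F M * schur_det (h M) ?n s * alternant ?n v s) \<partial>H)"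
    proof -
      have "alternant ?n v (\<lambda>i. i) * (F M * (\<Prod>j<?n. \<Sum>m\<le>K. h M (int m) * v j ^ m))
          = (\<Sum>s\<in>strict_seqs ?n (K + ?n). F M * schur_det (h M) ?n s * alternant ?n v s)" for M
      proof -
        have "alternant ?n v (\<lambda>i. i) * (\<Prod>j<?n. \<Sum>m\<le>K. h M (int m) * v j ^ m)
            = (\<Sum>s\<in>strict_seqs ?n (K + ?n). schur_det (h M) ?n s * alternant ?n v s)"
          by (rule alternant_mult_prod) (auto simp: h_def trace_schur_def)
        then show ?thesis by (simp add: mult.left_commute[of _ "F M"] sum_distrib_left mult.assoc)
      qed
      then show ?thesis unfolding integral_mult_right_zero[symmetric] by simp
    qed
    also have "\<dots> = (\<Sum>s\<in>strict_seqs ?n (K + ?n). (\<integral>M. F M * schur_det (h M) ?n s * alternant ?n v s \<partial>H))"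
      by (intro Bochner_Integration.integral_sum haar_integrable[OF H] continuous_intros F_cont h_cont)
    finally show ?thesis by (simp add: c_def)
  qed
  define y' where "y' = restrict y {0..<?n}"
  have y': "y' \<in> strict_seqs ?n (K + ?n)"
    using y yK by (force simp: y'_def strict_seqs_def strict_mono_on_def)
  have seqs: "strict_mono_on {0..<?n} s" "i < ?n \<Longrightarrow> s i < K + ?n" if "s \<in> strict_seqs ?n (K + ?n)" for s i
    using that by (auto simp: strict_seqs_def)
  have e: "bij_betw (index_of :: 'n \<Rightarrow> nat) UNIV {0..<?n}" using bij_index_of by (simp add: lessThan_atLeast0)
  let ?C = "coeff_at (K + ?n) (\<lambda>v. y' (index_of (v :: 'n)))"
  have C: "?C (\<lambda>X. alternant ?n (\<lambda>j. X (inv_into UNIV index_of j)) s) = of_bool (\<forall>i<?n. s i = y' i)"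
    if "strict_mono_on {0..<?n} s" "\<And>i. i < ?n \<Longrightarrow> s i < K + ?n" for s
    by (rule coeff_at_alternant[OF e]) (use that seqs[OF y'] in auto)
  have "of_bool (\<forall>i<?n. x i = y' i) = ?C (\<lambda>X. alternant ?n (\<lambda>j. X (inv_into UNIV index_of j)) x)"
    using x xK by (intro C[symmetric]) (auto intro: le_less_trans[where y = K])
  also have "\<dots> = (\<Sum>s\<in>strict_seqs ?n (K + ?n). c s * of_bool (\<forall>i<?n. s i = y' i))"
    unfolding main by (simp add: coeff_at_sum coeff_at_scale C seqs cong: sum.cong)
  also have "\<dots> = (\<Sum>s\<in>strict_seqs ?n (K + ?n). if s = y' then c y' else 0)"
  proof (rule sum.cong[OF refl])
    fix s assume "s \<in> strict_seqs ?n (K + ?n)"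
    then have "(\<forall>i<?n. s i = y' i) \<longleftrightarrow> s = y'"
      using y' unfolding strict_seqs_def by (auto intro!: PiE_ext[of s "{0..<?n}" "\<lambda>_. {0..<K + ?n}" y'])
    then show "c s * of_bool (\<forall>i<?n. s i = y' i) = (if s = y' then c y' else 0)" by simp
  qed
  also have "\<dots> = c y'" using y' by simp
  also have "\<dots> = (\<integral>M. schur_of M x * schur_of (mat_conj M) y \<partial>H)"
  proof -
    \<comment> \<open>All indices \<open>y i - j\<close> are at most \<open>K\<close>, so the
      truncation is invisible here.\<close>
    have "schur_det (h M) ?n y' = schur_of (mat_conj M) y" for M
      unfolding schur_det_def using yK by (intro detf_cong) (force simp: h_def y'_def)
    then show ?thesis by (simp add: c_def F_def)
  qed
  finally show ?thesis by (simp add: y'_def)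
qed

section \<open>Non-intersecting walkers\<close>

lemma schur_of_pieri:
  fixes M :: "complex^'n^'n"
  assumes "strict_mono_on {0..<CARD('n)} x"
  shows "schur_of M x * det_one_plus z M
    = (\<Sum>E | E \<subseteq> {0..<CARD('n)} \<and> strict_mono_on {0..<CARD('n)} (add_ind x E). z ^ card E * schur_of M (add_ind x E))"
proof -
  obtain w :: "nat \<Rightarrow> complex" where
    w: "\<And>f :: complex^'n^'n \<Rightarrow> complex. continuous_on UNIV f \<Longrightarrow> class_fun f \<Longrightarrow> f M = f (diag_seq w)"
    using eigenvalues[of M] by metis
  have "det_one_plus z M = (\<Prod>j<CARD('n). 1 + z * w j)"
    using w[OF det_one_plus_continuous det_one_plus_class] by (simp add: det_one_plus_diag_seq)
  moreover have "trace_schur M = complete_hom CARD('n) w"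
    by (rule trace_schur_eigenvalues) (rule w)
  ultimately show ?thesis
    using schur_det_pieri[OF assms] by simp
qed

text \<open>The integral of the theorem indexed by position sequences, in which form it obeys the
  recursions of \<open>walk_gf\<close>.\<close>

definition walk_integral ::
  "(complex^'n^'n) measure \<Rightarrow> complex \<Rightarrow> nat \<Rightarrow> nat \<Rightarrow> (nat \<Rightarrow> nat) \<Rightarrow> (nat \<Rightarrow> nat) \<Rightarrow> complex" where
  "walk_integral H z p q x y =
     (\<integral>M. schur_of M x * schur_of (mat_conj M) y * (det_one_plus z M ^ p * det_one_plus z (mat_conj M) ^ q) \<partial>H)"

lemma walk_integrand_integrable:
  "normalized_haar H \<Longrightarrow>
    integrable H (\<lambda>M. schur_of M x * schur_of (mat_conj M) y * (det_one_plus z M ^ p * det_one_plus z (mat_conj M) ^ q))"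
  by (intro haar_integrable continuous_intros continuous_on_schur_of det_one_plus_continuous
      continuous_on_comp_mat_conj[OF continuous_on_schur_of] continuous_on_comp_mat_conj[OF det_one_plus_continuous])

lemma walk_integral_Suc_p:
  fixes H :: "(complex^'n^'n) measure"
  assumes H: "normalized_haar H" and x: "strict_mono_on {0..<CARD('n)} x"
  shows "walk_integral H z (Suc p) q x y
    = (\<Sum>E | E \<subseteq> {0..<CARD('n)} \<and> strict_mono_on {0..<CARD('n)} (add_ind x E). z ^ card E * walk_integral H z p q (add_ind x E) y)"
proof -
  let ?r = "\<lambda>M. schur_of (mat_conj M) y * (det_one_plus z M ^ p * det_one_plus z (mat_conj M) ^ q)"
  have "walk_integral H z (Suc p) q x y = (\<integral>M. (schur_of M x * det_one_plus z M) * ?r M \<partial>H)"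
    by (simp add: walk_integral_def mult_ac)
  also have "\<dots> = (\<integral>M. (\<Sum>E | E \<subseteq> {0..<CARD('n)} \<and> strict_mono_on {0..<CARD('n)} (add_ind x E).
      z ^ card E * (schur_of M (add_ind x E) * schur_of (mat_conj M) y * (det_one_plus z M ^ p * det_one_plus z (mat_conj M) ^ q))) \<partial>H)"
    unfolding schur_of_pieri[OF x] by (simp add: sum_distrib_right mult.assoc)
  also have "\<dots> = (\<Sum>E | E \<subseteq> {0..<CARD('n)} \<and> strict_mono_on {0..<CARD('n)} (add_ind x E).
      z ^ card E * walk_integral H z p q (add_ind x E) y)"
    unfolding walk_integral_def
    by (subst Bochner_Integration.integral_sum) (use walk_integrand_integrable[OF H] in auto)
  finally show ?thesis .
qed

lemma walk_integral_Suc_q: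
  fixes H :: "(complex^'n^'n) measure"
  assumes H: "normalized_haar H" and y: "strict_mono_on {0..<CARD('n)} y"
  shows "walk_integral H z p (Suc q) x y
    = (\<Sum>E | E \<subseteq> {0..<CARD('n)} \<and> strict_mono_on {0..<CARD('n)} (add_ind y E). z ^ card E * walk_integral H z p q x (add_ind y E))"
proof -
  let ?r = "\<lambda>M. schur_of M x * (det_one_plus z M ^ p * det_one_plus z (mat_conj M) ^ q)"
  have "walk_integral H z p (Suc q) x y = (\<integral>M. (schur_of (mat_conj M) y * det_one_plus z (mat_conj M)) * ?r M \<partial>H)"
    by (simp add: walk_integral_def mult_ac)
  also have "\<dots> = (\<integral>M. (\<Sum>E | E \<subseteq> {0..<CARD('n)} \<and> strict_mono_on {0..<CARD('n)} (add_ind y E).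
      z ^ card E * (schur_of M x * schur_of (mat_conj M) (add_ind y E) * (det_one_plus z M ^ p * det_one_plus z (mat_conj M) ^ q))) \<partial>H)"
    unfolding schur_of_pieri[OF y] by (simp add: sum_distrib_left mult_ac)
  also have "\<dots> = (\<Sum>E | E \<subseteq> {0..<CARD('n)} \<and> strict_mono_on {0..<CARD('n)} (add_ind y E).
      z ^ card E * walk_integral H z p q x (add_ind y E))"
    unfolding walk_integral_def
    by (subst Bochner_Integration.integral_sum) (use walk_integrand_integrable[OF H] in auto)
  finally show ?thesis .
qed

lemma walk_integral_0:
  fixes H :: "(complex^'n^'n) measure"
  assumes "normalized_haar H" "strict_mono_on {0..<CARD('n)} x" "strict_mono_on {0..<CARD('n)} y"
  shows "walk_integral H z 0 0 x y = of_bool (\<forall>i<CARD('n). x i = y i)"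
  using schur_orthonormal[OF assms] by (simp add: walk_integral_def)

section \<open>Sets of walks and their recursion\<close>

definition walk_set :: "nat \<Rightarrow> nat \<Rightarrow> nat \<Rightarrow> (nat \<Rightarrow> nat) \<Rightarrow> (nat \<Rightarrow> nat) \<Rightarrow> (nat \<times> nat \<Rightarrow> int) set" where
  "walk_set n p q x y =
     {w \<in> ({0..p + q} \<times> {1..n}) \<rightarrow>\<^sub>E UNIV.
        (\<forall>j\<in>{1..n}. w (0, j) = int (x j) \<and> w (p + q, j) = int (y j)) \<and>
        (\<forall>t\<in>{0..p + q}. strict_mono_on {1..n} (\<lambda>j. w (t, j))) \<and>
        (\<forall>t\<in>{1..p}. \<forall>j\<in>{1..n}. w (t, j) - w (t - 1, j) \<in> {0, 1}) \<and>
        (\<forall>t\<in>{p + 1..p + q}. \<forall>j\<in>{1..n}. w (t, j) - w (t - 1, j) \<in> {0, - 1})}"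

definition moves :: "nat \<Rightarrow> nat \<Rightarrow> (nat \<times> nat \<Rightarrow> int) \<Rightarrow> int" where
  "moves n T w = (\<Sum>t = 1..T. \<Sum>j = 1..n. \<bar>w (t, j) - w (t - 1, j)\<bar>)"

lemma moves_nonneg: "0 \<le> moves n T w"
  unfolding moves_def by (intro sum_nonneg) simp

lemma walks_eq: "walks n p q x y k = {w \<in> walk_set n p q x y. moves n (p + q) w = int k}"
  by (auto simp: walks_def walk_set_def moves_def)

lemma walk_setD:
  assumes "w \<in> walk_set n p q x y"
  shows "\<And>j. 1 \<le> j \<Longrightarrow> j \<le> n \<Longrightarrow> w (0, j) = int (x j)"
    "\<And>j. 1 \<le> j \<Longrightarrow> j \<le> n \<Longrightarrow> w (p + q, j) = int (y j)"
    "\<And>t. t \<le> p + q \<Longrightarrow> strict_mono_on {1..n} (\<lambda>j. w (t, j))"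
    "\<And>t j. 1 \<le> t \<Longrightarrow> t \<le> p \<Longrightarrow> 1 \<le> j \<Longrightarrow> j \<le> n \<Longrightarrow> w (t, j) - w (t - 1, j) \<in> {0, 1}"
    "\<And>t j. p < t \<Longrightarrow> t \<le> p + q \<Longrightarrow> 1 \<le> j \<Longrightarrow> j \<le> n \<Longrightarrow> w (t, j) - w (t - 1, j) \<in> {0, - 1}"
    "\<And>t j. \<not> (t \<le> p + q \<and> 1 \<le> j \<and> j \<le> n) \<Longrightarrow> w (t, j) = undefined"
  using assms by (auto simp: walk_set_def PiE_def extensional_def)

lemma walk_setI:
  assumes "\<And>j. 1 \<le> j \<Longrightarrow> j \<le> n \<Longrightarrow> w (0, j) = int (x j)"
    "\<And>j. 1 \<le> j \<Longrightarrow> j \<le> n \<Longrightarrow> w (p + q, j) = int (y j)"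
    "\<And>t. t \<le> p + q \<Longrightarrow> strict_mono_on {1..n} (\<lambda>j. w (t, j))"
    "\<And>t j. 1 \<le> t \<Longrightarrow> t \<le> p \<Longrightarrow> 1 \<le> j \<Longrightarrow> j \<le> n \<Longrightarrow> w (t, j) - w (t - 1, j) \<in> {0, 1}"
    "\<And>t j. p < t \<Longrightarrow> t \<le> p + q \<Longrightarrow> 1 \<le> j \<Longrightarrow> j \<le> n \<Longrightarrow> w (t, j) - w (t - 1, j) \<in> {0, - 1}"
    "\<And>t j. \<not> (t \<le> p + q \<and> 1 \<le> j \<and> j \<le> n) \<Longrightarrow> w (t, j) = undefined"
  shows "w \<in> walk_set n p q x y"
proof -
  have "w \<in> ({0..p + q} \<times> {1..n}) \<rightarrow>\<^sub>E UNIV"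
    using assms(6) by (auto simp: PiE_def extensional_def)
  then show ?thesis using assms(1-5) by (simp add: walk_set_def)
qed

definition append_step :: "nat \<Rightarrow> nat \<Rightarrow> (nat \<Rightarrow> nat) \<Rightarrow> (nat \<times> nat \<Rightarrow> int) \<Rightarrow> nat \<times> nat \<Rightarrow> int" where
  "append_step n T y w = (\<lambda>(t, j). if t = Suc T \<and> 1 \<le> j \<and> j \<le> n then int (y j) else w (t, j))"

text \<open>The last instant is a left step into \<open>y\<close>. Hence the walkers stood at
  \<open>add_ind y E\<close> before it, where \<open>E\<close> is the set of those that
  moved.\<close>

lemma append_step_bij:
  assumes y: "strict_mono_on {1..n} y"
  shows "bij_betw (\<lambda>(E, w). append_step n (p + q) y w)
     (SIGMA E:{E. E \<subseteq> {1..n} \<and> strict_mono_on {1..n} (add_ind y E)}. walk_set n p q x (add_ind y E))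
     (walk_set n p (Suc q) x y)"
proof (rule bij_betw_byWitness[where
      f' = "\<lambda>w. ({j \<in> {1..n}. w (p + q, j) = int (y j) + 1}, restrict w ({0..p + q} \<times> {1..n}))"])
  let ?D = "SIGMA E:{E. E \<subseteq> {1..n} \<and> strict_mono_on {1..n} (add_ind y E)}. walk_set n p q x (add_ind y E)"
  show "\<forall>a\<in>?D. (\<lambda>w. ({j \<in> {1..n}. w (p + q, j) = int (y j) + 1}, restrict w ({0..p + q} \<times> {1..n})))
      ((\<lambda>(E, w). append_step n (p + q) y w) a) = a"
  proof
    fix a assume "a \<in> ?D"
    then obtain E w where a: "a = (E, w)" and E: "E \<subseteq> {1..n}" and w: "w \<in> walk_set n p q x (add_ind y E)" by blast
    have "restrict (append_step n (p + q) y w) ({0..p + q} \<times> {1..n}) = w"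
      using walk_setD(6)[OF w] by (auto simp: append_step_def restrict_def fun_eq_iff)
    moreover have "{j \<in> {1..n}. append_step n (p + q) y w (p + q, j) = int (y j) + 1} = E"
      using E walk_setD(2)[OF w] by (auto simp: append_step_def add_ind_def split: if_splits)
    ultimately show "(\<lambda>w. ({j \<in> {1..n}. w (p + q, j) = int (y j) + 1}, restrict w ({0..p + q} \<times> {1..n})))
      ((\<lambda>(E, w). append_step n (p + q) y w) a) = a" unfolding a prod.case by simp
  qed
  show "\<forall>w\<in>walk_set n p (Suc q) x y. (\<lambda>(E, w). append_step n (p + q) y w)
      ({j \<in> {1..n}. w (p + q, j) = int (y j) + 1}, restrict w ({0..p + q} \<times> {1..n})) = w"
  proof
    fix w assume w: "w \<in> walk_set n p (Suc q) x y"
    show "(\<lambda>(E, w). append_step n (p + q) y w)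
      ({j \<in> {1..n}. w (p + q, j) = int (y j) + 1}, restrict w ({0..p + q} \<times> {1..n})) = w"
      using walk_setD(2,6)[OF w] by (auto simp: append_step_def restrict_def fun_eq_iff le_Suc_eq)
  qed
  show "(\<lambda>(E, w). append_step n (p + q) y w) ` ?D \<subseteq> walk_set n p (Suc q) x y"
  proof (rule image_subsetI)
    fix a assume "a \<in> ?D"
    then obtain E w where a: "a = (E, w)" and E: "E \<subseteq> {1..n}" and w: "w \<in> walk_set n p q x (add_ind y E)" by blast
    note D = walk_setD[OF w]
    show "(\<lambda>(E, w). append_step n (p + q) y w) a \<in> walk_set n p (Suc q) x y"
      unfolding a prod.case
    proof (rule walk_setI)
      show "strict_mono_on {1..n} (\<lambda>j. append_step n (p + q) y w (t, j))" if "t \<le> p + Suc q" for t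
      proof (cases "t = Suc (p + q)")
        case True
        then show ?thesis using y by (auto simp: strict_mono_on_def append_step_def)
      next
        case False
        then show ?thesis using D(3)[of t] that by (simp add: append_step_def)
      qed
      show "append_step n (p + q) y w (t, j) - append_step n (p + q) y w (t - 1, j) \<in> {0, - 1}"
        if "p < t" "t \<le> p + Suc q" "1 \<le> j" "j \<le> n" for t j
      proof (cases "t = Suc (p + q)")
        case True
        then show ?thesis using D(2)[of j] that by (auto simp: append_step_def add_ind_def)
      next
        case False
        then show ?thesis using D(5)[of t j] that by (auto simp: append_step_def)
      qed
      show "append_step n (p + q) y w (t, j) - append_step n (p + q) y w (t - 1, j) \<in> {0, 1}"
        if "1 \<le> t" "t \<le> p" "1 \<le> j" "j \<le> n" for t j
        using D(4)[of t j] that by (auto simp: append_step_def)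
    qed (use D(1,6) in \<open>auto simp: append_step_def\<close>)
  qed
  show "(\<lambda>w. ({j \<in> {1..n}. w (p + q, j) = int (y j) + 1}, restrict w ({0..p + q} \<times> {1..n}))) `
      walk_set n p (Suc q) x y \<subseteq> ?D"
  proof (rule image_subsetI)
    fix w assume w: "w \<in> walk_set n p (Suc q) x y"
    note D = walk_setD[OF w]
    define E where "E = {j \<in> {1..n}. w (p + q, j) = int (y j) + 1}"
    have last: "w (p + q, j) = int (add_ind y E j)" if "1 \<le> j" "j \<le> n" for j
      using D(5)[of "Suc (p + q)" j] D(2)[of j] that by (auto simp: E_def add_ind_def)
    have "strict_mono_on {1..n} (add_ind y E)"
      using D(3)[of "p + q"] last by (auto simp: strict_mono_on_def) 
    moreover have "restrict w ({0..p + q} \<times> {1..n}) \<in> walk_set n p q x (add_ind y E)"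
    proof (rule walk_setI)
      show "strict_mono_on {1..n} (\<lambda>j. restrict w ({0..p + q} \<times> {1..n}) (t, j))" if "t \<le> p + q" for t
        using D(3)[of t] that by (auto simp: strict_mono_on_def)
      show "restrict w ({0..p + q} \<times> {1..n}) (t, j) - restrict w ({0..p + q} \<times> {1..n}) (t - 1, j) \<in> {0, 1}"
        if "1 \<le> t" "t \<le> p" "1 \<le> j" "j \<le> n" for t j
        using D(4)[of t j] that by auto
      show "restrict w ({0..p + q} \<times> {1..n}) (t, j) - restrict w ({0..p + q} \<times> {1..n}) (t - 1, j) \<in> {0, - 1}"
        if "p < t" "t \<le> p + q" "1 \<le> j" "j \<le> n" for t j
        using D(5)[of t j] that by auto
    qed (use D(1) last in auto)
    ultimately show "({j \<in> {1..n}. w (p + q, j) = int (y j) + 1}, restrict w ({0..p + q} \<times> {1..n})) \<in> ?D"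
      by (auto simp: E_def)
  qed
qed

lemma moves_append_step:
  assumes w: "w \<in> walk_set n p q x (add_ind y E)" and E: "E \<subseteq> {1..n}"
  shows "moves n (Suc (p + q)) (append_step n (p + q) y w) = moves n (p + q) w + int (card E)"
proof -
  have "(\<Sum>t = 1..p + q. \<Sum>j = 1..n. \<bar>append_step n (p + q) y w (t, j) - append_step n (p + q) y w (t - 1, j)\<bar>)
      = moves n (p + q) w"
    unfolding moves_def by (intro sum.cong refl) (auto simp: append_step_def)
  moreover have "(\<Sum>j = 1..n. \<bar>append_step n (p + q) y w (Suc (p + q), j) - append_step n (p + q) y w (p + q, j)\<bar>)
      = (\<Sum>j\<in>{1..n}. of_bool (j \<in> E))"
    using walk_setD(2)[OF w] by (intro sum.cong refl) (auto simp: append_step_def add_ind_def)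
  moreover have "(\<Sum>j\<in>{1..n}. of_bool (j \<in> E)) = int (card E)"
  proof -
    have "{1..n} \<inter> {j. j \<in> E} = E" using E by auto
    then show ?thesis by (simp add: of_bool_def sum.If_cases)
  qed
  ultimately show ?thesis by (simp add: moves_def)
qed

text \<open>The number of moves, fixed in \<open>walks\<close>, is free in \<open>walk_set\<close>
  and becomes the exponent of \<open>z\<close>.\<close>

definition walk_gf :: "complex \<Rightarrow> nat \<Rightarrow> nat \<Rightarrow> nat \<Rightarrow> (nat \<Rightarrow> nat) \<Rightarrow> (nat \<Rightarrow> nat) \<Rightarrow> complex" where
  "walk_gf z n p q x y = (\<Sum>w\<in>walk_set n p q x y. z ^ nat (moves n (p + q) w))"

lemma walk_set_empty:
  assumes "\<not> strict_mono_on {1..n} y"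
  shows "walk_set n p q x y = {}"
proof (rule ccontr)
  assume "walk_set n p q x y \<noteq> {}"
  then obtain w where w: "w \<in> walk_set n p q x y" by blast
  have "strict_mono_on {1..n} y"
    using walk_setD(3)[OF w, of "p + q"] walk_setD(2)[OF w] by (auto simp: strict_mono_on_def)
  with assms show False by contradiction
qed

text \<open>Right steps stand at the beginning of a walk. Time reversal turns them into final left
  steps, so \<open>append_step_bij\<close> covers both directions once no other steps
  remain.\<close>

definition reverse_walk :: "nat \<Rightarrow> nat \<Rightarrow> (nat \<times> nat \<Rightarrow> int) \<Rightarrow> nat \<times> nat \<Rightarrow> int" where
  "reverse_walk n T w = (\<lambda>(t, j). if t \<le> T \<and> 1 \<le> j \<and> j \<le> n then w (T - t, j) else undefined)"

lemma reverse_walk_right: "w \<in> walk_set n p 0 x y \<Longrightarrow> reverse_walk n p w \<in> walk_set n 0 p y x"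
proof -
  assume w: "w \<in> walk_set n p 0 x y"
  note D = walk_setD[OF w]
  show ?thesis
  proof (rule walk_setI)
    show "strict_mono_on {1..n} (\<lambda>j. reverse_walk n p w (t, j))" if "t \<le> 0 + p" for t
      using D(3)[of "p - t"] that by (auto simp: strict_mono_on_def reverse_walk_def)
    show "reverse_walk n p w (t, j) - reverse_walk n p w (t - 1, j) \<in> {0, - 1}"
      if "0 < t" "t \<le> 0 + p" "1 \<le> j" "j \<le> n" for t j
    proof -
      have "Suc (p - t) = p - (t - 1)" using that by simp
      then show ?thesis using D(4)[of "Suc (p - t)" j] that by (auto simp: reverse_walk_def)
    qed
  qed (use D(1,2) in \<open>auto simp: reverse_walk_def\<close>)
qed

lemma reverse_walk_left: "w \<in> walk_set n 0 p y x \<Longrightarrow> reverse_walk n p w \<in> walk_set n p 0 x y"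
proof -
  assume w: "w \<in> walk_set n 0 p y x"
  note D = walk_setD[OF w]
  show ?thesis
  proof (rule walk_setI)
    show "strict_mono_on {1..n} (\<lambda>j. reverse_walk n p w (t, j))" if "t \<le> p + 0" for t
      using D(3)[of "p - t"] that by (auto simp: strict_mono_on_def reverse_walk_def)
    show "reverse_walk n p w (t, j) - reverse_walk n p w (t - 1, j) \<in> {0, 1}"
      if "1 \<le> t" "t \<le> p" "1 \<le> j" "j \<le> n" for t j
    proof -
      have "Suc (p - t) = p - (t - 1)" using that by simp
      then show ?thesis using D(5)[of "Suc (p - t)" j] that by (auto simp: reverse_walk_def)
    qed
  qed (use D(1,2) in \<open>auto simp: reverse_walk_def\<close>)
qed

lemma reverse_reverse_walk:
  assumes "w \<in> walk_set n p q x y" "T = p + q"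
  shows "reverse_walk n T (reverse_walk n T w) = w"
  using walk_setD(6)[OF assms(1)] assms(2) by (auto simp: reverse_walk_def fun_eq_iff)

lemma moves_reverse_walk: "moves n T (reverse_walk n T w) = moves n T w"
  unfolding moves_def
\<comment> \<open>Instant \<open>t\<close> of the reversed walk undoes instant
  \<open>T + 1 - t\<close>.\<close>
proof (rule sum.reindex_bij_witness[of _ "\<lambda>t. Suc T - t" "\<lambda>t. Suc T - t"])
  fix t assume "t \<in> {1..T}"
  then have "Suc T - t - 1 = T - t" "T - (t - 1) = Suc T - t" by auto
  then show "(\<Sum>j = 1..n. \<bar>w (Suc T - t, j) - w (Suc T - t - 1, j)\<bar>)
      = (\<Sum>j = 1..n. \<bar>reverse_walk n T w (t, j) - reverse_walk n T w (t - 1, j)\<bar>)"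
    using \<open>t \<in> {1..T}\<close> by (intro sum.cong refl) (auto simp: reverse_walk_def)
qed auto

lemma walk_gf_reverse: "walk_gf z n p 0 x y = walk_gf z n 0 p y x"
  unfolding walk_gf_def
  by (rule sum.reindex_bij_witness[of _ "reverse_walk n p" "reverse_walk n p"])
    (auto simp: reverse_walk_right reverse_walk_left reverse_reverse_walk moves_reverse_walk)

definition constant_walk :: "nat \<Rightarrow> (nat \<Rightarrow> nat) \<Rightarrow> nat \<times> nat \<Rightarrow> int" where
  "constant_walk n x = (\<lambda>(t, j). if t = 0 \<and> 1 \<le> j \<and> j \<le> n then int (x j) else undefined)"

lemma walk_set_0_subset: "walk_set n 0 0 x y \<subseteq> {constant_walk n x}"
proof
  fix w assume w: "w \<in> walk_set n 0 0 x y"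
  have "w (t, j) = constant_walk n x (t, j)" for t j
    using walk_setD(1)[OF w, of j] walk_setD(6)[OF w, of t j] by (simp add: constant_walk_def)
  then show "w \<in> {constant_walk n x}" by auto
qed

lemma walk_gf_0:
  assumes "strict_mono_on {1..n} x"
  shows "walk_gf z n 0 0 x y = of_bool (\<forall>j\<in>{1..n}. x j = y j)"
proof -
  define c where "c = constant_walk n x"
  have sub: "walk_set n 0 0 x y \<subseteq> {c}" unfolding c_def by (rule walk_set_0_subset)
  show ?thesis
  proof (cases "\<forall>j\<in>{1..n}. x j = y j")
    case True
    have "c \<in> walk_set n 0 0 x y"
      using True assms by (intro walk_setI) (auto simp: c_def constant_walk_def strict_mono_on_def)
    then have "walk_set n 0 0 x y = {c}" using sub by blast
    then show ?thesis using True by (simp add: walk_gf_def moves_def)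
  next
    case False
    then obtain j where "1 \<le> j" "j \<le> n" "x j \<noteq> y j" by auto
    then have "w \<notin> walk_set n 0 0 x y" for w
      using walk_setD(1,2)[of w n 0 0 x y j] by fastforce
    then have "walk_set n 0 0 x y = {}" by blast
    then show ?thesis using False by (auto simp: walk_gf_def)
  qed
qed

lemma finite_walk_set_left:
  assumes "\<And>y. finite (walk_set n p 0 x y)"
  shows "finite (walk_set n p q x y)"
proof (induction q arbitrary: y)
  case (Suc q)
  show ?case
  proof (cases "strict_mono_on {1..n} y")
    case True
    have "finite (SIGMA E:{E. E \<subseteq> {1..n} \<and> strict_mono_on {1..n} (add_ind y E)}. walk_set n p q x (add_ind y E))"
      by (rule finite_SigmaI) (auto intro: Suc.IH finite_subset[of _ "Pow {1..n}"])
    then show ?thesis using bij_betw_finite[OF append_step_bij[OF True]] by blast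
  qed (simp add: walk_set_empty)
qed (use assms in auto)

lemma finite_walk_set: "finite (walk_set n p q x y)"
proof -
  have start: "finite (walk_set n 0 0 x y)" for x y
    by (rule finite_subset[OF walk_set_0_subset]) simp
  have left: "finite (walk_set n 0 q x y)" for q x y
    by (rule finite_walk_set_left) (rule start)
  have "finite (walk_set n p 0 x y)" for x y
  proof -
    have "walk_set n p 0 x y \<subseteq> reverse_walk n p ` walk_set n 0 p y x"
    proof
      fix w assume w: "w \<in> walk_set n p 0 x y"
      then have "w = reverse_walk n p (reverse_walk n p w)" by (simp add: reverse_reverse_walk)
      then show "w \<in> reverse_walk n p ` walk_set n 0 p y x" using reverse_walk_right[OF w] by blast
    qed
    then show ?thesis using left finite_surj by blast
  qed
  then show ?thesis by (rule finite_walk_set_left)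
qed

lemma walk_gf_Suc_q:
  assumes y: "strict_mono_on {1..n} y"
  shows "walk_gf z n p (Suc q) x y
    = (\<Sum>E | E \<subseteq> {1..n} \<and> strict_mono_on {1..n} (add_ind y E). z ^ card E * walk_gf z n p q x (add_ind y E))"
proof -
  let ?I = "{E. E \<subseteq> {1..n} \<and> strict_mono_on {1..n} (add_ind y E)}"
  have fI: "finite ?I" by (rule finite_subset[of _ "Pow {1..n}"]) auto
  have "walk_gf z n p (Suc q) x y
      = (\<Sum>(E, w)\<in>(SIGMA E:?I. walk_set n p q x (add_ind y E)). z ^ nat (moves n (Suc (p + q)) (append_step n (p + q) y w)))"
    unfolding walk_gf_def sum.reindex_bij_betw[OF append_step_bij[OF y], symmetric]
    by (simp add: case_prod_beta)
  also have "\<dots> = (\<Sum>E\<in>?I. \<Sum>w\<in>walk_set n p q x (add_ind y E). z ^ nat (moves n (Suc (p + q)) (append_step n (p + q) y w)))"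
    using fI finite_walk_set by (subst sum.Sigma) auto
  also have "\<dots> = (\<Sum>E\<in>?I. z ^ card E * walk_gf z n p q x (add_ind y E))"
    unfolding walk_gf_def sum_distrib_left
    by (intro sum.cong refl)
      (auto simp: moves_append_step nat_add_distrib moves_nonneg power_add mult.commute)
  finally show ?thesis .
qed

lemma walk_gf_Suc_p:
  assumes x: "strict_mono_on {1..n} x"
  shows "walk_gf z n (Suc p) 0 x y
    = (\<Sum>E | E \<subseteq> {1..n} \<and> strict_mono_on {1..n} (add_ind x E). z ^ card E * walk_gf z n p 0 (add_ind x E) y)"
  using walk_gf_Suc_q[OF x, of z 0 p y] by (simp add: walk_gf_reverse)

text \<open>Walkers are numbered from 1, rows of determinants from 0; the summation over sets of
  movers is carried across.\<close>

lemma sum_shift_index_set: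
  "(\<Sum>E | E \<subseteq> {1..n} \<and> strict_mono_on {1..n} (add_ind y E). z ^ card E * f (\<lambda>i. add_ind y E (Suc i)))
    = (\<Sum>E | E \<subseteq> {0..<n} \<and> strict_mono_on {0..<n} (add_ind (\<lambda>i. y (Suc i)) E).
        z ^ card E * f (add_ind (\<lambda>i. y (Suc i)) E))"
proof (rule sum.reindex_bij_witness[of _ "\<lambda>E. Suc ` E" "\<lambda>E. Suc -` E"])
  have ind: "(\<lambda>i. add_ind y E (Suc i)) = add_ind (\<lambda>i. y (Suc i)) (Suc -` E)" for E
    by (simp add: add_ind_def)
  have strict: "strict_mono_on {1..n} g \<longleftrightarrow> strict_mono_on {0..<n} (\<lambda>i. g (Suc i))" for g :: "nat \<Rightarrow> nat"
  proof
    assume g: "strict_mono_on {0..<n} (\<lambda>i. g (Suc i))"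
    show "strict_mono_on {1..n} g"
    proof (rule strict_mono_onI)
      fix r s assume "r \<in> {1..n}" "s \<in> {1..n}" "r < s"
      then show "g r < g s" using strict_mono_onD[OF g, of "r - 1" "s - 1"] by auto
    qed
  qed (auto simp: strict_mono_on_def)
  fix E
  {
    assume E: "E \<in> {E. E \<subseteq> {1..n} \<and> strict_mono_on {1..n} (add_ind y E)}"
    have im: "Suc ` (Suc -` E) = E"
    proof -
      have "e \<in> Suc ` (Suc -` E)" if "e \<in> E" for e using E that by (cases e) auto
      then show ?thesis by auto
    qed
    then show "Suc ` (Suc -` E) = E" .
    show "Suc -` E \<in> {E. E \<subseteq> {0..<n} \<and> strict_mono_on {0..<n} (add_ind (\<lambda>i. y (Suc i)) E)}"
    proof -
      have "strict_mono_on {0..<n} (\<lambda>i. add_ind y E (Suc i))" using E strict by blast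
      then show ?thesis using E by (auto simp: ind)
    qed
    have "card E = card (Suc -` E)" using card_image[of Suc "Suc -` E"] im by simp
    then show "z ^ card (Suc -` E) * f (add_ind (\<lambda>i. y (Suc i)) (Suc -` E)) = z ^ card E * f (\<lambda>i. add_ind y E (Suc i))"
      by (simp add: ind)
  }
  {
    assume E: "E \<in> {E. E \<subseteq> {0..<n} \<and> strict_mono_on {0..<n} (add_ind (\<lambda>i. y (Suc i)) E)}"
    show im: "Suc -` (Suc ` E) = E" by auto
    show "Suc ` E \<in> {E. E \<subseteq> {1..n} \<and> strict_mono_on {1..n} (add_ind y E)}"
    proof -
      have "strict_mono_on {0..<n} (\<lambda>i. add_ind y (Suc ` E) (Suc i))" using E by (simp add: ind im)
      then have "strict_mono_on {1..n} (add_ind y (Suc ` E))" using strict by blast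
      then show ?thesis using E by auto
    qed
  }
qed

lemma strict_mono_on_shift:
  assumes "strict_mono_on {1..n} (g :: nat \<Rightarrow> nat)"
  shows "strict_mono_on {0..<n} (\<lambda>i. g (Suc i))"
  using assms by (auto simp: strict_mono_on_def)

text \<open>Both sides satisfy the same recursion. Left steps are removed from the end, replacing
  \<open>y\<close> by \<open>add_ind y E\<close>, then right steps from the start in the same way
  for \<open>x\<close>. Without steps, the claim is orthonormality.\<close>

theorem walk_gf_eq_integral:
  fixes H :: "(complex^'n^'n) measure"
  assumes H: "normalized_haar H"
    and x: "strict_mono_on {1..CARD('n)} x" and y: "strict_mono_on {1..CARD('n)} y"
  shows "walk_gf z CARD('n) p q x y = walk_integral H z p q (\<lambda>i. x (Suc i)) (\<lambda>i. y (Suc i))"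
  using y
proof (induction q arbitrary: y)
  case 0
  from x show ?case
  proof (induction p arbitrary: x)
    case 0
    have "(\<forall>j\<in>{1..CARD('n)}. x j = y j) \<longleftrightarrow> (\<forall>i<CARD('n). x (Suc i) = y (Suc i))"
      by (metis (no_types, lifting) Suc_le_eq One_nat_def Suc_le_mono atLeastAtMost_iff le0 not0_implies_Suc not_one_le_zero)
    then show ?case
      using walk_gf_0[OF 0(1)] walk_integral_0[OF H strict_mono_on_shift strict_mono_on_shift] 0 \<open>strict_mono_on {1..CARD('n)} y\<close>
      by simp
  next
    case (Suc p)
    have "walk_gf z CARD('n) (Suc p) 0 x y
        = (\<Sum>E | E \<subseteq> {1..CARD('n)} \<and> strict_mono_on {1..CARD('n)} (add_ind x E).
            z ^ card E * walk_integral H z p 0 (\<lambda>i. add_ind x E (Suc i)) (\<lambda>i. y (Suc i)))"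
      unfolding walk_gf_Suc_p[OF Suc.prems] by (intro sum.cong refl) (simp add: Suc.IH)
    then show ?case
      unfolding sum_shift_index_set[where f = "\<lambda>x. walk_integral H z p 0 x (\<lambda>i. y (Suc i))"]
        walk_integral_Suc_p[OF H strict_mono_on_shift[OF Suc.prems]] .
  qed
next
  case (Suc q)
  have "walk_gf z CARD('n) p (Suc q) x y
      = (\<Sum>E | E \<subseteq> {1..CARD('n)} \<and> strict_mono_on {1..CARD('n)} (add_ind y E).
          z ^ card E * walk_integral H z p q (\<lambda>i. x (Suc i)) (\<lambda>i. add_ind y E (Suc i)))"
    unfolding walk_gf_Suc_q[OF Suc.prems] by (intro sum.cong refl) (simp add: Suc.IH)
  then show ?case
    unfolding sum_shift_index_set[where f = "\<lambda>y. walk_integral H z p q (\<lambda>i. x (Suc i)) y"]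
      walk_integral_Suc_q[OF H strict_mono_on_shift[OF Suc.prems]] .
qed

text \<open>Walks are grouped by their number of moves. Only finitely many \<open>k\<close> occur,
  and the factorial in \<open>b_coeff\<close> cancels.\<close>

lemma sums_walk_gf:
  "(\<lambda>k. z ^ k / fact k * of_nat (b_coeff n p q x y k)) sums walk_gf z n p q x y"
proof -
  let ?m = "\<lambda>w. nat (moves n (p + q) w)"
  let ?W = "walk_set n p q x y"
  have summand: "z ^ k / fact k * of_nat (b_coeff n p q x y k) = (\<Sum>w | w \<in> ?W \<and> ?m w = k. z ^ ?m w)" for k
  proof -
    have "walks n p q x y k = {w \<in> ?W. ?m w = k}"
      unfolding walks_eq using moves_nonneg[of n "p + q"] by auto
    then show ?thesis by (simp add: b_coeff_def)
  qed
  have "(\<lambda>k. \<Sum>w | w \<in> ?W \<and> ?m w = k. z ^ ?m w) sums (\<Sum>k\<in>?m ` ?W. \<Sum>w | w \<in> ?W \<and> ?m w = k. z ^ ?m w)"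
    by (rule sums_finite) (auto simp: finite_walk_set intro!: sum.neutral)
  also have "(\<Sum>k\<in>?m ` ?W. \<Sum>w | w \<in> ?W \<and> ?m w = k. z ^ ?m w) = walk_gf z n p q x y"
    unfolding walk_gf_def by (rule sum.image_gen[OF finite_walk_set, symmetric])
  finally show ?thesis by (simp only: summand)
qed

section \<open>Exponentials of linear forms\<close>

text \<open>Used with constant weight 1 for the total degree, and with \<open>var_index\<close> for
  the grading in which the \<open>i\<close>-th variable of either family has weight
  \<open>i\<close>.\<close>

definition weight_by :: "('v \<Rightarrow> nat) \<Rightarrow> ('v \<Rightarrow>\<^sub>0 nat) \<Rightarrow> nat" where
  "weight_by f a = (\<Sum>v\<in>Poly_Mapping.keys a. f v * Poly_Mapping.lookup a v)"

lemma weight_by_superset: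
  "finite S \<Longrightarrow> Poly_Mapping.keys a \<subseteq> S \<Longrightarrow> weight_by f a = (\<Sum>v\<in>S. f v * Poly_Mapping.lookup a v)"
  unfolding weight_by_def by (rule sum.mono_neutral_left) (auto simp: in_keys_iff)

lemma weight_by_add: "weight_by f (a + b) = weight_by f a + weight_by f b"
proof -
  let ?S = "Poly_Mapping.keys a \<union> Poly_Mapping.keys b"
  have "weight_by f (a + b) = (\<Sum>v\<in>?S. f v * Poly_Mapping.lookup (a + b) v)"
    by (rule weight_by_superset) (simp, rule Poly_Mapping.keys_add)
  then show ?thesis
    by (simp add: lookup_add distrib_left sum.distrib weight_by_superset[of ?S])
qed

lemma weight_by_single: "weight_by f (Poly_Mapping.single v k) = f v * k"
  by (simp add: weight_by_def)

lemma sub_single_add: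
  fixes a :: "'v \<Rightarrow>\<^sub>0 nat"
  assumes "v \<in> Poly_Mapping.keys a"
  shows "Poly_Mapping.single v 1 + (a - Poly_Mapping.single v 1) = a"
proof (rule poly_mapping_eqI)
  fix u
  show "Poly_Mapping.lookup (Poly_Mapping.single v 1 + (a - Poly_Mapping.single v 1)) u = Poly_Mapping.lookup a u"
    using assms by (cases "u = v") (auto simp: lookup_add lookup_minus lookup_single in_keys_iff)
qed

lemma weight_by_sub_single:
  assumes "v \<in> Poly_Mapping.keys a"
  shows "weight_by f a = f v + weight_by f (a - Poly_Mapping.single v 1)"
  using arg_cong[OF sub_single_add[OF assms], of "weight_by f"] by (simp only: weight_by_add weight_by_single mult_1_right)

lemma weight_by_eq_0_iff: "weight_by (\<lambda>_. 1) a = 0 \<longleftrightarrow> a = 0"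
  by (auto simp: weight_by_def in_keys_iff intro!: poly_mapping_eqI)

section \<open>Coefficient rules for formal series\<close>

lemma mcoeff_sum: "mcoeff (\<Sum>i\<in>I. f i) a = (\<Sum>i\<in>I. mcoeff (f i) a)"
  by (induction I rule: infinite_finite_induct) auto

lemma mcoeff_mconst_mult [simp]: "mcoeff (mconst c * (f :: 'a mfps)) a = c * mcoeff f a"
proof -
  have "mcoeff (mconst c * f) a = (\<Sum>(b, d)\<in>{(0 :: 'a \<Rightarrow>\<^sub>0 nat, a)}. mcoeff (mconst c) b * mcoeff f d)"
    unfolding mcoeff_mult
    by (rule sum.mono_neutral_right) (auto simp: finite_exponent_pairs mconst_def split: if_splits)
  then show ?thesis by (simp add: mconst_def)
qed

lemma mconst_mult: "mconst (c * d) = mconst c * mconst d"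
  by (rule mfps_eqI) (simp, simp add: mconst_def)

lemma mconst_add: "mconst (c + d) = mconst c + mconst d"
  by (rule mfps_eqI) (simp add: mconst_def)

lemma mconst_0: "mconst 0 = 0" and mconst_1: "mconst 1 = 1"
  by (auto intro!: mfps_eqI simp: mconst_def)

lemma mconst_uminus: "mconst (- c) = - mconst c"
  by (rule mfps_eqI) (simp add: mconst_def)

lemma mconst_sum: "mconst (\<Sum>i\<in>I. f i) = (\<Sum>i\<in>I. mconst (f i))"
  by (induction I rule: infinite_finite_induct) (simp_all add: mconst_0 mconst_add)

lemma mconst_prod: "mconst (\<Prod>i\<in>I. f i) = (\<Prod>i\<in>I. mconst (f i))"
  by (induction I rule: infinite_finite_induct) (simp_all add: mconst_1 mconst_mult)

lemma mconst_power: "mconst (c ^ k) = mconst c ^ k"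
  by (induction k) (simp_all add: mconst_1 mconst_mult)

lemma mconst_of_int: "mconst (of_int k) = of_int k"
proof -
  have nat: "mconst (of_nat m) = of_nat m" for m
    by (induction m) (simp_all add: mconst_0 mconst_1 mconst_add)
  show ?thesis by (cases k) (simp_all add: nat mconst_uminus mconst_add mconst_1 del: of_nat_Suc)
qed

lemma mcoeff_of_nat_mult [simp]: "mcoeff (of_nat m * f) a = of_nat m * mcoeff f a"
  by (induction m) (simp_all add: distrib_right)

lemma mcoeff_mvar_mult:
  "mcoeff (mvar v * f) a = (if v \<in> Poly_Mapping.keys a then mcoeff f (a - Poly_Mapping.single v 1) else 0)"
proof (cases "v \<in> Poly_Mapping.keys a")
  case True
  have "mcoeff (mvar v * f) a
      = (\<Sum>(b, d)\<in>{(Poly_Mapping.single v 1, a - Poly_Mapping.single v 1)}. mcoeff (mvar v) b * mcoeff f d)"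
    unfolding mcoeff_mult
    by (rule sum.mono_neutral_right)
      (auto simp: finite_exponent_pairs mvar_def sub_single_add[OF True, simplified] split: if_splits)
  then show ?thesis using True by (simp add: mvar_def)
next
  case False
  have "mcoeff (mvar v) b = 0" if "b + d = a" for b d
  proof -
    have "b \<noteq> Poly_Mapping.single v 1"
      using False that by (auto simp: in_keys_iff lookup_add lookup_single)
    then show ?thesis by (simp add: mvar_def)
  qed
  then show ?thesis using False by (auto simp: mcoeff_mult intro!: sum.neutral)
qed

text \<open>The coefficients of the exponential of the linear form with coefficients
  \<open>c\<close>.\<close>

definition exp_coeff :: "('v \<Rightarrow> complex) \<Rightarrow> ('v \<Rightarrow>\<^sub>0 nat) \<Rightarrow> complex" where
  "exp_coeff c a = (\<Prod>v\<in>Poly_Mapping.keys a. c v ^ Poly_Mapping.lookup a v / fact (Poly_Mapping.lookup a v))"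

definition exp_linear :: "('v \<Rightarrow> complex) \<Rightarrow> 'v mfps" where
  "exp_linear c = Abs_mfps (exp_coeff c)"

lemma exp_coeff_superset:
  assumes "finite S" "Poly_Mapping.keys a \<subseteq> S"
  shows "exp_coeff c a = (\<Prod>v\<in>S. c v ^ Poly_Mapping.lookup a v / fact (Poly_Mapping.lookup a v))"
  unfolding exp_coeff_def by (rule prod.mono_neutral_left) (use assms in \<open>auto simp: in_keys_iff\<close>)

text \<open>Coefficient form of the fact that the partial derivative in \<open>v\<close> multiplies
  the exponential by \<open>c v\<close>.\<close>

lemma exp_coeff_sub_single:
  assumes v: "v \<in> Poly_Mapping.keys a"
  shows "c v * exp_coeff c (a - Poly_Mapping.single v 1) = of_nat (Poly_Mapping.lookup a v) * exp_coeff c a"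
proof -
  let ?b = "a - Poly_Mapping.single v 1" and ?K = "Poly_Mapping.keys a"
  let ?g = "\<lambda>a v. c v ^ Poly_Mapping.lookup a v / fact (Poly_Mapping.lookup a v)"
  obtain m where m: "Poly_Mapping.lookup a v = Suc m" using v by (cases "Poly_Mapping.lookup a v") (auto simp: in_keys_iff)
  have sub: "Poly_Mapping.keys ?b \<subseteq> ?K" by (auto simp: in_keys_iff lookup_minus)
  have "exp_coeff c ?b = ?g ?b v * (\<Prod>u\<in>?K - {v}. ?g ?b u)"
    unfolding exp_coeff_superset[OF finite_keys sub] by (rule prod.remove) (use v in auto)
  also have "(\<Prod>u\<in>?K - {v}. ?g ?b u) = (\<Prod>u\<in>?K - {v}. ?g a u)"
    by (rule prod.cong) (auto simp: lookup_minus lookup_single)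
  finally have b: "exp_coeff c ?b = c v ^ m / fact m * (\<Prod>u\<in>?K - {v}. ?g a u)"
    using m by (simp add: lookup_minus lookup_single)
  have a: "exp_coeff c a = ?g a v * (\<Prod>u\<in>?K - {v}. ?g a u)"
    unfolding exp_coeff_def by (rule prod.remove) (use v in auto)
  have step: "c v * (c v ^ m / fact m) = of_nat (Suc m) * (c v ^ Suc m / fact (Suc m))"
    by (simp add: divide_simps del: of_nat_Suc)
  show ?thesis unfolding a b m mult.assoc[symmetric] by (simp only: step)
qed

text \<open>A sum over possibly infinitely many variables. Summing over the keys of \<open>a\<close>
  keeps each coefficient finite, and at a single variable \<open>v\<close> the only key is
  \<open>v\<close>.\<close>

definition linear_form :: "('v \<Rightarrow> complex) \<Rightarrow> 'v mfps" where
  "linear_form c = Abs_mfps (\<lambda>a. \<Sum>v\<in>Poly_Mapping.keys a. if a = Poly_Mapping.single v 1 then c v else 0)"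

lemma mcoeff_linear_form_mult:
  "mcoeff (linear_form c * f) a = (\<Sum>v\<in>Poly_Mapping.keys a. c v * mcoeff f (a - Poly_Mapping.single v 1))"
proof -
  have lf: "mcoeff (linear_form c) b * y = (\<Sum>v\<in>Poly_Mapping.keys a. c v * (mcoeff (mvar v) b * y))"
    if "b + d = a" for b d y
  proof (cases "\<exists>v. b = Poly_Mapping.single v 1")
    case True
    then obtain v where b: "b = Poly_Mapping.single v 1" by blast
    have v: "v \<in> Poly_Mapping.keys a" using that unfolding b by (auto simp: in_keys_iff lookup_add)
    have inj: "Poly_Mapping.single v 1 = Poly_Mapping.single u (1::nat) \<longleftrightarrow> u = v" for u
      by (metis lookup_single_eq lookup_single_not_eq zero_neq_one)
    have "mcoeff (linear_form c) b = c v"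
      unfolding b by (simp add: linear_form_def)
    moreover have "(\<Sum>u\<in>Poly_Mapping.keys a. c u * (mcoeff (mvar u) b * y)) = (\<Sum>u\<in>Poly_Mapping.keys a. if u = v then c v * y else 0)"
      unfolding b by (intro sum.cong refl) (auto simp: mvar_def inj[simplified])
    ultimately show ?thesis using v by simp
  next
    case False
    then show ?thesis by (auto simp: linear_form_def mvar_def)
  qed
  have "mcoeff (linear_form c * f) a
      = (\<Sum>(b, d)\<in>{(b, d). b + d = a}. \<Sum>v\<in>Poly_Mapping.keys a. c v * (mcoeff (mvar v) b * mcoeff f d))"
    unfolding mcoeff_mult by (intro sum.cong refl) (auto simp: lf)
  also have "\<dots> = (\<Sum>v\<in>Poly_Mapping.keys a. c v * mcoeff (mvar v * f) a)"
    unfolding mcoeff_mult sum_distrib_left case_prod_beta by (rule sum.swap)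
  also have "\<dots> = (\<Sum>v\<in>Poly_Mapping.keys a. c v * mcoeff f (a - Poly_Mapping.single v 1))"
    by (simp add: mcoeff_mvar_mult)
  finally show ?thesis .
qed

abbreviation total_degree :: "('v \<Rightarrow>\<^sub>0 nat) \<Rightarrow> nat" where
  "total_degree \<equiv> weight_by (\<lambda>_. 1)"

lemma exp_coeff_euler:
  "(\<Sum>v\<in>Poly_Mapping.keys a. c v * exp_coeff c (a - Poly_Mapping.single v 1)) = of_nat (total_degree a) * exp_coeff c a"
proof -
  have "(\<Sum>v\<in>Poly_Mapping.keys a. c v * exp_coeff c (a - Poly_Mapping.single v 1))
      = (\<Sum>v\<in>Poly_Mapping.keys a. of_nat (Poly_Mapping.lookup a v) * exp_coeff c a)"
    by (rule sum.cong[OF refl]) (rule exp_coeff_sub_single)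
  then show ?thesis by (simp add: weight_by_def sum_distrib_right)
qed

text \<open>The multinomial theorem, obtained from the Euler identity \<open>exp_coeff_euler\<close>
  instead of a count of words.\<close>

lemma mcoeff_linear_form_power:
  "mcoeff (linear_form c ^ k) a = (if total_degree a = k then fact k * exp_coeff c a else 0)"
proof (induction k arbitrary: a)
  case 0
  show ?case using weight_by_eq_0_iff[of a] by (auto simp: exp_coeff_def)
next
  case (Suc k)
  have "mcoeff (linear_form c ^ Suc k) a
      = (\<Sum>v\<in>Poly_Mapping.keys a. if total_degree a = Suc k then fact k * (c v * exp_coeff c (a - Poly_Mapping.single v 1)) else 0)"
    unfolding power_Suc mcoeff_linear_form_mult Suc.IH
  proof (rule sum.cong[OF refl])
    fix v assume "v \<in> Poly_Mapping.keys a"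
    from weight_by_sub_single[OF this, of "\<lambda>_. 1"]
    show "c v * (if total_degree (a - Poly_Mapping.single v 1) = k then fact k * exp_coeff c (a - Poly_Mapping.single v 1) else 0)
        = (if total_degree a = Suc k then fact k * (c v * exp_coeff c (a - Poly_Mapping.single v 1)) else 0)"
      by simp
  qed
  then show ?case
    by (simp add: sum_distrib_left[symmetric] exp_coeff_euler del: One_nat_def)
qed

lemma mexp_linear_form: "mexp (linear_form c) = exp_linear c"
proof (rule mfps_eqI)
  fix a :: "'a \<Rightarrow>\<^sub>0 nat"
  let ?f = "\<lambda>k. mcoeff ((1 / fact k) *\<^sub>R linear_form c ^ k) a"
  have f: "?f k = (if k = total_degree a then exp_coeff c a else 0)" for k
    by (simp add: mcoeff_linear_form_power scaleR_conv_of_real[where 'a = complex] del: One_nat_def)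
  have "mcoeff (mexp (linear_form c)) a = (\<Sum>k | ?f k \<noteq> 0. ?f k)"
    by (simp add: mexp_def msum_def)
  also have "\<dots> = (\<Sum>k\<in>{total_degree a}. if k = total_degree a then exp_coeff c a else 0)"
    unfolding f by (rule sum.mono_neutral_left) (auto split: if_splits)
  finally show "mcoeff (mexp (linear_form c)) a = mcoeff (exp_linear c) a"
    by (simp add: exp_linear_def)
qed

text \<open>The Euler equation expresses a coefficient of positive degree by coefficients of smaller
  degree.\<close>

lemma exp_coeff_unique:
  assumes "X 0 = 1"
    and "\<And>a. of_nat (total_degree a) * X a = (\<Sum>v\<in>Poly_Mapping.keys a. c v * X (a - Poly_Mapping.single v 1))"
  shows "X a = exp_coeff c a"
proof (induction "total_degree a" arbitrary: a rule: less_induct)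
  case less
  show ?case
  proof (cases "a = 0")
    case True
    then show ?thesis using assms(1) by (simp add: exp_coeff_def)
  next
    case False
    have "of_nat (total_degree a) * X a = of_nat (total_degree a) * exp_coeff c a"
      unfolding assms(2) exp_coeff_euler[symmetric]
    proof (rule sum.cong[OF refl])
      fix v assume "v \<in> Poly_Mapping.keys a"
      from weight_by_sub_single[OF this, of "\<lambda>_. 1"]
      show "c v * X (a - Poly_Mapping.single v 1) = c v * exp_coeff c (a - Poly_Mapping.single v 1)"
        by (simp add: less)
    qed
    then show ?thesis using False weight_by_eq_0_iff[of a] by simp
  qed
qed

text \<open>The Euler operator, which multiplies the coefficient at \<open>a\<close> by the degree of \<open>a\<close>, is a
  derivation.\<close>

lemma exp_linear_add: "exp_linear (\<lambda>v. c v + d v) = exp_linear c * exp_linear d"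
proof (rule mfps_eqI)
  fix a :: "'a \<Rightarrow>\<^sub>0 nat"
  let ?X = "mcoeff (exp_linear c * exp_linear d)"
  have euler: "linear_form c * exp_linear c = Abs_mfps (\<lambda>a. of_nat (total_degree a) * exp_coeff c a)" for c :: "'a \<Rightarrow> complex"
    by (rule mfps_eqI) (simp add: mcoeff_linear_form_mult exp_linear_def exp_coeff_euler del: One_nat_def)
  have "?X a = exp_coeff (\<lambda>v. c v + d v) a"
  proof (rule exp_coeff_unique)
    have "{(b, e). b + e = (0 :: 'a \<Rightarrow>\<^sub>0 nat)} = {(0, 0)}"
      by (auto simp: poly_mapping_eq_iff fun_eq_iff lookup_add)
    then show "?X 0 = 1" by (simp add: mcoeff_mult exp_linear_def exp_coeff_def)
    fix a :: "'a \<Rightarrow>\<^sub>0 nat"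
    have "of_nat (total_degree a) * ?X a
        = (\<Sum>(b, e)\<in>{(b, e). b + e = a}. of_nat (total_degree b) * exp_coeff c b * exp_coeff d e
            + exp_coeff c b * (of_nat (total_degree e) * exp_coeff d e))"
      unfolding mcoeff_mult sum_distrib_left
      by (intro sum.cong refl) (auto simp: exp_linear_def weight_by_add algebra_simps)
    also have "\<dots> = mcoeff (linear_form c * exp_linear c * exp_linear d + exp_linear c * (linear_form d * exp_linear d)) a"
      unfolding euler mcoeff_simps mcoeff_mult by (simp add: sum.distrib case_prod_beta exp_linear_def)
    also have "\<dots> = mcoeff (linear_form c * (exp_linear c * exp_linear d)) a + mcoeff (linear_form d * (exp_linear c * exp_linear d)) a"
      by (simp add: mult_ac)
    also have "\<dots> = (\<Sum>v\<in>Poly_Mapping.keys a. (c v + d v) * ?X (a - Poly_Mapping.single v 1))"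
      by (simp add: mcoeff_linear_form_mult sum.distrib distrib_right)
    finally show "of_nat (total_degree a) * ?X a = (\<Sum>v\<in>Poly_Mapping.keys a. (c v + d v) * ?X (a - Poly_Mapping.single v 1))" .
  qed
  then show "mcoeff (exp_linear (\<lambda>v. c v + d v)) a = ?X a" by (simp add: exp_linear_def)
qed

lemma exp_linear_zero: "exp_linear (\<lambda>_. 0) = 1"
proof (rule mfps_eqI)
  fix a :: "'a \<Rightarrow>\<^sub>0 nat"
  show "mcoeff (exp_linear (\<lambda>_. 0)) a = mcoeff 1 a"
    by (cases "a = 0") (auto simp: exp_linear_def exp_coeff_def in_keys_iff poly_mapping_eq_iff fun_eq_iff)
qed

lemma exp_linear_sum: "exp_linear (\<lambda>v. \<Sum>j\<in>J. c j v) = (\<Prod>j\<in>J. exp_linear (c j))"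
  by (induction J rule: infinite_finite_induct) (simp_all add: exp_linear_zero exp_linear_add)

section \<open>The Cauchy identity for formal variables\<close>

primrec var_index :: "ts_var \<Rightarrow> nat" where
  "var_index (T_var i) = i"
| "var_index (S_var i) = i"

abbreviation wt :: "(ts_var \<Rightarrow>\<^sub>0 nat) \<Rightarrow> nat" where
  "wt \<equiv> weight_by var_index"

text \<open>The part of weight \<open>m\<close> of an exponential. For suitable \<open>c\<close>
  these parts are the elementary Schur polynomials in the formal variables.\<close>

definition graded_exp :: "(ts_var \<Rightarrow> complex) \<Rightarrow> int \<Rightarrow> ts_var mfps" where
  "graded_exp c m = Abs_mfps (\<lambda>a. if int (wt a) = m then exp_coeff c a else 0)"

text \<open>Congruence modulo series of weight above \<open>K\<close>. It respects products because
  weights add.\<close>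

definition agree_upto :: "nat \<Rightarrow> ts_var mfps \<Rightarrow> ts_var mfps \<Rightarrow> bool" where
  "agree_upto K f g \<longleftrightarrow> (\<forall>a. wt a \<le> K \<longrightarrow> mcoeff f a = mcoeff g a)"

lemma agree_upto_refl: "agree_upto K f f"
  by (simp add: agree_upto_def)

lemma agree_upto_mult: "agree_upto K f g \<Longrightarrow> agree_upto K f' g' \<Longrightarrow> agree_upto K (f * f') (g * g')"
  unfolding agree_upto_def mcoeff_mult by (auto intro!: sum.cong simp: weight_by_add)

lemma agree_upto_prod: "(\<And>i. i \<in> I \<Longrightarrow> agree_upto K (f i) (g i)) \<Longrightarrow> agree_upto K (\<Prod>i\<in>I. f i) (\<Prod>i\<in>I. g i)"
  by (induction I rule: infinite_finite_induct) (auto intro: agree_upto_refl agree_upto_mult)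

lemma agree_upto_sum: "(\<And>i. i \<in> I \<Longrightarrow> agree_upto K (f i) (g i)) \<Longrightarrow> agree_upto K (\<Sum>i\<in>I. f i) (\<Sum>i\<in>I. g i)"
  by (auto simp: agree_upto_def mcoeff_sum intro: sum.cong)

lemma agree_upto_schur_det:
  "(\<And>k. agree_upto K (h k) (h' k)) \<Longrightarrow> agree_upto K (schur_det h n x) (schur_det h' n x)"
  unfolding schur_det_def detf_leibniz
  by (intro agree_upto_sum agree_upto_mult agree_upto_prod agree_upto_refl)

lemma exp_coeff_scale: "exp_coeff (\<lambda>v. c v * u ^ var_index v) a = exp_coeff c a * u ^ wt a"
  unfolding exp_coeff_def weight_by_def power_sum
  by (simp add: power_mult_distrib power_mult prod.distrib[symmetric])

lemma alternant_mconst: "alternant n (\<lambda>j. mconst (w j)) x = mconst (alternant n w x)"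
  by (simp add: alternant_def detf_leibniz mconst_sum mconst_mult mconst_prod mconst_power mconst_of_int)

text \<open>Comparing coefficients at \<open>a\<close>, only the parts of weight at most that of \<open>a\<close> matter, which
  makes the infinite sums over \<open>m\<close> finite.\<close>

lemma cauchy_identity:
  fixes w :: "nat \<Rightarrow> complex"
  assumes a: "wt a \<le> K"
  shows "exp_coeff (\<lambda>v. c v * power_sum n w (var_index v)) a
    = (\<Sum>x\<in>strict_seqs n (K + n). schur_det (complete_hom n w) n x * mcoeff (schur_det (graded_exp c) n x) a)"
proof (rule eq_of_eq_on_distinct[where n = n
      and f = "\<lambda>w. exp_coeff (\<lambda>v. c v * power_sum n w (var_index v)) a"
      and g = "\<lambda>w. \<Sum>x\<in>strict_seqs n (K + n). schur_det (complete_hom n w) n x * mcoeff (schur_det (graded_exp c) n x) a"])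
  fix w :: "nat \<Rightarrow> complex"
  assume "inj_on w {0..<n}"
  then have nz: "alternant n w (\<lambda>i. i) \<noteq> 0" by (rule alternant_nonzero)
  define h where "h k = (if int K < k then 0 else graded_exp c k)" for k
  have h: "agree_upto K (h k) (graded_exp c k)" for k
    by (auto simp: agree_upto_def h_def graded_exp_def)
  have factor: "agree_upto K (exp_linear (\<lambda>v. c v * w j ^ var_index v)) (\<Sum>m\<le>K. h (int m) * mconst (w j) ^ m)" for j
    unfolding agree_upto_def
  proof (intro allI impI)
    fix b assume b: "wt b \<le> K"
    have "mcoeff (\<Sum>m\<le>K. h (int m) * mconst (w j) ^ m) b = (\<Sum>m\<le>K. if m = wt b then exp_coeff c b * w j ^ m else 0)"
      unfolding mcoeff_sum
      by (rule sum.cong[OF refl])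
        (auto simp: h_def graded_exp_def mconst_power[symmetric] mult.commute[of _ "mconst _"])
    then show "mcoeff (exp_linear (\<lambda>v. c v * w j ^ var_index v)) b = mcoeff (\<Sum>m\<le>K. h (int m) * mconst (w j) ^ m) b"
      using b by (simp add: exp_linear_def exp_coeff_scale)
  qed
  \<comment> \<open>A power sum in the exponent splits the exponential into one factor per
    \<open>w j\<close>; by homogeneity that factor is the series of \<open>graded_exp c m\<close>
    times \<open>w j ^ m\<close>.\<close>
  have "exp_linear (\<lambda>v. c v * power_sum n w (var_index v)) = (\<Prod>j<n. exp_linear (\<lambda>v. c v * w j ^ var_index v))"
    by (simp add: power_sum_def sum_distrib_left exp_linear_sum)
  moreover have "agree_upto K \<dots> (\<Prod>j<n. \<Sum>m\<le>K. h (int m) * mconst (w j) ^ m)"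
    by (intro agree_upto_prod factor)
  ultimately have "exp_coeff (\<lambda>v. c v * power_sum n w (var_index v)) a = mcoeff (\<Prod>j<n. \<Sum>m\<le>K. h (int m) * mconst (w j) ^ m) a"
    using a by (auto simp: agree_upto_def exp_linear_def dest: arg_cong[where f = "\<lambda>f. mcoeff f a"])
  then have "alternant n w (\<lambda>i. i) * exp_coeff (\<lambda>v. c v * power_sum n w (var_index v)) a
      = mcoeff (alternant n (\<lambda>j. mconst (w j)) (\<lambda>i. i) * (\<Prod>j<n. \<Sum>m\<le>K. h (int m) * mconst (w j) ^ m)) a"
    by (simp add: alternant_mconst)
  also have "alternant n (\<lambda>j. mconst (w j)) (\<lambda>i. i) * (\<Prod>j<n. \<Sum>m\<le>K. h (int m) * mconst (w j) ^ m)
      = (\<Sum>x\<in>strict_seqs n (K + n). schur_det h n x * alternant n (\<lambda>j. mconst (w j)) x)"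
  proof (rule alternant_mult_prod)
    show "h k = 0" if "k < 0 \<or> int K < k" for k
      using that by (auto simp: h_def graded_exp_def intro!: mfps_eqI)
  qed
  also have "mcoeff \<dots> a = (\<Sum>x\<in>strict_seqs n (K + n). alternant n w x * mcoeff (schur_det h n x) a)"
    by (simp add: mcoeff_sum alternant_mconst mult.commute[of _ "mconst _"])
  also have "\<dots> = (\<Sum>x\<in>strict_seqs n (K + n). alternant n w x * mcoeff (schur_det (graded_exp c) n x) a)"
    using agree_upto_schur_det[of K h "graded_exp c" n, OF h] a by (simp add: agree_upto_def)
  also have "\<dots> = alternant n w (\<lambda>i. i)
      * (\<Sum>x\<in>strict_seqs n (K + n). schur_det (complete_hom n w) n x * mcoeff (schur_det (graded_exp c) n x) a)"
    unfolding sum_distrib_left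
  proof (rule sum.cong[OF refl])
    fix x
    show "alternant n w x * mcoeff (schur_det (graded_exp c) n x) a
        = alternant n w (\<lambda>i. i) * (schur_det (complete_hom n w) n x * mcoeff (schur_det (graded_exp c) n x) a)"
      by (subst jacobi_trudi) (simp only: mult_ac)
  qed
  finally show "exp_coeff (\<lambda>v. c v * power_sum n w (var_index v)) a
      = (\<Sum>x\<in>strict_seqs n (K + n). schur_det (complete_hom n w) n x * mcoeff (schur_det (graded_exp c) n x) a)"
    using nz by simp
next
  show "continuous_on UNIV (\<lambda>\<epsilon>. exp_coeff (\<lambda>v. c v * power_sum n (\<lambda>i. w i + of_nat i * \<epsilon>) (var_index v)) a)"
    unfolding exp_coeff_def power_sum_def by (intro continuous_intros) auto
  show "continuous_on UNIV (\<lambda>\<epsilon>. \<Sum>x\<in>strict_seqs n (K + n).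
      schur_det (complete_hom n (\<lambda>i. w i + of_nat i * \<epsilon>)) n x * mcoeff (schur_det (graded_exp c) n x) a)"
    by (intro continuous_intros continuous_on_schur_det_complete_hom)
qed

lemma exp_coeff_nonzeroD: "exp_coeff c a \<noteq> 0 \<Longrightarrow> v \<in> Poly_Mapping.keys a \<Longrightarrow> c v \<noteq> 0"
  by (auto simp: exp_coeff_def in_keys_iff)

text \<open>Both sides satisfy \<open>elem_schur_recursion\<close>, for the right-hand side because
  its factors, each index times the multiplicity of that variable, add up to the weight.
  \<open>c\<close> is 0 at \<open>\<iota> 0\<close> since \<open>elem_schur\<close> ignores that
  entry. The sign \<open>\<epsilon>\<close> is 1 for \<open>t\<close> and -1 for
  \<open>- s\<close>.\<close>

lemma elem_schur_variables:
  fixes \<iota> :: "nat \<Rightarrow> ts_var" and \<epsilon> :: complex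
  assumes \<iota>: "\<And>i. var_index (\<iota> i) = i"
  defines "c \<equiv> \<lambda>v. if \<exists>i\<ge>1. v = \<iota> i then \<epsilon> else 0"
  shows "elem_schur (\<lambda>i. mconst \<epsilon> * mvar (\<iota> i)) k = graded_exp c k"
proof (cases "k < 0")
  case True
  then show ?thesis by (auto simp: graded_exp_def intro!: mfps_eqI)
next
  case False
  have c: "c (\<iota> (Suc i)) = \<epsilon>" for i by (auto simp: c_def)
  have rec: "of_nat (Suc m) * graded_exp c (int (Suc m))
      = (\<Sum>i=0..m. of_nat (Suc i) * (mconst \<epsilon> * mvar (\<iota> (Suc i))) * graded_exp c (int (m - i)))" for m
  proof (rule mfps_eqI)
    fix a
    let ?G = "exp_coeff c a"
    have "mcoeff (\<Sum>i=0..m. of_nat (Suc i) * (mconst \<epsilon> * mvar (\<iota> (Suc i))) * graded_exp c (int (m - i))) a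
        = (\<Sum>i=0..m. if wt a = Suc m then of_nat (Suc i * Poly_Mapping.lookup a (\<iota> (Suc i))) * ?G else 0)"
      unfolding mcoeff_sum
    proof (rule sum.cong[OF refl])
      fix i assume i: "i \<in> {0..m}"
      let ?v = "\<iota> (Suc i)"
      show "mcoeff (of_nat (Suc i) * (mconst \<epsilon> * mvar ?v) * graded_exp c (int (m - i))) a
          = (if wt a = Suc m then of_nat (Suc i * Poly_Mapping.lookup a ?v) * ?G else 0)"
      proof (cases "?v \<in> Poly_Mapping.keys a")
        case True
        have "wt a = Suc i + wt (a - Poly_Mapping.single ?v 1)"
          using weight_by_sub_single[OF True, of var_index] by (simp only: \<iota>)
        then have "int (wt (a - Poly_Mapping.single ?v 1)) = int (m - i) \<longleftrightarrow> wt a = Suc m" using i by auto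
        then show ?thesis
          using exp_coeff_sub_single[OF True, of c] True
          unfolding mult.assoc mcoeff_of_nat_mult mcoeff_mconst_mult mcoeff_mvar_mult
          by (simp add: graded_exp_def c mult.assoc distrib_right del: One_nat_def)
      next
        case False
        then show ?thesis
          unfolding mult.assoc mcoeff_of_nat_mult mcoeff_mconst_mult mcoeff_mvar_mult
          by (simp add: in_keys_iff)
      qed
    qed
    also have "\<dots> = (if wt a = Suc m then of_nat (\<Sum>i=0..m. Suc i * Poly_Mapping.lookup a (\<iota> (Suc i))) * ?G else 0)"
      by (simp add: sum_distrib_right del: of_nat_mult of_nat_Suc mult_Suc)
    also have "\<dots> = (if wt a = Suc m then of_nat (Suc m) * ?G else 0)"
    \<comment> \<open>A nonzero \<open>?G\<close> confines \<open>a\<close> to variables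
      \<open>\<iota> i\<close> with \<open>i \<ge> 1\<close>, and the weight bounds \<open>i\<close>
      by \<open>m + 1\<close>. The sum then is the weight of \<open>a\<close>.\<close>
    proof (cases "wt a = Suc m \<and> ?G \<noteq> 0")
      case True
      have inj: "inj_on (\<lambda>i. \<iota> (Suc i)) {0..m}" by (rule inj_onI) (metis \<iota> Suc_inject)
      have "Poly_Mapping.keys a \<subseteq> (\<lambda>i. \<iota> (Suc i)) ` {0..m}"
      proof
        fix v assume v: "v \<in> Poly_Mapping.keys a"
        then have "c v \<noteq> 0" using exp_coeff_nonzeroD[of c a v] True by simp
        then obtain i where i: "1 \<le> i" "v = \<iota> i" by (auto simp: c_def split: if_splits)
        have "var_index v \<le> wt a" using weight_by_sub_single[OF v, of var_index] by linarith
        then have "i \<le> Suc m" using True by (simp add: i(2) \<iota>)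
        moreover obtain l where "i = Suc l" using i(1) by (cases i) auto
        ultimately show "v \<in> (\<lambda>i. \<iota> (Suc i)) ` {0..m}" using i(2) by auto
      qed
      then have "wt a = (\<Sum>v\<in>(\<lambda>i. \<iota> (Suc i)) ` {0..m}. var_index v * Poly_Mapping.lookup a v)"
        by (intro weight_by_superset) auto
      also have "\<dots> = (\<Sum>i=0..m. Suc i * Poly_Mapping.lookup a (\<iota> (Suc i)))"
        by (simp add: sum.reindex[OF inj] \<iota>)
      finally show ?thesis using True by simp
    qed auto
    finally show "mcoeff (of_nat (Suc m) * graded_exp c (int (Suc m))) a
        = mcoeff (\<Sum>i=0..m. of_nat (Suc i) * (mconst \<epsilon> * mvar (\<iota> (Suc i))) * graded_exp c (int (m - i))) a"
      unfolding mcoeff_of_nat_mult by (simp add: graded_exp_def del: of_nat_Suc)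
  qed
  have "elem_schur (\<lambda>i. mconst \<epsilon> * mvar (\<iota> i)) (int m) = graded_exp c (int m)" for m
  proof (induction m rule: less_induct)
    case (less m)
    show ?case
    proof (cases m)
      case 0
      have "graded_exp c 0 = 1"
      proof (rule mfps_eqI)
        fix a
        show "mcoeff (graded_exp c 0) a = mcoeff 1 a"
        proof (cases "a = 0 \<or> exp_coeff c a = 0")
          case False
          then have "Poly_Mapping.keys a \<noteq> {}" by simp
          then obtain v where v: "v \<in> Poly_Mapping.keys a" by blast
          then have "c v \<noteq> 0" using exp_coeff_nonzeroD[of c a v] False by simp
          then obtain i where "1 \<le> i" "v = \<iota> i" by (auto simp: c_def split: if_splits)
          then have "var_index v \<noteq> 0" by (simp add: \<iota>)
          then have "wt a \<noteq> 0" using weight_by_sub_single[OF v, of var_index] by linarith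
          then show ?thesis using False by (simp add: graded_exp_def)
        qed (auto simp: graded_exp_def exp_coeff_def weight_by_def)
      qed
      then show ?thesis using 0 by simp
    next
      case (Suc l)
      show ?thesis unfolding Suc
      proof (rule real_algebra_of_nat_cancel)
        show "of_nat (Suc l) * elem_schur (\<lambda>i. mconst \<epsilon> * mvar (\<iota> i)) (int (Suc l)) = of_nat (Suc l) * graded_exp c (int (Suc l))"
          unfolding rec elem_schur_recursion
          by (intro sum.cong refl arg_cong2[where f = "(*)"] less.IH) (simp add: Suc)
      qed
    qed
  qed
  from this[of "nat k"] False show ?thesis by simp
qed

lemma graded_exp_homogeneous: "mcoeff (graded_exp c m) a \<noteq> 0 \<Longrightarrow> int (wt a) = m"
  by (auto simp: graded_exp_def split: if_splits)

lemma mcoeff_prod_graded_exp: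
  "finite I \<Longrightarrow> mcoeff (\<Prod>i\<in>I. graded_exp c (m i)) a \<noteq> 0 \<Longrightarrow> int (wt a) = (\<Sum>i\<in>I. m i)"
proof (induction I arbitrary: a rule: finite_induct)
  case (insert i I)
  from insert.prems obtain b d where bd: "b + d = a"
    "mcoeff (graded_exp c (m i)) b * mcoeff (\<Prod>i\<in>I. graded_exp c (m i)) d \<noteq> 0"
    using insert.hyps by (auto simp: mcoeff_mult elim!: sum.not_neutral_contains_not_neutral)
  then have "int (wt b) = m i" "int (wt d) = (\<Sum>i\<in>I. m i)"
    using graded_exp_homogeneous insert.IH by auto
  then show ?case using bd insert.hyps by (auto simp: weight_by_add)
qed (auto simp: weight_by_def split: if_splits)

text \<open>A permutation of the columns does not change the sum of the indices, so all Leibniz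
  terms have the same weight; for \<open>x = shape n ka\<close> it is the size of
  \<open>ka\<close>.\<close>

lemma schur_det_graded_exp_homogeneous:
  assumes "mcoeff (schur_det (graded_exp c) n x) a \<noteq> 0"
  shows "int (wt a) = (\<Sum>i=0..<n. int (x i) - int i)"
proof -
  have "mcoeff (of_int k * f) a = of_int k * mcoeff f a" for k and f :: "ts_var mfps"
    by (simp add: mconst_of_int[symmetric])
  then obtain p where p: "p permutes {0..<n}" "mcoeff (\<Prod>i=0..<n. graded_exp c (int (x i) - int (p i))) a \<noteq> 0"
    using assms unfolding schur_det_def detf_leibniz mcoeff_sum
    by (auto elim!: sum.not_neutral_contains_not_neutral)
  have "int (wt a) = (\<Sum>i=0..<n. int (x i) - int (p i))"
    by (rule mcoeff_prod_graded_exp[OF _ p(2)]) simp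
  also have "\<dots> = (\<Sum>i=0..<n. int (x i)) - (\<Sum>i=0..<n. int (p i))" by (rule sum_subtractf)
  also have "(\<Sum>i=0..<n. int (p i)) = (\<Sum>i=0..<n. int i)"
    using sum.permute[OF p(1), of int] by (simp add: o_def)
  finally show ?thesis by (simp add: sum_subtractf)
qed

section \<open>Partitions and strictly increasing sequences\<close>

lemma partition_antimono:
  assumes "is_partition ka" "1 \<le> i" "i \<le> j"
  shows "ka j \<le> ka i"
  using assms(3)
proof (induction j rule: dec_induct)
  case (step j)
  have "ka (j + 1) \<le> ka j" using assms(1,2) step.hyps(1) by (simp add: is_partition_def)
  then show ?case using step.IH by simp
qed simp

lemma partition_rows:
  assumes ka: "is_partition ka" and "1 \<le> i"
  shows "ka i \<noteq> 0 \<longleftrightarrow> i \<le> num_rows ka"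
proof -
  let ?S = "{i. 1 \<le> i \<and> ka i \<noteq> 0}"
  have fin: "finite ?S" using ka by (auto simp: is_partition_def intro: finite_subset[of _ "{i. ka i \<noteq> 0}"])
  have down: "j \<in> ?S" if "i \<in> ?S" "1 \<le> j" "j \<le> i" for i j
    using partition_antimono[OF ka, of j i] that by auto
  have "?S = {1..num_rows ka}"
  proof (cases "?S = {}")
    case True
    then show ?thesis unfolding num_rows_def by (simp only: card.empty) simp
  next
    case False
    have "Max ?S \<in> ?S" using Max_in[OF fin False] .
    then have "?S = {1..Max ?S}" using down Max_ge[OF fin] by (intro subset_antisym subsetI) (auto intro: Max_ge[OF fin])
    then have "num_rows ka = Max ?S" unfolding num_rows_def by (metis card_atLeastAtMost diff_Suc_1 One_nat_def)
    with \<open>?S = {1..Max ?S}\<close> show ?thesis by simp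
  qed
  then have "i \<in> ?S \<longleftrightarrow> i \<in> {1..num_rows ka}" by (simp only:)
  then show ?thesis using assms(2) by simp
qed

text \<open>With \<open>i = j - 1\<close> this is the position \<open>x j\<close> of the theorem:
  the parts in increasing order plus a staircase.\<close>

definition shape :: "nat \<Rightarrow> (nat \<Rightarrow> nat) \<Rightarrow> nat \<Rightarrow> nat" where
  "shape n ka i = ka (n - i) + i"

lemma detf_Suc:
  assumes "\<And>j. j < m \<Longrightarrow> f m j = 0" "f m m = 1"
  shows "detf (Suc m) f = detf m f"
proof -
  let ?A = "Matrix.mat (Suc m) (Suc m) (\<lambda>(i, j). f i j)"
  have "detf (Suc m) f = (\<Sum>j<Suc m. ?A $$ (m, j) * cofactor ?A m j)"
    unfolding detf_def by (rule laplace_expansion_row) auto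
  also have "\<dots> = cofactor ?A m m" using assms by simp
  also have "\<dots> = Determinant.det (mat_delete ?A m m)"
    by (simp add: Determinant.cofactor_def)
  also have "mat_delete ?A m m = Matrix.mat m m (\<lambda>(i, j). f i j)"
    by (rule eq_matI) (auto simp: mat_delete_def)
  finally show ?thesis by (simp add: detf_def)
qed

lemma detf_reverse: "detf n (\<lambda>i j. f (n - 1 - i) (n - 1 - j)) = detf n f"
proof -
  define p where "p i = (if i < n then n - 1 - i else i)" for i
  have "bij_betw p {0..<n} {0..<n}"
    by (rule bij_betw_byWitness[where f' = p]) (auto simp: p_def)
  then have p: "p permutes {0..<n}" by (rule bij_imp_permutes) (simp add: p_def)
  have "detf n (\<lambda>i j. f (n - 1 - i) (n - 1 - j)) = detf n (\<lambda>i j. f (p i) (p j))"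
    by (rule detf_cong) (simp add: p_def)
  also have "\<dots> = signof p * detf n (\<lambda>i j. f j (p i))"
    unfolding detf_permute_rows[OF p, of "\<lambda>i j. f i (p j)"]
    by (simp add: detf_transpose[of n "\<lambda>i j. f i (p j)"])
  also have "\<dots> = signof p * (signof p * detf n f)"
    unfolding detf_permute_rows[OF p, of "\<lambda>i j. f j i"] by (simp add: detf_transpose[of n f])
  also have "\<dots> = detf n f" by (simp add: sign_def)
  finally show ?thesis .
qed

text \<open>The determinant of size \<open>num_rows ka\<close> is padded to size \<open>n\<close>,
  and its rows and columns are reversed.\<close>

lemma schur_eq_schur_det:
  fixes t :: "nat \<Rightarrow> 'a::{comm_ring_1,real_algebra_1}"
  assumes ka: "is_partition ka" and n: "num_rows ka \<le> n"
  shows "schur ka t = schur_det (elem_schur t) n (shape n ka)"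
proof -
  define f where "f i j = elem_schur t (int (ka (i + 1)) - int i + int j)" for i j
  \<comment> \<open>A padded row \<open>m\<close> belongs to a part 0. It vanishes left of the
    diagonal, where the index is negative, and has 1 on the diagonal.\<close>
  have "detf n f = detf (num_rows ka) f"
    using n
  proof (induction n rule: dec_induct)
    case (step m)
    have "ka (m + 1) = 0" using partition_rows[OF ka, of "m + 1"] step.hyps by auto
    then have "detf (Suc m) f = detf m f" by (intro detf_Suc) (auto simp: f_def)
    then show ?case using step.IH by simp
  qed simp
  moreover have "schur_det (elem_schur t) n (shape n ka) = detf n (\<lambda>i j. f (n - 1 - i) (n - 1 - j))"
    unfolding schur_det_def
  proof (rule detf_cong)
    fix i j assume "i < n" "j < n"
    then have "n - 1 - i + 1 = n - i" "int (n - 1 - i) = int n - 1 - int i" "int (n - 1 - j) = int n - 1 - int j" by auto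
    then show "elem_schur t (int (shape n ka i) - int j) = f (n - 1 - i) (n - 1 - j)"
      by (simp add: f_def shape_def algebra_simps)
  qed
  moreover have "schur ka t = detf (num_rows ka) f" by (simp add: schur_def detf_def f_def)
  ultimately show ?thesis by (simp only: detf_reverse)
qed

definition bounded_partitions :: "nat \<Rightarrow> nat \<Rightarrow> (nat \<Rightarrow> nat) set" where
  "bounded_partitions n K = {ka. is_partition ka \<and> num_rows ka \<le> n \<and> (\<forall>i. ka i \<le> K)}"

lemma strict_mono_on_add_le:
  assumes "strict_mono_on {0..<n} (x :: nat \<Rightarrow> nat)" "i + d < n"
  shows "x i + d \<le> x (i + d)"
  using assms(2)
proof (induction d)
  case (Suc d)
  have "x (i + d) < x (i + Suc d)" using assms(1) Suc.prems by (auto simp: strict_mono_on_def)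
  then show ?case using Suc by simp
qed simp

lemma shape_strict_mono:
  assumes "is_partition ka"
  shows "strict_mono_on {0..<n} (shape n ka)"
proof (rule strict_mono_onI)
  fix r s assume "r \<in> {0..<n}" "s \<in> {0..<n}" "r < s"
  then have "r < s" "1 \<le> n - s" "n - s \<le> n - r" by auto
  then show "shape n ka r < shape n ka s"
    using partition_antimono[OF assms, of "n - s" "n - r"] by (simp add: shape_def)
qed

text \<open>A bound \<open>K\<close> on the parts corresponds to the bound \<open>K + n\<close> on
  the positions used by Cauchy--Binet.\<close>

lemma bij_betw_shape:
  "bij_betw (\<lambda>ka. restrict (shape n ka) {0..<n}) (bounded_partitions n K) (strict_seqs n (K + n))"
proof (rule bij_betw_byWitness[where f' = "\<lambda>x j. if 1 \<le> j \<and> j \<le> n then x (n - j) - (n - j) else 0"])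
  show "\<forall>ka\<in>bounded_partitions n K.
      (\<lambda>j. if 1 \<le> j \<and> j \<le> n then restrict (shape n ka) {0..<n} (n - j) - (n - j) else 0) = ka"
  proof
    fix ka assume ka: "ka \<in> bounded_partitions n K"
    show "(\<lambda>j. if 1 \<le> j \<and> j \<le> n then restrict (shape n ka) {0..<n} (n - j) - (n - j) else 0) = ka"
    proof
      fix j
      have "ka j = 0" if "\<not> (1 \<le> j \<and> j \<le> n)"
      proof (cases "j = 0")
        case True
        then show ?thesis using ka by (simp add: bounded_partitions_def is_partition_def)
      next
        case False
        then have "\<not> j \<le> num_rows ka" using ka that by (auto simp: bounded_partitions_def)
        then show ?thesis using partition_rows[of ka j] ka False by (auto simp: bounded_partitions_def)
      qed
      then show "(if 1 \<le> j \<and> j \<le> n then restrict (shape n ka) {0..<n} (n - j) - (n - j) else 0) = ka j"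
        by (auto simp: shape_def)
    qed
  qed
  \<comment> \<open>So the subtraction in the inverse map is never truncated at 0.\<close>
  have ge: "i \<le> x i" if "x \<in> strict_seqs n (K + n)" "i < n" for x i
    using strict_mono_on_add_le[of n x 0 i] that by (auto simp: strict_seqs_def)
  show "\<forall>x\<in>strict_seqs n (K + n).
      restrict (shape n (\<lambda>j. if 1 \<le> j \<and> j \<le> n then x (n - j) - (n - j) else 0)) {0..<n} = x"
  proof
    fix x assume x: "x \<in> strict_seqs n (K + n)"
    show "restrict (shape n (\<lambda>j. if 1 \<le> j \<and> j \<le> n then x (n - j) - (n - j) else 0)) {0..<n} = x"
    proof
      fix i
      have "x i = undefined" if "\<not> i < n" using x that by (auto simp: strict_seqs_def PiE_def extensional_def)
      then show "restrict (shape n (\<lambda>j. if 1 \<le> j \<and> j \<le> n then x (n - j) - (n - j) else 0)) {0..<n} i = x i"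
        using ge[OF x, of i] by (auto simp: shape_def)
    qed
  qed
  show "(\<lambda>ka. restrict (shape n ka) {0..<n}) ` bounded_partitions n K \<subseteq> strict_seqs n (K + n)"
  proof (rule image_subsetI)
    fix ka assume ka: "ka \<in> bounded_partitions n K"
    have "shape n ka i < K + n" if "i < n" for i
      using ka that by (auto simp: bounded_partitions_def shape_def intro: add_le_less_mono)
    moreover have "strict_mono_on {0..<n} (restrict (shape n ka) {0..<n})"
      using shape_strict_mono[of ka n] ka by (auto simp: bounded_partitions_def strict_mono_on_def)
    ultimately show "restrict (shape n ka) {0..<n} \<in> strict_seqs n (K + n)"
      by (auto simp: strict_seqs_def)
  qed
  show "(\<lambda>x j. if 1 \<le> j \<and> j \<le> n then x (n - j) - (n - j) else 0) ` strict_seqs n (K + n) \<subseteq> bounded_partitions n K"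
  proof (rule image_subsetI)
    fix x assume x: "x \<in> strict_seqs n (K + n)"
    then have mono: "strict_mono_on {0..<n} x" by (simp add: strict_seqs_def)
    define ka where "ka = (\<lambda>j. if 1 \<le> j \<and> j \<le> n then x (n - j) - (n - j) else 0)"
    have "ka (i + 1) \<le> ka i" if "1 \<le> i" for i
    proof (cases "i + 1 \<le> n")
      case True
      have "x (n - (i + 1)) + 1 \<le> x (n - (i + 1) + 1)"
        using that True by (intro strict_mono_on_add_le[OF mono]) auto
      moreover have "n - (i + 1) + 1 = n - i" using True by simp
      ultimately show ?thesis using that True by (simp add: ka_def)
    qed (simp add: ka_def)
    moreover have "finite {i. ka i \<noteq> 0}"
      by (rule finite_subset[of _ "{..n}"]) (auto simp: ka_def)
    moreover have "ka 0 = 0" by (simp add: ka_def)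
    ultimately have part: "is_partition ka" unfolding is_partition_def by blast
    have "num_rows ka \<le> n"
    proof -
      have "num_rows ka \<le> card {1..n}"
        unfolding num_rows_def by (rule card_mono) (auto simp: ka_def)
      then show ?thesis by simp
    qed
    moreover have "ka i \<le> K" for i
    proof (cases "1 \<le> i \<and> i \<le> n")
      case True
      \<comment> \<open>Comparison with the last position, which is at most \<open>K + n - 1\<close>
        and lies \<open>i - 1\<close> places further on, bounds part \<open>i\<close> by
        \<open>K\<close>.\<close>
      have "x (n - i) + (i - 1) \<le> x (n - i + (i - 1))"
        using True by (intro strict_mono_on_add_le[OF mono]) auto
      moreover have "n - i + (i - 1) = n - 1" using True by simp
      moreover have "x (n - 1) < K + n" using x True by (auto simp: strict_seqs_def)
      ultimately show ?thesis using True by (simp add: ka_def)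
    qed (auto simp: ka_def)
    ultimately show "(\<lambda>j. if 1 \<le> j \<and> j \<le> n then x (n - j) - (n - j) else 0) \<in> bounded_partitions n K"
      using part by (simp add: bounded_partitions_def ka_def)
  qed
qed

section \<open>The main theorem\<close>

lemma trace_exponent_linear_form:
  fixes M :: "complex^'n^'n"
  shows "trace_exponent M = linear_form (\<lambda>v. case v of
      T_var i \<Rightarrow> if i = 0 then 0 else trace (matpow M i)
    | S_var i \<Rightarrow> if i = 0 then 0 else - trace (matpow (mat_conj M) i))"
  (is "_ = linear_form ?c")
proof (rule mfps_eqI)
  fix a :: "ts_var \<Rightarrow>\<^sub>0 nat"
  let ?f = "\<lambda>i. trace (map_matrix (\<lambda>c. t_var i * mconst c) (matpow M i)
      - map_matrix (\<lambda>c. s_var i * mconst c) (matpow (mat_conj M) i))"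
  have f: "mcoeff (?f i) a = (if a = Poly_Mapping.single (T_var i) 1 then trace (matpow M i) else 0)
      - (if a = Poly_Mapping.single (S_var i) 1 then trace (matpow (mat_conj M) i) else 0)" for i
  proof -
    have "?f i = mconst (trace (matpow M i)) * t_var i - mconst (trace (matpow (mat_conj M) i)) * s_var i"
      by (simp add: trace_def sum_subtractf mconst_sum sum_distrib_left mult.commute)
    then show ?thesis by (simp add: mvar_def)
  qed
  have inj: "Poly_Mapping.single u 1 = Poly_Mapping.single v (1::nat) \<longleftrightarrow> u = v" for u v :: ts_var
    by (metis lookup_single_eq lookup_single_not_eq zero_neq_one)
  have lin: "mcoeff (linear_form ?c) (Poly_Mapping.single v 1) = ?c v" for v
    by (simp add: linear_form_def)
  have "mcoeff (trace_exponent M) a = (\<Sum>i | i \<in> {1..} \<and> mcoeff (?f i) a \<noteq> 0. mcoeff (?f i) a)"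
    by (simp add: trace_exponent_def msum_def)
  also have "\<dots> = mcoeff (linear_form ?c) a"
  proof (cases "\<exists>v. a = Poly_Mapping.single v 1")
    case True
    then obtain v where a: "a = Poly_Mapping.single v 1" by blast
    have f': "mcoeff (?f i) a = (if i = var_index v then case v of T_var i \<Rightarrow> trace (matpow M i)
        | S_var i \<Rightarrow> - trace (matpow (mat_conj M) i) else 0)" for i
      unfolding a f[unfolded a] inj by (cases v) auto
    have "(\<Sum>i | i \<in> {1..} \<and> mcoeff (?f i) a \<noteq> 0. mcoeff (?f i) a) = (\<Sum>i\<in>{var_index v} \<inter> {1..}. mcoeff (?f i) a)"
      by (rule sum.mono_neutral_left) (auto simp: f' split: if_splits)
    also have "\<dots> = ?c v"
      unfolding f' by (cases v) auto
    finally show ?thesis unfolding a lin .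
  next
    case False
    then have z: "mcoeff (?f i) a = 0" for i unfolding f by auto
    have "mcoeff (linear_form ?c) a = 0" using False by (auto simp: linear_form_def)
    then show ?thesis by (simp only: z) simp
  qed
  finally show "mcoeff (trace_exponent M) a = mcoeff (linear_form ?c) a" .
qed

definition t_ind :: "ts_var \<Rightarrow> complex" where
  "t_ind v = (if \<exists>i\<ge>1. v = T_var i then 1 else 0)"

definition s_ind :: "ts_var \<Rightarrow> complex" where
  "s_ind v = (if \<exists>i\<ge>1. v = S_var i then - 1 else 0)"

lemma t_ind_simps [simp]: "t_ind (T_var i) = (if i = 0 then 0 else 1)" "t_ind (S_var i) = 0"
  by (auto simp: t_ind_def)

lemma s_ind_simps [simp]: "s_ind (S_var i) = (if i = 0 then 0 else - 1)" "s_ind (T_var i) = 0"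
  by (auto simp: s_ind_def)

lemma elem_schur_t_var: "elem_schur t_var = graded_exp t_ind"
proof
  fix k
  have "elem_schur (\<lambda>i. mconst 1 * mvar (T_var i)) k = graded_exp t_ind k"
    unfolding t_ind_def by (rule elem_schur_variables) simp
  then show "elem_schur t_var k = graded_exp t_ind k" by (simp add: mconst_1)
qed

lemma elem_schur_s_var: "elem_schur (\<lambda>i. - s_var i) = graded_exp s_ind"
proof
  fix k
  have "elem_schur (\<lambda>i. mconst (- 1) * mvar (S_var i)) k = graded_exp s_ind k"
    unfolding s_ind_def by (rule elem_schur_variables) simp
  then show "elem_schur (\<lambda>i. - s_var i) k = graded_exp s_ind k" by (simp add: mconst_1 mconst_uminus)
qed

lemma mexp_trace_exponent:
  fixes M :: "complex^'n^'n"
  shows "mexp (trace_exponent M) =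
    exp_linear (\<lambda>v. t_ind v * trace (matpow M (var_index v))) *
    exp_linear (\<lambda>v. s_ind v * trace (matpow (mat_conj M) (var_index v)))"
proof -
  have "(\<lambda>v. case v of T_var i \<Rightarrow> if i = 0 then 0 else trace (matpow M i)
      | S_var i \<Rightarrow> if i = 0 then 0 else - trace (matpow (mat_conj M) i))
    = (\<lambda>v. t_ind v * trace (matpow M (var_index v)) + s_ind v * trace (matpow (mat_conj M) (var_index v)))"
    by (rule ext) (simp split: ts_var.split)
  then show ?thesis
    by (simp only: trace_exponent_linear_form mexp_linear_form exp_linear_add)
qed

lemma cauchy_identity_trace:
  fixes M :: "complex^'n^'n"
  assumes "wt a \<le> K"
  shows "exp_coeff (\<lambda>v. c v * trace (matpow M (var_index v))) a
    = (\<Sum>x\<in>strict_seqs CARD('n) (K + CARD('n)). schur_of M x * mcoeff (schur_det (graded_exp c) CARD('n) x) a)"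
proof -
  obtain w :: "nat \<Rightarrow> complex" where
    w: "\<And>f :: complex^'n^'n \<Rightarrow> complex. continuous_on UNIV f \<Longrightarrow> class_fun f \<Longrightarrow> f M = f (diag_seq w)"
    using eigenvalues[of M] by metis
  have "trace (matpow M i) = power_sum CARD('n) w i" for i
    using w[OF polynomial_mat_continuous[OF polynomial_mat_trace_matpow] trace_matpow_class]
    by (simp add: trace_matpow_diag_seq)
  moreover have "trace_schur M = complete_hom CARD('n) w"
    by (rule trace_schur_eigenvalues) (rule w)
  ultimately show ?thesis
    using cauchy_identity[OF assms, of c "CARD('n)" w] by simp
qed

lemma det_weight_eq: "det_weight p q z M = det_one_plus z M ^ p * det_one_plus z (mat_conj M) ^ q"
  by (simp add: det_weight_def det_one_plus_def)

lemma schur_mat_eq: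
  fixes M :: "complex^'n^'n"
  assumes "is_partition ka" "num_rows ka \<le> CARD('n)"
  shows "schur_mat ka M = schur_of M (shape CARD('n) ka)"
  unfolding schur_mat_def trace_schur_def by (rule schur_eq_schur_det[OF assms])

lemma a_coeff_eq:
  fixes H :: "(complex^'n^'n) measure"
  assumes "is_partition ka" "num_rows ka \<le> CARD('n)" "is_partition nu" "num_rows nu \<le> CARD('n)"
  shows "a_coeff H p q ka nu z = walk_integral H z p q (shape CARD('n) ka) (shape CARD('n) nu)"
  unfolding a_coeff_def walk_integral_def using assms by (simp add: schur_mat_eq det_weight_eq)

lemma walk_integral_cong:
  fixes H :: "(complex^'n^'n) measure"
  assumes "\<And>i. i < CARD('n) \<Longrightarrow> x i = x' i" "\<And>i. i < CARD('n) \<Longrightarrow> y i = y' i"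
  shows "walk_integral H z p q x y = walk_integral H z p q x' y'"
proof -
  have "schur_of M x = schur_of M x'" "schur_of M y = schur_of M y'" for M :: "complex^'n^'n"
    using assms by (auto intro: schur_det_cong)
  then show ?thesis by (simp add: walk_integral_def)
qed

text \<open>At a fixed monomial, the Cauchy identities in \<open>t\<close> and in \<open>s\<close>
  are finite sums, so they can be exchanged with the integral.\<close>

lemma mintegral_coeff:
  fixes H :: "(complex^'n^'n) measure"
  assumes H: "normalized_haar H" and K: "wt a \<le> K"
  defines "X \<equiv> strict_seqs CARD('n) (K + CARD('n))"
  shows "mcoeff (mintegral H (\<lambda>M. mconst (det_weight p q z M) * mexp (trace_exponent M))) a
    = (\<Sum>x\<in>X. \<Sum>y\<in>X. walk_integral H z p q x y
        * mcoeff (schur_det (elem_schur t_var) CARD('n) x * schur_det (elem_schur (\<lambda>i. - s_var i)) CARD('n) y) a)"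
proof -
  let ?S = "schur_det (graded_exp t_ind) CARD('n)" and ?S' = "schur_det (graded_exp s_ind) CARD('n)"
  let ?P = "{(b, d). b + d = a}"
  have expand: "mcoeff (mexp (trace_exponent M)) a
      = (\<Sum>x\<in>X. \<Sum>y\<in>X. schur_of M x * schur_of (mat_conj M) y * mcoeff (?S x * ?S' y) a)" for M :: "complex^'n^'n"
  proof -
    have "mcoeff (mexp (trace_exponent M)) a
        = (\<Sum>(b, d)\<in>?P. (\<Sum>x\<in>X. schur_of M x * mcoeff (?S x) b) * (\<Sum>y\<in>X. schur_of (mat_conj M) y * mcoeff (?S' y) d))"
      unfolding mexp_trace_exponent mcoeff_mult
    proof (rule sum.cong[OF refl], clarify)
      fix b d assume "a = b + d"
      then have "wt b \<le> K" "wt d \<le> K" using K by (simp_all add: weight_by_add)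
      then show "mcoeff (exp_linear (\<lambda>v. t_ind v * trace (matpow M (var_index v)))) b *
          mcoeff (exp_linear (\<lambda>v. s_ind v * trace (matpow (mat_conj M) (var_index v)))) d
        = (\<Sum>x\<in>X. schur_of M x * mcoeff (?S x) b) * (\<Sum>y\<in>X. schur_of (mat_conj M) y * mcoeff (?S' y) d)"
        by (simp add: exp_linear_def cauchy_identity_trace X_def)
    qed
    also have "\<dots> = (\<Sum>r\<in>?P. \<Sum>x\<in>X. \<Sum>y\<in>X. schur_of M x * schur_of (mat_conj M) y * (mcoeff (?S x) (fst r) * mcoeff (?S' y) (snd r)))"
      by (simp add: sum_product case_prod_beta mult_ac)
    also have "\<dots> = (\<Sum>x\<in>X. \<Sum>y\<in>X. \<Sum>r\<in>?P. schur_of M x * schur_of (mat_conj M) y * (mcoeff (?S x) (fst r) * mcoeff (?S' y) (snd r)))"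
      by (subst sum.swap, rule sum.cong[OF refl], rule sum.swap)
    also have "\<dots> = (\<Sum>x\<in>X. \<Sum>y\<in>X. schur_of M x * schur_of (mat_conj M) y * mcoeff (?S x * ?S' y) a)"
      by (simp add: mcoeff_mult sum_distrib_left case_prod_beta)
    finally show ?thesis .
  qed
  let ?d = "\<lambda>M. det_one_plus z M ^ p * det_one_plus z (mat_conj M) ^ q"
  have int: "integrable H (\<lambda>M. schur_of M x * schur_of (mat_conj M) y * ?d M)" for x y
    by (rule walk_integrand_integrable[OF H])
  have "mcoeff (mintegral H (\<lambda>M. mconst (det_weight p q z M) * mexp (trace_exponent M))) a
      = (\<integral>M. (\<Sum>x\<in>X. \<Sum>y\<in>X. schur_of M x * schur_of (mat_conj M) y * ?d M * mcoeff (?S x * ?S' y) a) \<partial>H)"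
    unfolding mintegral_def mcoeff_Abs mcoeff_mconst_mult det_weight_eq expand sum_distrib_left
    by (simp only: mult_ac)
  also have "\<dots> = (\<Sum>x\<in>X. \<Sum>y\<in>X. walk_integral H z p q x y * mcoeff (?S x * ?S' y) a)"
    unfolding walk_integral_def using int
    by (subst Bochner_Integration.integral_sum, simp)+ simp
  finally show ?thesis by (simp only: elem_schur_t_var elem_schur_s_var)
qed

text \<open>Homogeneity: a partition contributing at a monomial has size equal to the weight of a
  divisor of it. This bounds all parts and yields the finiteness required by
  \<open>has_msum\<close>.\<close>

lemma schur_mult_coeff_bound:
  assumes ka: "is_partition ka" "num_rows ka \<le> n" and nu: "is_partition nu" "num_rows nu \<le> n"
    and nz: "mcoeff (schur ka t_var * schur nu (\<lambda>i. - s_var i)) a \<noteq> 0"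
  shows "ka \<in> bounded_partitions n (wt a)" "nu \<in> bounded_partitions n (wt a)"
proof -
  have bound: "la \<in> bounded_partitions n (wt b)"
    if la: "is_partition la" "num_rows la \<le> n" and "mcoeff (schur_det (graded_exp c) n (shape n la)) b \<noteq> 0" for la c b
  proof -
    have "int (wt b) = (\<Sum>i=0..<n. int (shape n la i) - int i)"
      by (rule schur_det_graded_exp_homogeneous[OF that(3)])
    then have wt: "wt b = (\<Sum>i=0..<n. la (n - i))"
      by (simp add: shape_def flip: of_nat_sum)
    have "la i \<le> wt b" for i
    proof (cases "1 \<le> i \<and> i \<le> n")
      case True
      have "la (n - (n - i)) \<le> (\<Sum>i=0..<n. la (n - i))"
        using True by (intro member_le_sum[of "n - i" "{0..<n}" "\<lambda>i. la (n - i)"]) auto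
      then show ?thesis using True wt by simp
    next
      case False
      have "la i = 0"
      proof (cases "i = 0")
        case True
        then show ?thesis using la by (simp add: is_partition_def)
      next
        case False
        then show ?thesis using \<open>\<not> (1 \<le> i \<and> i \<le> n)\<close> partition_rows[OF la(1), of i] la(2) by auto
      qed
      then show ?thesis by simp
    qed
    then show ?thesis using la by (simp add: bounded_partitions_def)
  qed
  obtain b d where bd: "b + d = a"
    "mcoeff (schur ka t_var) b \<noteq> 0" "mcoeff (schur nu (\<lambda>i. - s_var i)) d \<noteq> 0"
    using nz by (auto simp: mcoeff_mult elim!: sum.not_neutral_contains_not_neutral)
  have "ka \<in> bounded_partitions n (wt b)"
    using bd(2) by (intro bound[OF ka, of t_ind]) (simp add: schur_eq_schur_det[OF ka] elem_schur_t_var)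
  moreover have "nu \<in> bounded_partitions n (wt d)"
    using bd(3) by (intro bound[OF nu, of s_ind]) (simp add: schur_eq_schur_det[OF nu] elem_schur_s_var)
  moreover have "wt b \<le> wt a" "wt d \<le> wt a" using bd(1) by (auto simp: weight_by_add)
  ultimately show "ka \<in> bounded_partitions n (wt a)" "nu \<in> bounded_partitions n (wt a)"
    by (auto simp: bounded_partitions_def intro: order_trans)
qed

theorem mainTheorem6:
  fixes H :: "(complex^'n^'n) measure"
    and p q :: nat and x y lam mu :: "nat \<Rightarrow> nat" and z :: complex
  assumes "normalized_haar H"
    and "strict_mono_on {1..CARD('n)} x" and "strict_mono_on {1..CARD('n)} y"
    and "is_partition lam" and "num_rows lam \<le> CARD('n)"
    and "is_partition mu" and "num_rows mu \<le> CARD('n)"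
    and "\<forall>j\<in>{1..CARD('n)}. int (lam (CARD('n) - j + 1)) = int (x j) - int j + 1"
    and "\<forall>j\<in>{1..CARD('n)}. int (mu (CARD('n) - j + 1)) = int (y j) - int j + 1"
  shows "(\<lambda>k. z ^ k / fact k * of_nat (b_coeff CARD('n) p q x y k)) sums a_coeff H p q lam mu z
    \<and> has_msum
        (\<lambda>(ka, nu). mconst (a_coeff H p q ka nu z) * schur ka t_var * schur nu (\<lambda>i. - s_var i))
        {(ka, nu). is_partition ka \<and> is_partition nu \<and> num_rows ka \<le> CARD('n) \<and> num_rows nu \<le> CARD('n)}
        (mintegral H (\<lambda>M. mconst (det_weight p q z M) * mexp (trace_exponent M)))"
proof
  let ?n = "CARD('n)"
  note H = assms(1)
  \<comment> \<open>The substitution \<open>j = i + 1\<close> turns the relation between partition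
    and positions into the formula for \<open>shape\<close>.\<close>
  have shape_eq: "shape ?n la i = u (Suc i)"
    if "\<forall>j\<in>{1..?n}. int (la (?n - j + 1)) = int (u j) - int j + 1" "i < ?n" for la u :: "nat \<Rightarrow> nat" and i
  proof -
    have "int (la (?n - Suc i + 1)) = int (u (Suc i)) - int (Suc i) + 1" using that by auto
    moreover have "?n - Suc i + 1 = ?n - i" using that(2) by simp
    ultimately show ?thesis by (simp add: shape_def)
  qed
  have "walk_gf z ?n p q x y = walk_integral H z p q (shape ?n lam) (shape ?n mu)"
    unfolding walk_gf_eq_integral[OF H assms(2,3)]
    by (rule walk_integral_cong) (use shape_eq[OF assms(8)] shape_eq[OF assms(9)] in auto)
  also have "\<dots> = a_coeff H p q lam mu z"
    by (rule a_coeff_eq[OF assms(4-7), symmetric])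
  finally show "(\<lambda>k. z ^ k / fact k * of_nat (b_coeff ?n p q x y k)) sums a_coeff H p q lam mu z"
    using sums_walk_gf[of z ?n p q x y] by simp
next
  let ?n = "CARD('n)"
  let ?I = "{(ka, nu). is_partition ka \<and> is_partition nu \<and> num_rows ka \<le> ?n \<and> num_rows nu \<le> ?n}"
  let ?f = "\<lambda>(ka, nu). mconst (a_coeff H p q ka nu z) * schur ka t_var * schur nu (\<lambda>i. - s_var i)"
  note H = assms(1)
  let ?B = "\<lambda>a. bounded_partitions ?n (wt a)"
  let ?R = "mintegral H (\<lambda>M. mconst (det_weight p q z M) * mexp (trace_exponent M))"
  have finB: "finite (?B a)" for a
    using bij_betw_finite[OF bij_betw_shape[of ?n "wt a"]] by simp
  have sub: "{i \<in> ?I. mcoeff (?f i) a \<noteq> 0} \<subseteq> ?B a \<times> ?B a" for a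
  proof
    fix i assume i: "i \<in> {i \<in> ?I. mcoeff (?f i) a \<noteq> 0}"
    then obtain ka nu where kn: "i = (ka, nu)" "is_partition ka" "num_rows ka \<le> ?n" "is_partition nu" "num_rows nu \<le> ?n"
      by auto
    have "mcoeff (schur ka t_var * schur nu (\<lambda>i. - s_var i)) a \<noteq> 0"
      using i unfolding kn(1) by (auto simp: mult.assoc)
    from schur_mult_coeff_bound[OF kn(2-5) this] show "i \<in> ?B a \<times> ?B a" by (simp add: kn(1))
  qed
  have "mcoeff ?R a = mcoeff (msum ?f ?I) a" for a
  proof -
    let ?X = "strict_seqs ?n (wt a + ?n)"
    let ?g = "\<lambda>x y. walk_integral H z p q x y
        * mcoeff (schur_det (elem_schur t_var) ?n x * schur_det (elem_schur (\<lambda>i. - s_var i)) ?n y) a"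
    let ?r = "\<lambda>ka. restrict (shape ?n ka) {0..<?n}"
    have g: "?g (?r ka) (?r nu) = mcoeff (?f (ka, nu)) a" if "ka \<in> ?B a" "nu \<in> ?B a" for ka nu
    proof -
      have ka: "is_partition ka" "num_rows ka \<le> ?n" and nu: "is_partition nu" "num_rows nu \<le> ?n"
        using that by (auto simp: bounded_partitions_def)
      have "schur_det (elem_schur t_var) ?n (?r ka) = schur ka t_var"
        unfolding schur_eq_schur_det[OF ka] by (rule schur_det_cong) simp
      moreover have "schur_det (elem_schur (\<lambda>i. - s_var i)) ?n (?r nu) = schur nu (\<lambda>i. - s_var i)"
        unfolding schur_eq_schur_det[OF nu] by (rule schur_det_cong) simp
      moreover have "walk_integral H z p q (?r ka) (?r nu) = a_coeff H p q ka nu z"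
        unfolding a_coeff_eq[OF ka nu] by (rule walk_integral_cong) simp_all
      ultimately show ?thesis by (simp add: mult.assoc)
    qed
    have "mcoeff ?R a = (\<Sum>x\<in>?X. \<Sum>y\<in>?X. ?g x y)" by (rule mintegral_coeff[OF H order_refl])
    also have "\<dots> = (\<Sum>ka\<in>?B a. \<Sum>nu\<in>?B a. ?g (?r ka) (?r nu))"
      by (simp only: sum.reindex_bij_betw[OF bij_betw_shape, symmetric])
    also have "\<dots> = (\<Sum>ka\<in>?B a. \<Sum>nu\<in>?B a. mcoeff (?f (ka, nu)) a)"
      by (intro sum.cong refl g)
    also have "\<dots> = (\<Sum>i\<in>?B a \<times> ?B a. mcoeff (?f i) a)"
      by (simp add: sum.cartesian_product case_prod_beta)
    \<comment> \<open>\<open>msum\<close> adds the nonzero coefficients only; by \<open>sub\<close>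
      they all come from pairs with parts at most \<open>wt a\<close>.\<close>
    also have "\<dots> = (\<Sum>i | i \<in> ?I \<and> mcoeff (?f i) a \<noteq> 0. mcoeff (?f i) a)"
    proof (rule sum.mono_neutral_right)
      show "finite (?B a \<times> ?B a)" using finB by simp
      show "{i. i \<in> ?I \<and> mcoeff (?f i) a \<noteq> 0} \<subseteq> ?B a \<times> ?B a" by (rule sub)
      show "\<forall>i\<in>?B a \<times> ?B a - {i. i \<in> ?I \<and> mcoeff (?f i) a \<noteq> 0}. mcoeff (?f i) a = 0"
        by (auto simp: bounded_partitions_def)
    qed
    finally show ?thesis by (simp add: msum_def)
  qed
  then have "?R = msum ?f ?I" by (rule mfps_eqI)
  moreover have "finite {i \<in> ?I. mcoeff (?f i) a \<noteq> 0}" for a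
    using finite_subset[OF sub] finB by blast
  ultimately show "has_msum ?f ?I ?R" unfolding has_msum_def by blast
qed

end
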